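(* The decision problem Bounded-Two-Stage$(\mathcal{X}_c,\mathcal{U}_d(x),\mathcal{Y}_c)$ is in $\Sigma_2^p$.
   Context: An instance consists of rational data encoded in binary: a bound $R\in\mathbb{Z}_+$, vectors $a\in\mathbb{Q}^{m_x}$, $b\in\mathbb{Q}^{m_u}$, matrices $A\in\mathbb{Q}^{m_x\times n_x}$, $W\in\mathbb{Q}^{m_y\times n_y}$, an $m_u\times n_u$ matrix $B(x)$ whose entries depend linearly on $x$ with rational coefficients, and an $m_y\times n_x$ matrix $T(u)$ whose entries depend linearly on $u$ with rational coefficients. Let $\mathcal{X}_c=\{x\in[0,R]^{n_x}: Ax\le a\}$, $\mathcal{U}_d(x)=\{u\in[0,R]^{n_u}\cap\mathbb{Z}^{n_u}: B(x)u\le b\}$, $\mathcal{Y}_c(x,u)=\{y\in[0,R]^{n_y}: T(u)x+Wy\le 0\}$. Bounded-Two-Stage$(\mathcal{X}_c,\mathcal{U}_d(x),\mathcal{Y}_c)$ is the decision problem $$\exists x\in\mathcal{X}_c\ \ \forall u\in\mathcal{U}_d(x)\ \ \exists y\in\mathcal{Y}_c(x,u)\,?$$ $\Sigma_2^p$ is the class of problems expressible as $\exists X\,\forall Y: P(I,X,Y)$, where $I$ is the instance, $X,Y$ range over objects of encoding length polynomial in that of $I$, and $P$ is decidable in polynomial time. *)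

theory Defs
  imports
    "HOL-Computational_Algebra.Polynomial"
    "Jordan_Normal_Form.Matrix"
begin

section \<open>Deterministic multitape Turing machines\<close>

text \<open>Tapes are infinite in both directions.  States and tape symbols are initial segments of the
  natural numbers; state 0 is the start state and symbol 0 is the blank.\<close>

datatype direction = Go_Left | Stay | Go_Right

type_synonym tape = "(int \<Rightarrow> nat) \<times> int"

type_synonym config = "nat \<times> tape list"

record tm =
  tape_count :: nat
  symbol_count :: nat
  state_count :: nat
  accept_state :: nat
  reject_state :: nat
  transition :: "nat \<Rightarrow> nat list \<Rightarrow> nat \<times> (nat \<times> direction) list"

text \<open>Four symbols are needed for the blank and the three input symbols.  The last conjunct makes
  the control finite: the transition function is only ever applied to arguments in range.\<close>

definition turing_machine :: "tm \<Rightarrow> bool" where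
  "turing_machine M \<longleftrightarrow>
     tape_count M \<ge> 1 \<and> symbol_count M \<ge> 4 \<and> state_count M \<ge> 1 \<and>
     accept_state M < state_count M \<and> reject_state M < state_count M \<and>
     accept_state M \<noteq> reject_state M \<and>
     (\<forall>q syms. q < state_count M \<and> length syms = tape_count M \<and> set syms \<subseteq> {..<symbol_count M} \<longrightarrow>
        (case transition M q syms of (q', acts) \<Rightarrow>
           q' < state_count M \<and> length acts = tape_count M \<and>
           (\<forall>(s, d) \<in> set acts. s < symbol_count M)))"

definition read_tape :: "tape \<Rightarrow> nat" where
  "read_tape tp = fst tp (snd tp)"

fun offset :: "direction \<Rightarrow> int" where
  "offset Go_Left = - 1"
| "offset Stay = 0"
| "offset Go_Right = 1"

fun act_on_tape :: "nat \<times> direction \<Rightarrow> tape \<Rightarrow> tape" where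
  "act_on_tape (s, d) (f, h) = (f(h := s), h + offset d)"

definition tm_step :: "tm \<Rightarrow> config \<Rightarrow> config" where
  "tm_step M c =
     (if fst c \<in> {accept_state M, reject_state M} then c
      else case transition M (fst c) (map read_tape (snd c)) of
        (q', acts) \<Rightarrow> (q', map2 act_on_tape acts (snd c)))"

fun input_symbol :: "bool option \<Rightarrow> nat" where
  "input_symbol None = 1"
| "input_symbol (Some False) = 2"
| "input_symbol (Some True) = 3"

definition blank_tape :: tape where
  "blank_tape = ((\<lambda>_. 0), 0)"

definition input_tape :: "bool option list \<Rightarrow> tape" where
  "input_tape w =
     ((\<lambda>i. if 0 \<le> i \<and> i < int (length w) then input_symbol (w ! nat i) else 0), 0)"

definition initial_config :: "tm \<Rightarrow> bool option list \<Rightarrow> config" where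
  "initial_config M w = (0, input_tape w # replicate (tape_count M - 1) blank_tape)"


section \<open>The class \<open>\<Sigma>\<^sub>2\<^sup>p\<close>\<close>

text \<open>Triples of bit strings are presented to a machine as one string with separator \<open>None\<close>.\<close>

definition triple_word :: "bool list \<Rightarrow> bool list \<Rightarrow> bool list \<Rightarrow> bool option list" where
  "triple_word I X Y = map Some I @ None # map Some X @ None # map Some Y"

text \<open>Halting configurations are fixed points of \<open>tm_step\<close>, so the condition below says that
  the machine halts with the correct answer after at most the stated number of steps.\<close>

definition polytime_decidable :: "(bool list \<Rightarrow> bool list \<Rightarrow> bool list \<Rightarrow> bool) \<Rightarrow> bool" where
  "polytime_decidable P \<longleftrightarrow>
     (\<exists>M (t :: nat poly). turing_machine M \<and>
        (\<forall>I X Y.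
           fst ((tm_step M ^^ poly t (length (triple_word I X Y)))
                  (initial_config M (triple_word I X Y))) =
           (if P I X Y then accept_state M else reject_state M)))"

definition Sigma2p :: "bool list set set" where
  "Sigma2p = {L. \<exists>P (p :: nat poly). polytime_decidable P \<and>
     (\<forall>I. I \<in> L \<longleftrightarrow>
        (\<exists>X. length X \<le> poly p (length I) \<and>
          (\<forall>Y. length Y \<le> poly p (length I) \<longrightarrow> P I X Y)))}"


section \<open>Two-stage instances\<close>

text \<open>The matrix \<open>B(x)\<close> is given by the coefficient matrices \<open>B\<^sub>k\<close> in
  \<open>B(x) = (\<Sum>k<n\<^sub>x. x\<^sub>k B\<^sub>k)\<close>, and likewise \<open>T(u)\<close>.\<close>

record two_stage =
  bound :: nat
  nx :: nat
  nu :: nat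
  ny :: nat
  mx :: nat
  mu :: nat
  my :: nat
  rhs_a :: "rat vec"
  rhs_b :: "rat vec"
  mat_A :: "rat mat"
  mat_W :: "rat mat"
  coeffs_B :: "rat mat list"
  coeffs_T :: "rat mat list"

definition two_stage_instance :: "two_stage \<Rightarrow> bool" where
  "two_stage_instance I \<longleftrightarrow>
     rhs_a I \<in> carrier_vec (mx I) \<and>
     rhs_b I \<in> carrier_vec (mu I) \<and>
     mat_A I \<in> carrier_mat (mx I) (nx I) \<and>
     mat_W I \<in> carrier_mat (my I) (ny I) \<and>
     length (coeffs_B I) = nx I \<and> set (coeffs_B I) \<subseteq> carrier_mat (mu I) (nu I) \<and>
     length (coeffs_T I) = nu I \<and> set (coeffs_T I) \<subseteq> carrier_mat (my I) (nx I)"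

abbreviation real_vec :: "rat vec \<Rightarrow> real vec" where
  "real_vec \<equiv> map_vec real_of_rat"

abbreviation real_mat :: "rat mat \<Rightarrow> real mat" where
  "real_mat \<equiv> map_mat real_of_rat"

definition matrix_B :: "two_stage \<Rightarrow> real vec \<Rightarrow> real mat" where
  "matrix_B I x =
     mat (mu I) (nu I) (\<lambda>(i, j). \<Sum>k<nx I. real_of_rat (coeffs_B I ! k $$ (i, j)) * x $ k)"

definition matrix_T :: "two_stage \<Rightarrow> real vec \<Rightarrow> real mat" where
  "matrix_T I u =
     mat (my I) (nx I) (\<lambda>(i, j). \<Sum>k<nu I. real_of_rat (coeffs_T I ! k $$ (i, j)) * u $ k)"

definition vec_box :: "nat \<Rightarrow> nat \<Rightarrow> real vec set" where
  "vec_box R n = {v \<in> carrier_vec n. \<forall>i<n. 0 \<le> v $ i \<and> v $ i \<le> real R}"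

definition set_X :: "two_stage \<Rightarrow> real vec set" where
  "set_X I = {x \<in> vec_box (bound I) (nx I). real_mat (mat_A I) *\<^sub>v x \<le> real_vec (rhs_a I)}"

definition set_U :: "two_stage \<Rightarrow> real vec \<Rightarrow> real vec set" where
  "set_U I x =
     {u \<in> vec_box (bound I) (nu I). (\<forall>i<nu I. u $ i \<in> \<int>) \<and> matrix_B I x *\<^sub>v u \<le> real_vec (rhs_b I)}"

definition set_Y :: "two_stage \<Rightarrow> real vec \<Rightarrow> real vec \<Rightarrow> real vec set" where
  "set_Y I x u =
     {y \<in> vec_box (bound I) (ny I). matrix_T I u *\<^sub>v x + real_mat (mat_W I) *\<^sub>v y \<le> 0\<^sub>v (my I)}"

definition two_stage_yes :: "two_stage \<Rightarrow> bool" where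
  "two_stage_yes I \<longleftrightarrow> (\<exists>x \<in> set_X I. \<forall>u \<in> set_U I x. \<exists>y. y \<in> set_Y I x u)"


section \<open>Binary encoding of instances\<close>

text \<open>Binary digits come least significant first, without leading zeros.  Each digit is preceded
  by \<open>True\<close> and the number is closed by \<open>False\<close>, which makes the code prefix-free.\<close>

fun binary_digits :: "nat \<Rightarrow> bool list" where
  "binary_digits 0 = []"
| "binary_digits (Suc n) = odd (Suc n) # binary_digits (Suc n div 2)"

definition encode_nat :: "nat \<Rightarrow> bool list" where
  "encode_nat n = concat (map (\<lambda>d. [True, d]) (binary_digits n)) @ [False]"

definition encode_int :: "int \<Rightarrow> bool list" where
  "encode_int z = (z < 0) # encode_nat (nat \<bar>z\<bar>)"

text \<open>A rational is encoded by its numerator and positive denominator in lowest terms.\<close>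

definition encode_rat :: "rat \<Rightarrow> bool list" where
  "encode_rat r = (case quotient_of r of (p, q) \<Rightarrow> encode_int p @ encode_nat (nat q))"

definition encode_vec :: "rat vec \<Rightarrow> bool list" where
  "encode_vec v = concat (map encode_rat (list_of_vec v))"

definition encode_mat :: "rat mat \<Rightarrow> bool list" where
  "encode_mat A = concat (map encode_vec (rows A))"

text \<open>Dimensions are written in unary, because the size of an instance is at least its number of
  variables and constraints, even if a matrix without rows or columns contributes no entries.\<close>

definition encode_dim :: "nat \<Rightarrow> bool list" where
  "encode_dim n = replicate n True @ [False]"

definition encode_two_stage :: "two_stage \<Rightarrow> bool list" where
  "encode_two_stage I =
     encode_dim (nx I) @ encode_dim (nu I) @ encode_dim (ny I) @
     encode_dim (mx I) @ encode_dim (mu I) @ encode_dim (my I) @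
     encode_nat (bound I) @
     encode_vec (rhs_a I) @ encode_vec (rhs_b I) @
     encode_mat (mat_A I) @ encode_mat (mat_W I) @
     concat (map encode_mat (coeffs_B I)) @ concat (map encode_mat (coeffs_T I))"

definition Bounded_Two_Stage :: "bool list set" where
  "Bounded_Two_Stage = {encode_two_stage I | I. two_stage_instance I \<and> two_stage_yes I}"

end

theory Submission
  imports Defs "Jordan_Normal_Form.Determinant"
begin

text \<open>Fix a first-stage solution and record for every scenario either a violated inequality of
  \<open>B(x) u \<le> b\<close> or the fact that all dual inequalities hold that express the existence of a recourse.
  The dual inequalities come from the vertices of a polytope that does not depend on \<open>x\<close> and \<open>u\<close>, so by Cramer's
  rule they have coefficients of polynomial length.  Hence the first-stage solutions with the same record are
  described by strict and weak inequalities of polynomial length, exponentially many of them, and contain a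
  rational point of polynomial length.  That point is guessed as \<open>X\<close>, and \<open>Y\<close> ranges over scenarios together
  with dual multipliers that refute the existence of a recourse; so no linear program has to be solved.

  What remains to be checked are comparisons of sums of products of binary numbers.  The digits of such a sum are
  first computed without carries, as polynomially bounded numbers, and the carries of a comparison are
  polynomially bounded too.  A machine therefore needs only finitely many counters bounded by a polynomial,
  and these are represented by head positions on copies of the input.\<close>

section \<open>Counter programs\<close>

text \<open>Exponentially many constraints do no harm because a vertex solves a nonsingular system
  of \<open>n\<close> of them: the size of its coordinates depends on \<open>n\<close> and on the
  size of single coefficients, not on the number of rows. The loads are real, but they enter the
  dual program only through its objective, which Cramer's rule never sees. Two computations are
  avoided. A common denominator of all entries is a product of unboundedly many numbers, while the
  arithmetic offers only binary products and indexed sums; so \<open>X\<close> also contains a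
  common denominator and the scaled numerators, checked by cross-multiplication. Instances are
  encoded in lowest terms, but no gcd is computed: a universally quantified \<open>Y\<close> would
  exhibit a common divisor. With input length \<open>L\<close> the bit bounds are
  \<open>3 * L^2\<close> for dual multipliers, \<open>9 * L^2\<close> for coefficients of the
  first-stage system and \<open>10 * L^3\<close> for its vertex.\<close>

datatype com =
    Skip | Inc nat | Dec nat | Seq com com | Cond nat "nat set" com com | Loop nat "nat set" com

fun variables :: "com \<Rightarrow> nat set" where
  "variables Skip = {}"
| "variables (Inc v) = {v}"
| "variables (Dec v) = {v}"
| "variables (Seq c d) = variables c \<union> variables d"
| "variables (Cond v S c d) = insert v (variables c \<union> variables d)"
| "variables (Loop v S c) = insert v (variables c)"

text \<open>The command that is left after one step. It depends on the counters only through the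
  symbols \<open>r v\<close> under the heads, so it can be kept in a finite control. Passing from
  \<open>Seq Skip d\<close> to \<open>d\<close> costs a step of its own.\<close>

fun residual :: "(nat \<Rightarrow> nat) \<Rightarrow> com \<Rightarrow> com" where
  "residual r (Seq c d) = (if c = Skip then d else Seq (residual r c) d)"
| "residual r (Cond v S c d) = (if r v \<in> S then c else d)"
| "residual r (Loop v S c) = (if r v \<in> S then Seq c (Loop v S c) else Skip)"
| "residual r _ = Skip"

text \<open>\<open>Dec\<close> is truncated: a symbol of at least 4 marks position 0, and there the
  head stays.\<close>

fun move :: "(nat \<Rightarrow> nat) \<Rightarrow> com \<Rightarrow> nat \<Rightarrow> direction" where
  "move r (Inc u) v = (if v = u then Go_Right else Stay)"
| "move r (Dec u) v = (if v = u \<and> r v < 4 then Go_Left else Stay)"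
| "move r (Seq c d) v = (if c = Skip then Stay else move r c v)"
| "move r _ v = Stay"

fun shift :: "direction \<Rightarrow> nat \<Rightarrow> nat" where
  "shift Go_Left n = n - 1"
| "shift Stay n = n"
| "shift Go_Right n = Suc n"

text \<open>In a nonempty word exactly position 0 carries a symbol of at least 4, which turns
  reading into a zero test; the blank shows that a counter has reached the length of the
  word.\<close>

definition cell :: "bool option list \<Rightarrow> nat \<Rightarrow> nat" where
  "cell w n = (if n < length w then input_symbol (w ! n) + (if n = 0 then 4 else 0) else 0)"

definition com_step :: "bool option list \<Rightarrow> com \<times> (nat \<Rightarrow> nat) \<Rightarrow> com \<times> (nat \<Rightarrow> nat)" where
  "com_step w = (\<lambda>(c, s). let r = (\<lambda>v. cell w (s v)) in (residual r c, \<lambda>v. shift (move r c v) (s v)))"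

fun steps :: "bool option list \<Rightarrow> nat \<Rightarrow> com \<times> (nat \<Rightarrow> nat) \<Rightarrow> com \<times> (nat \<Rightarrow> nat) \<Rightarrow> bool" where
  "steps w 0 x y \<longleftrightarrow> x = y"
| "steps w (Suc n) x y \<longleftrightarrow> fst x \<noteq> Skip \<and> steps w n (com_step w x) y"

lemma input_symbol_bounds: "1 \<le> input_symbol b" "input_symbol b \<le> 3"
  by (cases b; simp; case_tac a; simp)+

lemma cell_less: "cell w n < 8"
  using input_symbol_bounds(2)[of "w ! n"] by (auto simp: cell_def)

lemma cell_zero_iff: "w \<noteq> [] \<Longrightarrow> 4 \<le> cell w n \<longleftrightarrow> n = 0"
  using input_symbol_bounds(2)[of "w ! n"] by (auto simp: cell_def)

lemma move_left: "move r c v = Go_Left \<Longrightarrow> r v < 4"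
  by (induction c) (auto split: if_splits)

text \<open>Together with \<open>move_cong\<close>: a step depends only on the heads of the counters
  that the program mentions, so finitely many tapes suffice.\<close>

lemma residual_cong:
  "variables c \<subseteq> V \<Longrightarrow> (\<And>v. v \<in> V \<Longrightarrow> r v = r' v) \<Longrightarrow> residual r c = residual r' c"
  by (induction c) auto

lemma move_cong: "r v = r' v \<Longrightarrow> move r c v = move r' c v"
  by (induction c) auto

lemma finite_variables: "finite (variables c)"
  by (induction c) auto

text \<open>A finite set containing the program and closed under \<open>residual\<close>; it
  supplies the states of the machine.\<close>

fun reach :: "com \<Rightarrow> com set" where
  "reach (Seq c d) = (\<lambda>e. Seq e d) ` reach c \<union> reach d"
| "reach (Cond v S c d) = insert (Cond v S c d) (reach c \<union> reach d)"
| "reach (Loop v S c) = {Loop v S c, Skip} \<union> (\<lambda>e. Seq e (Loop v S c)) ` reach c"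
| "reach c = {c, Skip}"

lemma reach_refl: "c \<in> reach c"
  by (induction c) auto

lemma finite_reach: "finite (reach c)"
  by (induction c) auto

lemma reach_residual: "e \<in> reach c \<Longrightarrow> residual r e \<in> reach c"
  by (induction c arbitrary: e) (auto simp: reach_refl split: if_splits)

lemma variables_reach: "e \<in> reach c \<Longrightarrow> variables e \<subseteq> variables c"
  by (induction c arbitrary: e) fastforce+


section \<open>Compilation to Turing machines\<close>

text \<open>Every tape first receives a copy of the input word, whose leftmost symbol is then marked by
  adding 4.  Afterwards nothing is written any more: the value of counter \<open>v\<close> is
  the head position on tape \<open>v\<close>.\<close>

datatype phase = Copy | Rewind | Mark | Exec com | Accept | Reject

text \<open>Tape 0 alone steers copying and rewinding. Adding 4 is capped at 7 so that symbols which
  never occur in this phase also lead to legal ones. Acceptance means that counter 0 is nonzero at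
  the end.\<close>

fun delta :: "com \<Rightarrow> phase \<Rightarrow> (nat \<Rightarrow> nat) \<Rightarrow> phase \<times> (nat \<Rightarrow> nat \<times> direction)" where
  "delta c Copy r =
     (if r 0 \<noteq> 0 then (Copy, \<lambda>_. (r 0, Go_Right)) else (Rewind, \<lambda>v. (r v, Go_Left)))"
| "delta c Rewind r =
     (if r 0 \<noteq> 0 then (Rewind, \<lambda>v. (r v, Go_Left)) else (Mark, \<lambda>v. (r v, Go_Right)))"
| "delta c Mark r = (Exec c, \<lambda>v. (min 7 (r v + 4), Stay))"
| "delta c (Exec d) r =
     (if d = Skip then (if r 0 \<ge> 4 then Reject else Accept, \<lambda>v. (r v, Stay))
      else (Exec (residual r d), \<lambda>v. (r v, move r d v)))"
| "delta c Accept r = (Accept, \<lambda>v. (r v, Stay))"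
| "delta c Reject r = (Reject, \<lambda>v. (r v, Stay))"

definition phases :: "com \<Rightarrow> phase set" where
  "phases c = {Copy, Rewind, Mark, Accept, Reject} \<union> Exec ` reach c"

lemma delta_phases: "q \<in> phases c \<Longrightarrow> fst (delta c q r) \<in> phases c"
  by (cases q) (auto simp: phases_def reach_refl reach_residual)

lemma delta_symbol: "(\<And>v. r v < 8) \<Longrightarrow> fst (snd (delta c q r) v) < 8"
  by (cases q) auto

lemma delta_cong:
  assumes "q \<in> phases c" "variables c \<subseteq> {..<k}" "\<And>v. v < k \<Longrightarrow> r v = r' v" "0 < k"
  shows "fst (delta c q r) = fst (delta c q r')"
    and "v < k \<Longrightarrow> snd (delta c q r) v = snd (delta c q r') v"
proof -
  have res: "residual r d = residual r' d" if "q = Exec d" for d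
    using that assms variables_reach[of d c]
    by (intro residual_cong[of _ "{..<k}"]) (auto simp: phases_def)
  have mv: "v < k \<Longrightarrow> move r d v = move r' d v" for d v
    using assms(3) by (intro move_cong) auto
  show "fst (delta c q r) = fst (delta c q r')"
    using assms(3,4) res by (cases q) auto
  show "v < k \<Longrightarrow> snd (delta c q r) v = snd (delta c q r') v"
    using assms(3,4) mv by (cases q) auto
qed

definition base_content :: "bool option list \<Rightarrow> int \<Rightarrow> nat" where
  "base_content w i = (if 0 \<le> i \<and> i < int (length w) then input_symbol (w ! nat i) else 0)"

definition marked_content :: "bool option list \<Rightarrow> int \<Rightarrow> nat" where
  "marked_content w i = (if 0 \<le> i then cell w (nat i) else 0)"

text \<open>The overhead \<open>2 * length w + 4\<close> consists of copying, rewinding and one step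
  for leaving each of the phases \<open>Copy\<close>, \<open>Rewind\<close>, \<open>Mark\<close> and
  \<open>Exec\<close>.\<close>

lemma com_to_tm:
  assumes vars: "variables c \<subseteq> {..<k}" and k: "0 < k"
  shows "\<exists>M. turing_machine M \<and> (\<forall>w s t n. w \<noteq> [] \<longrightarrow> steps w t (c, \<lambda>_. 0) (Skip, s) \<longrightarrow>
      2 * length w + 4 + t \<le> n \<longrightarrow>
      fst ((tm_step M ^^ n) (initial_config M w)) =
        (if s 0 \<noteq> 0 then accept_state M else reject_state M))"
proof -
  have "finite (phases c - {Copy})"
    by (simp add: phases_def finite_reach)
  from finite_distinct_list[OF this] obtain ps where ps: "set ps = phases c - {Copy}" "distinct ps"
    by (elim exE conjE)
  \<comment> \<open>\<open>Copy\<close> is put in front because state 0 is the start state.\<close>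
  define qs where "qs = Copy # ps"
  have qs: "set qs = phases c" "distinct qs" "qs ! 0 = Copy"
    using ps by (auto simp: qs_def phases_def)
  define idx where "idx q = (LEAST i. i < length qs \<and> qs ! i = q)" for q
  have idx: "idx q < length qs" "qs ! idx q = q" if q: "q \<in> phases c" for q
  proof -
    have "\<exists>i. i < length qs \<and> qs ! i = q"
      using q qs(1) by (metis in_set_conv_nth)
    then have "idx q < length qs \<and> qs ! idx q = q"
      unfolding idx_def by (rule LeastI_ex)
    then show "idx q < length qs" "qs ! idx q = q" by auto
  qed
  have idx_inj: "idx q = idx q' \<Longrightarrow> q = q'" if "q \<in> phases c" "q' \<in> phases c" for q q'
    using idx(2) that by metis
  have idx0: "idx Copy = 0"
    unfolding idx_def using qs(3) by (intro Least_equality) (auto simp: qs_def)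
  \<comment> \<open>The list of read symbols is extended by 0 to a function on all counters; by
    \<open>delta_cong\<close> the values from \<open>k\<close> on have no influence.\<close>
  define M where "M = \<lparr>tape_count = k, symbol_count = 8, state_count = length qs,
     accept_state = idx Accept, reject_state = idx Reject,
     transition = (\<lambda>q syms. let d = delta c (qs ! q) (\<lambda>v. if v < k then syms ! v else 0)
        in (idx (fst d), map (snd d) [0..<k]))\<rparr>"
  have ph: "Copy \<in> phases c" "Rewind \<in> phases c" "Mark \<in> phases c" "Accept \<in> phases c" "Reject \<in> phases c"
    by (auto simp: phases_def)
  have AR: "idx Accept \<noteq> idx Reject"
    using idx_inj[of Accept Reject] ph by auto
  have tm: "turing_machine M"
    unfolding turing_machine_def
  proof (intro conjI allI impI)
    fix q syms
    assume a: "q < state_count M \<and> length syms = tape_count M \<and> set syms \<subseteq> {..<symbol_count M}"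
    let ?r = "\<lambda>v. if v < k then syms ! v else 0"
    have q: "qs ! q \<in> phases c" using a qs(1) by (auto simp: M_def)
    have "syms ! v < 8" if "v < k" for v
    proof -
      have "syms ! v \<in> set syms" using a that by (simp add: M_def)
      then have "syms ! v \<in> {..<8}" using a by (simp add: M_def subset_eq)
      then show ?thesis by simp
    qed
    then have sym: "fst (snd (delta c (qs ! q) ?r) v) < 8" for v
      by (intro delta_symbol) auto
    have "\<forall>(s, d)\<in>set (map (snd (delta c (qs ! q) ?r)) [0..<k]). s < 8"
    proof clarify
      fix s d assume "(s, d) \<in> set (map (snd (delta c (qs ! q) ?r)) [0..<k])"
      then obtain v where "snd (delta c (qs ! q) ?r) v = (s, d)" by auto
      then show "s < 8" using sym[of v] by simp
    qed
    then show "case transition M q syms of (q', acts) \<Rightarrow>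
           q' < state_count M \<and> length acts = tape_count M \<and>
           (\<forall>(s, d)\<in>set acts. s < symbol_count M)"
      using idx(1)[OF delta_phases[OF q, of ?r]] by (simp add: M_def Let_def)
  qed (use k idx(1) ph AR in \<open>simp_all add: M_def qs_def Suc_le_eq\<close>)
  define cfg where "cfg q T = (idx q, map T [0..<k])" for q and T :: "nat \<Rightarrow> tape"
  have step: "tm_step M (cfg q T) =
      cfg (fst (delta c q (\<lambda>v. read_tape (T v)))) (\<lambda>v. act_on_tape (snd (delta c q (\<lambda>v. read_tape (T v))) v) (T v))"
    if q: "q \<in> phases c" "q \<noteq> Accept" "q \<noteq> Reject" for q T
  proof -
    let ?r = "\<lambda>v. read_tape (T v)"
    let ?r' = "\<lambda>v. if v < k then map read_tape (map T [0..<k]) ! v else 0"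
    have "?r' v = ?r v" if "v < k" for v using that by simp
    note cong = delta_cong[OF q(1) vars this k]
    have "idx q \<noteq> idx Accept" "idx q \<noteq> idx Reject"
      using idx_inj ph q by blast+
    then have "tm_step M (cfg q T) = (idx (fst (delta c q ?r')),
        map2 act_on_tape (map (snd (delta c q ?r')) [0..<k]) (map T [0..<k]))"
      using idx(2)[OF q(1)] by (simp add: tm_step_def cfg_def M_def Let_def del: map_map)
    also have "\<dots> = (idx (fst (delta c q ?r)),
        map2 act_on_tape (map (snd (delta c q ?r)) [0..<k]) (map T [0..<k]))"
      using cong by (auto intro!: arg_cong[where f = "\<lambda>x. map2 act_on_tape x (map T [0..<k])"])
    also have "map2 act_on_tape (map (snd (delta c q ?r)) [0..<k]) (map T [0..<k]) =
        map (\<lambda>v. act_on_tape (snd (delta c q ?r) v) (T v)) [0..<k]"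
      by (intro nth_equalityI) auto
    finally show ?thesis by (simp add: cfg_def)
  qed
  have main: "fst ((tm_step M ^^ n) (initial_config M w)) =
        (if s 0 \<noteq> 0 then accept_state M else reject_state M)"
    if w: "w \<noteq> []" and run: "steps w t (c, \<lambda>_. 0) (Skip, s)" and n: "2 * length w + 4 + t \<le> n"
    for w s t n
  proof -
    let ?b = "base_content w"
    \<comment> \<open>\<open>T1 j\<close>: the first \<open>j\<close> cells have been copied, tape 0
      being complete from the start. \<open>T2 i\<close>: all tapes hold the word and all heads are
      at \<open>i\<close>. \<open>T3 s\<close>: the first cells are marked and the heads show the
      counters \<open>s\<close>.\<close>
    define T1 where "T1 j = (\<lambda>v :: nat. ((\<lambda>i. if v = 0 \<or> i < int j then ?b i else 0), int j))" for j :: nat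
    define T2 where "T2 i = (\<lambda>v :: nat. (?b, i))" for i :: int
    define T3 where "T3 s = (\<lambda>v :: nat. (marked_content w, int (s v)))" for s :: "nat \<Rightarrow> nat"
    have init: "initial_config M w = cfg Copy (T1 0)"
    proof -
      have "input_tape w # replicate (k - 1) blank_tape = map (T1 0) [0..<k]"
        using k by (intro nth_equalityI) (auto simp: nth_Cons' T1_def input_tape_def blank_tape_def base_content_def)
      then show ?thesis by (simp add: initial_config_def cfg_def idx0) (simp add: M_def)
    qed
    have nz: "?b i = 0 \<longleftrightarrow> \<not> (0 \<le> i \<and> i < int (length w))" for i
      using input_symbol_bounds(1)[of "w ! nat i"] by (auto simp: base_content_def)
    have copy: "(tm_step M ^^ j) (cfg Copy (T1 0)) = cfg Copy (T1 j)" if "j \<le> length w" for j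
      using that
    proof (induction j)
      case (Suc j)
      have r: "read_tape (T1 j 0) = ?b (int j)" by (simp add: read_tape_def T1_def)
      have "act_on_tape (?b (int j), Go_Right) (T1 j v) = T1 (Suc j) v" for v
        by (auto simp: T1_def)
      then show ?case
        using Suc step[OF ph(1), of "T1 j"] nz[of "int j"] by (simp add: r)
    qed simp
    have c2: "tm_step M (cfg Copy (T1 (length w))) = cfg Rewind (T2 (int (length w) - 1))"
    proof -
      have r: "read_tape (T1 (length w) 0) = 0" using nz by (simp add: read_tape_def T1_def)
      have "act_on_tape (read_tape (T1 (length w) v), Go_Left) (T1 (length w) v) = T2 (int (length w) - 1) v" for v
        using nz by (auto simp: T1_def T2_def read_tape_def fun_eq_iff)
      then show ?thesis using step[OF ph(1), of "T1 (length w)"] by (simp add: r)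
    qed
    have wind: "act_on_tape (read_tape (T2 i v), d) (T2 i v) = T2 (i + offset d) v" for i d v
      by (simp add: T2_def read_tape_def)
    have r2: "read_tape (T2 i 0) = ?b i" for i
      by (simp add: T2_def read_tape_def)
    have rew: "(tm_step M ^^ j) (cfg Rewind (T2 (int (length w) - 1))) = cfg Rewind (T2 (int (length w) - 1 - int j))"
      if "j \<le> length w" for j
      using that
    proof (induction j)
      case (Suc j)
      have "tm_step M (cfg Rewind (T2 (int (length w) - 1 - int j))) = cfg Rewind (T2 (int (length w) - 1 - int (Suc j)))"
        using Suc.prems step[OF ph(2), of "T2 (int (length w) - 1 - int j)"] nz[of "int (length w) - 1 - int j"]
        by (simp add: wind r2 algebra_simps)
      then show ?case using Suc by simp
    qed simp
    have c3: "tm_step M (cfg Rewind (T2 (- 1))) = cfg Mark (T2 0)"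
      using step[OF ph(2), of "T2 (- 1)"] nz[of "- 1"] by (simp add: wind r2)
    have b0: "min 7 (?b 0 + 4) = marked_content w 0"
      using w input_symbol_bounds(2)[of "w ! 0"] by (simp add: base_content_def marked_content_def cell_def)
    have b1: "i \<noteq> 0 \<Longrightarrow> ?b i = marked_content w i" for i
      by (auto simp: base_content_def marked_content_def cell_def)
    have c4: "tm_step M (cfg Mark (T2 0)) = cfg (Exec c) (T3 (\<lambda>_. 0))"
    proof -
      have "act_on_tape (min 7 (read_tape (T2 0 v) + 4), Stay) (T2 0 v) = T3 (\<lambda>_. 0) v" for v
        using b0 b1 by (auto simp: T2_def T3_def read_tape_def)
      then show ?thesis using step[OF ph(3), of "T2 0"] by simp
    qed
    have c5: "(tm_step M ^^ t) (cfg (Exec d) (T3 s')) = cfg (Exec d') (T3 s'')"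
      if "steps w t (d, s') (d', s'')" "d \<in> reach c" for t d d' s' s''
      using that
    proof (induction t arbitrary: d s')
      case (Suc t)
      let ?r = "\<lambda>v. cell w (s' v)"
      let ?s = "\<lambda>v. shift (move ?r d v) (s' v)"
      have r: "(\<lambda>v. read_tape (T3 s' v)) = ?r"
        by (auto simp: read_tape_def T3_def marked_content_def)
      have mv: "int (s' v) + offset (move ?r d v) = int (?s v)" for v
        using move_left[of ?r d v] cell_zero_iff[OF w, of "s' v"]
        by (cases "move ?r d v") auto
      have "act_on_tape (?r v, move ?r d v) (T3 s' v) = T3 ?s v" for v
        using mv[of v] by (simp add: T3_def marked_content_def fun_upd_idem)
      then have "tm_step M (cfg (Exec d) (T3 s')) = cfg (Exec (residual ?r d)) (T3 ?s)"
        using step[of "Exec d" "T3 s'"] Suc.prems by (simp add: phases_def r)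
      moreover have "(tm_step M ^^ t) (cfg (Exec (residual ?r d)) (T3 ?s)) = cfg (Exec d') (T3 s'')"
        using Suc.prems reach_residual[of d c ?r] by (intro Suc.IH) (auto simp: com_step_def Let_def)
      ultimately show ?case by (simp add: funpow_swap1)
    qed simp
    have sk: "Exec Skip \<in> phases c"
    proof -
      have "d' \<in> reach c" if "steps w t (d, s') (d', s'')" "d \<in> reach c" for t d d' s' s''
        using that by (induction t arbitrary: d s') (auto simp: com_step_def Let_def intro: reach_residual)
      then show ?thesis using run reach_refl by (auto simp: phases_def)
    qed
    let ?e = "if s 0 \<noteq> 0 then Accept else Reject"
    have c6: "\<exists>T. tm_step M (cfg (Exec Skip) (T3 s)) = cfg ?e T"
      using sk cell_zero_iff[OF w, of "s 0"]
      by (subst step) (auto simp: read_tape_def T3_def marked_content_def)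
    have chain: "(tm_step M ^^ (a + b)) x = z" if "(tm_step M ^^ a) x = y" "(tm_step M ^^ b) y = z" for a b x y z
      using that funpow_add[of b a "tm_step M"] by (simp add: add.commute)
    have one: "tm_step M x = y \<Longrightarrow> (tm_step M ^^ 1) x = y" for x y by simp
    have rew': "(tm_step M ^^ length w) (cfg Rewind (T2 (int (length w) - 1))) = cfg Rewind (T2 (- 1))"
      using rew[of "length w"] by simp
    obtain T where T: "tm_step M (cfg (Exec Skip) (T3 s)) = cfg ?e T" using c6 by blast
    have "(tm_step M ^^ (length w + (1 + (length w + (1 + (1 + (t + 1))))))) (initial_config M w) = cfg ?e T"
      unfolding init
      by (rule chain[OF copy[OF order_refl] chain[OF one[OF c2] chain[OF rew' chain[OF one[OF c3]
            chain[OF one[OF c4] chain[OF c5[OF run reach_refl] one[OF T]]]]]]])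
    \<comment> \<open>Halting configurations are fixed points, which fills up the remaining steps
      until \<open>n\<close>.\<close>
    moreover have fp: "(tm_step M ^^ j) (cfg ?e T) = cfg ?e T" for j
      by (induction j) (auto simp: tm_step_def cfg_def M_def)
    ultimately have "(tm_step M ^^ ((length w + (1 + (length w + (1 + (1 + (t + 1)))))) +
        (n - (2 * length w + 4 + t)))) (initial_config M w) = cfg ?e T"
      by (rule chain)
    moreover have "(length w + (1 + (length w + (1 + (1 + (t + 1)))))) + (n - (2 * length w + 4 + t)) = n"
      using n by simp
    ultimately have "(tm_step M ^^ n) (initial_config M w) = cfg ?e T" by (simp only:)
    then show ?thesis by (simp add: cfg_def M_def)
  qed
  show ?thesis using tm main by blast
qed


section \<open>Timed runs of counter programs and elementary operations on counters\<close>

type_synonym inp = "bool list \<times> bool list \<times> bool list"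
type_synonym env = "nat \<Rightarrow> nat"

definition word :: "inp \<Rightarrow> bool option list" where
  "word z = (case z of (I, X, Y) \<Rightarrow> triple_word I X Y)"

lemma word_nonempty [simp]: "word z \<noteq> []"
  by (auto simp: word_def triple_word_def split: prod.split)

definition runs :: "bool option list \<Rightarrow> com \<Rightarrow> env \<Rightarrow> nat \<Rightarrow> env \<Rightarrow> bool" where
  "runs w c s T s' \<longleftrightarrow> (\<exists>t\<le>T. steps w t (c, s) (Skip, s'))"

lemma steps_trans: "steps w m x y \<Longrightarrow> steps w n y z \<Longrightarrow> steps w (m + n) x z"
  by (induction m arbitrary: x) auto

lemma steps_Seq: "steps w n (c, s) (c', s') \<Longrightarrow> steps w n (Seq c d, s) (Seq c' d, s')"
  by (induction n arbitrary: c s) (auto simp: com_step_def Let_def)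

lemma runs_mono: "runs w c s T s' \<Longrightarrow> T \<le> T' \<Longrightarrow> runs w c s T' s'"
  unfolding runs_def by (meson order_trans)

lemma runs_first: "c \<noteq> Skip \<Longrightarrow> com_step w (c, s) = (c', s1) \<Longrightarrow> runs w c' s1 T s' \<Longrightarrow> runs w c s (T + 1) s'"
  unfolding runs_def by (metis Suc_eq_plus1 Suc_le_mono fst_conv steps.simps(2))

lemma runs_Skip: "runs w Skip s T s"
  unfolding runs_def by (intro exI[of _ 0]) auto

lemma runs_Inc: "runs w (Inc v) s 1 (s(v := Suc (s v)))"
  using runs_first[OF _ _ runs_Skip[of _ _ 0], of "Inc v" w s "s(v := Suc (s v))"]
  by (force simp: com_step_def fun_eq_iff)

lemma runs_Dec: "w \<noteq> [] \<Longrightarrow> runs w (Dec v) s 1 (s(v := s v - 1))"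
  using runs_first[OF _ _ runs_Skip[of _ _ 0], of "Dec v" w s "s(v := s v - 1)"] cell_zero_iff[of w "s v"]
  by (force simp: com_step_def fun_eq_iff)

lemma runs_Seq: "runs w c s T1 s1 \<Longrightarrow> runs w d s1 T2 s2 \<Longrightarrow> runs w (Seq c d) s (T1 + T2 + 1) s2"
proof -
  assume "runs w c s T1 s1" "runs w d s1 T2 s2"
  then obtain t1 t2 where t: "t1 \<le> T1" "t2 \<le> T2" "steps w t1 (c, s) (Skip, s1)" "steps w t2 (d, s1) (Skip, s2)"
    by (auto simp: runs_def)
  have "steps w (Suc t2) (Seq Skip d, s1) (Skip, s2)"
    using t(4) by (simp add: com_step_def)
  then have "steps w (t1 + Suc t2) (Seq c d, s) (Skip, s2)"
    using steps_trans steps_Seq[OF t(3)] by blast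
  then show ?thesis using t(1,2) unfolding runs_def by (intro exI[of _ "t1 + Suc t2"]) auto
qed

lemma runs_Cond:
  "runs w (if cell w (s v) \<in> S then c else d) s T s' \<Longrightarrow> runs w (Cond v S c d) s (T + 1) s'"
  by (rule runs_first[rotated 2]) (auto simp: com_step_def)

lemma runs_Loop_stop: "cell w (s v) \<notin> S \<Longrightarrow> runs w (Loop v S c) s 1 s"
  using runs_first[OF _ _ runs_Skip[of _ _ 0], of "Loop v S c" w s s] by (auto simp: com_step_def)

lemma runs_Loop_continue:
  assumes "cell w (s v) \<in> S" "runs w c s T1 s1" "runs w (Loop v S c) s1 T2 s2"
  shows "runs w (Loop v S c) s (T1 + T2 + 2) s2"
  using runs_first[OF _ _ runs_Seq[OF assms(2,3)], of "Loop v S c"] assms(1)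
  by (auto simp: com_step_def)

text \<open>\<open>S i\<close> is the environment after \<open>i\<close> rounds. A round costs
  \<open>T + 2\<close>: one step unfolds the loop and one discards the \<open>Skip\<close> that the
  body leaves behind.\<close>

lemma runs_Loop:
  assumes cont: "\<And>i. i < n \<Longrightarrow> cell w (S i v) \<in> A"
    and body: "\<And>i. i < n \<Longrightarrow> runs w c (S i) T (S (Suc i))"
    and stop: "cell w (S n v) \<notin> A"
  shows "runs w (Loop v A c) (S 0) (n * (T + 2) + 1) (S n)"
proof -
  have "runs w (Loop v A c) (S (n - j)) (j * (T + 2) + 1) (S n)" if "j \<le> n" for j
    using that
  proof (induction j)
    case 0
    then show ?case using runs_Loop_stop stop by auto
  next
    case (Suc j)
    have "Suc (n - Suc j) = n - j" "n - Suc j < n" using Suc.prems by auto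
    then have c: "cell w (S (n - Suc j) v) \<in> A" and b: "runs w c (S (n - Suc j)) T (S (n - j))"
      using cont[of "n - Suc j"] body[of "n - Suc j"] by simp_all
    have "runs w (Loop v A c) (S (n - Suc j)) (T + (j * (T + 2) + 1) + 2) (S n)"
      using Suc by (intro runs_Loop_continue[OF c b]) simp
    then show ?case by (rule runs_mono) auto
  qed
  from this[of n] show ?thesis by simp
qed

text \<open>A head moves by at most one cell per step. This is why whatever is computed in
  polynomial time is polynomially bounded.\<close>

lemma runs_value: "runs w c s T s' \<Longrightarrow> s' v \<le> s v + T"
proof -
  have "s' v \<le> s v + t" if "steps w t (c, s) (c', s')" for t c' c s
    using that
  proof (induction t arbitrary: c s)
    case (Suc t)
    let ?s = "\<lambda>v. shift (move (\<lambda>v. cell w (s v)) c v) (s v)"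
    have "s' v \<le> ?s v + t" using Suc by (auto simp: com_step_def Let_def)
    moreover have "shift d x \<le> Suc x" for d x by (cases d) auto
    ultimately show ?case by (metis add_Suc_right add_Suc_shift add_le_mono1 order_trans)
  qed auto
  then show "runs w c s T s' \<Longrightarrow> s' v \<le> s v + T"
    unfolding runs_def by (meson add_left_mono order_trans)
qed

definition clear :: "nat \<Rightarrow> com" where
  "clear v = Loop v {..<4} (Dec v)"

definition transfer :: "nat \<Rightarrow> nat \<Rightarrow> com" where
  "transfer u v = Loop u {..<4} (Seq (Dec u) (Inc v))"

text \<open>Counting a counter out destroys it, so \<open>u\<close> is emptied into \<open>v\<close>
  and the scratch counter \<open>t\<close> simultaneously and then restored from
  \<open>t\<close>.\<close>

definition duplicate :: "nat \<Rightarrow> nat \<Rightarrow> nat \<Rightarrow> com" where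
  "duplicate u v t = Seq (Loop u {..<4} (Seq (Dec u) (Seq (Inc v) (Inc t)))) (transfer t u)"

lemma cell_in_iff: "w \<noteq> [] \<Longrightarrow> cell w n \<in> {..<4} \<longleftrightarrow> n \<noteq> 0"
  using cell_zero_iff[of w n] by auto

lemma runs_clear: "w \<noteq> [] \<Longrightarrow> runs w (clear v) s (3 * s v + 1) (s(v := 0))"
proof -
  assume w: "w \<noteq> []"
  have "runs w (Dec v) (s(v := s v - i)) 1 (s(v := s v - Suc i))" for i
    using runs_Dec[OF w, of v "s(v := s v - i)"] by simp
  then have "runs w (Loop v {..<4} (Dec v)) (s(v := s v - 0)) (s v * (1 + 2) + 1) (s(v := s v - s v))"
    using runs_Loop[of "s v" w "\<lambda>i. s(v := s v - i)" v "{..<4}" "Dec v" 1]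
    by (simp add: cell_in_iff[OF w] del: lessThan_iff)
  then show ?thesis by (auto simp: clear_def elim: runs_mono)
qed

lemma runs_transfer:
  assumes "w \<noteq> []" "u \<noteq> v"
  shows "runs w (transfer u v) s (5 * s u + 1) (s(u := 0, v := s v + s u))"
proof -
  let ?S = "\<lambda>i. s(u := s u - i, v := s v + i)"
  have "runs w (Seq (Dec u) (Inc v)) (?S i) (1 + 1 + 1) (?S (Suc i))" for i
  proof (rule runs_Seq)
    show "runs w (Dec u) (?S i) 1 ((?S i)(u := (?S i) u - 1))" by (rule runs_Dec[OF assms(1)])
    have "(?S i)(u := (?S i) u - 1, v := Suc (((?S i)(u := (?S i) u - 1)) v)) = ?S (Suc i)"
      using assms(2) by (auto simp: fun_eq_iff)
    then show "runs w (Inc v) ((?S i)(u := (?S i) u - 1)) 1 (?S (Suc i))"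
      using runs_Inc[of w v "(?S i)(u := (?S i) u - 1)"] by simp
  qed
  then have "runs w (Loop u {..<4} (Seq (Dec u) (Inc v))) (?S 0) (s u * (1 + 1 + 1 + 2) + 1) (?S (s u))"
    using runs_Loop[of "s u" w ?S u "{..<4}" "Seq (Dec u) (Inc v)" "1 + 1 + 1"] assms(2)
    by (simp add: cell_in_iff[OF assms(1)] del: lessThan_iff)
  then show ?thesis by (auto simp: transfer_def elim: runs_mono)
qed

lemma runs_duplicate:
  assumes "w \<noteq> []" "u \<noteq> v" "u \<noteq> t" "v \<noteq> t" "s t = 0"
  shows "runs w (duplicate u v t) s (12 * s u + 3) (s(v := s v + s u))"
proof -
  let ?S = "\<lambda>i. s(u := s u - i, v := s v + i, t := i)"
  have "runs w (Seq (Dec u) (Seq (Inc v) (Inc t))) (?S i) (1 + (1 + 1 + 1) + 1) (?S (Suc i))" for i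
  proof (intro runs_Seq)
    let ?s1 = "(?S i)(u := (?S i) u - 1)"
    let ?s2 = "?s1(v := Suc (?s1 v))"
    show "runs w (Dec u) (?S i) 1 ?s1" by (rule runs_Dec[OF assms(1)])
    show "runs w (Inc v) ?s1 1 ?s2" by (rule runs_Inc)
    have "?s2(t := Suc (?s2 t)) = ?S (Suc i)" using assms by (auto simp: fun_eq_iff)
    then show "runs w (Inc t) ?s2 1 (?S (Suc i))" using runs_Inc[of w t ?s2] by simp
  qed
  then have 1: "runs w (Loop u {..<4} (Seq (Dec u) (Seq (Inc v) (Inc t)))) (?S 0) (s u * (1 + (1 + 1 + 1) + 1 + 2) + 1) (?S (s u))"
    using runs_Loop[of "s u" w ?S u "{..<4}" "Seq (Dec u) (Seq (Inc v) (Inc t))" "1 + (1 + 1 + 1) + 1"] assms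
    by (simp add: cell_in_iff[OF assms(1)] del: lessThan_iff)
  have S0: "?S 0 = s" using assms by (auto simp: fun_eq_iff)
  have S1: "(?S (s u))(t := 0, u := ?S (s u) u + ?S (s u) t) = s(v := s v + s u)"
    using assms by (auto simp: fun_eq_iff)
  have 2: "runs w (transfer t u) (?S (s u)) (5 * s u + 1) (s(v := s v + s u))"
    using runs_transfer[OF assms(1), of t u "?S (s u)"] assms(3) unfolding S1 by simp
  show ?thesis unfolding duplicate_def
    by (rule runs_mono[OF runs_Seq[OF 1[unfolded S0] 2]]) simp
qed


section \<open>Polynomially bounded quantities\<close>

lemma poly_nat_mono: "x \<le> y \<Longrightarrow> poly p x \<le> poly p (y :: nat)"
  by (induction p) (auto intro: add_mono mult_mono)

text \<open>Counters enter with their values, not with their binary lengths: they are head positions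
  and hence unary numbers.\<close>

definition pbounded :: "nat \<Rightarrow> (inp \<Rightarrow> env \<Rightarrow> nat) \<Rightarrow> bool" where
  "pbounded k T \<longleftrightarrow> (\<exists>p. \<forall>z \<sigma>. T z \<sigma> \<le> poly p (length (word z) + (\<Sum>v<k. \<sigma> v)))"

lemma pbounded_mono: "pbounded k T' \<Longrightarrow> (\<And>z \<sigma>. T z \<sigma> \<le> T' z \<sigma>) \<Longrightarrow> pbounded k T"
  unfolding pbounded_def by (meson order_trans)

lemma pbounded_const: "pbounded k (\<lambda>z \<sigma>. c)"
  unfolding pbounded_def by (intro exI[of _ "[:c:]"]) auto

lemma pbounded_length: "pbounded k (\<lambda>z \<sigma>. length (word z))"
  unfolding pbounded_def by (intro exI[of _ "[:0, 1:]"]) auto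

lemma pbounded_var: "v < k \<Longrightarrow> pbounded k (\<lambda>z \<sigma>. \<sigma> v)"
  unfolding pbounded_def by (intro exI[of _ "[:0, 1:]"]) (auto intro!: trans_le_add2 member_le_sum)

lemma pbounded_add: "pbounded k S \<Longrightarrow> pbounded k T \<Longrightarrow> pbounded k (\<lambda>z \<sigma>. S z \<sigma> + T z \<sigma>)"
  unfolding pbounded_def
  apply (elim exE)
  subgoal for p q by (intro exI[of _ "p + q"]) (auto intro: add_mono)
  done

lemma pbounded_mult: "pbounded k S \<Longrightarrow> pbounded k T \<Longrightarrow> pbounded k (\<lambda>z \<sigma>. S z \<sigma> * T z \<sigma>)"
  unfolding pbounded_def
  apply (elim exE)
  subgoal for p q by (intro exI[of _ "p * q"]) (auto intro: mult_mono)
  done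

lemma pbounded_sum:
  "(\<And>i. i < n \<Longrightarrow> pbounded k (T i)) \<Longrightarrow> pbounded k (\<lambda>z \<sigma>. \<Sum>i<n. T i z \<sigma>)" for n :: nat
  by (induction n) (auto intro: pbounded_const pbounded_add)

lemma pbounded_poly: "pbounded k T \<Longrightarrow> pbounded k (\<lambda>z \<sigma>. poly p (T z \<sigma>))"
  unfolding pbounded_def
  apply (elim exE)
  subgoal for q by (intro exI[of _ "pcompose p q"]) (auto simp: poly_pcompose intro: poly_nat_mono)
  done

lemma pbounded_subst:
  assumes "pbounded m T" "\<And>v. v < m \<Longrightarrow> pbounded k (\<lambda>z \<sigma>. g z \<sigma> v)"
  shows "pbounded k (\<lambda>z \<sigma>. T z (g z \<sigma>))"
proof -
  obtain p where p: "\<And>z \<sigma>. T z \<sigma> \<le> poly p (length (word z) + (\<Sum>v<m. \<sigma> v))"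
    using assms(1) by (auto simp: pbounded_def)
  have "pbounded k (\<lambda>z \<sigma>. poly p (length (word z) + (\<Sum>v<m. g z \<sigma> v)))"
    using assms(2) by (intro pbounded_poly pbounded_add pbounded_length pbounded_sum) auto
  then show ?thesis by (rule pbounded_mono) (rule p)
qed

lemma pbounded_weaken: "pbounded k T \<Longrightarrow> k \<le> m \<Longrightarrow> pbounded m T"
  using pbounded_subst[of k T m "\<lambda>z \<sigma>. \<sigma>"] by (simp add: pbounded_var)

lemma pbounded_if:
  "(P \<Longrightarrow> pbounded k S) \<Longrightarrow> (\<not> P \<Longrightarrow> pbounded k T) \<Longrightarrow> pbounded k (\<lambda>z \<sigma>. if P then S z \<sigma> else T z \<sigma>)"
  by (cases P) auto

lemmas pbounded_intros = pbounded_const pbounded_length pbounded_var pbounded_add pbounded_mult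
  pbounded_sum pbounded_poly


section \<open>Polynomial-time functions with polynomially bounded values\<close>

definition depends :: "nat \<Rightarrow> (inp \<Rightarrow> env \<Rightarrow> 'a) \<Rightarrow> bool" where
  "depends k f \<longleftrightarrow> (\<forall>z \<sigma> \<sigma>'. (\<forall>v<k. \<sigma> v = \<sigma>' v) \<longrightarrow> f z \<sigma> = f z \<sigma>')"

text \<open>Counters below \<open>m\<close> hold arguments and must be preserved, the others are scratch counters
  that are zero before and, apart from the result in counter \<open>m\<close>, zero afterwards.  Asking for a
  program at every level \<open>m \<ge> k\<close> makes weakening trivial.\<close>

definition feasible :: "nat \<Rightarrow> (inp \<Rightarrow> env \<Rightarrow> nat) \<Rightarrow> bool" where
  "feasible k f \<longleftrightarrow> depends k f \<and>
     (\<forall>m\<ge>k. \<exists>c T. pbounded m T \<and>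
        (\<forall>z \<sigma>. (\<forall>v\<ge>m. \<sigma> v = 0) \<longrightarrow> runs (word z) c \<sigma> (T z \<sigma>) (\<sigma>(m := f z \<sigma>))))"

lemma dependsD: "depends k f \<Longrightarrow> (\<And>v. v < k \<Longrightarrow> \<sigma> v = \<sigma>' v) \<Longrightarrow> f z \<sigma> = f z \<sigma>'"
  unfolding depends_def by blast

lemma feasible_depends: "feasible k f \<Longrightarrow> depends k f"
  by (simp add: feasible_def)

lemma feasibleI:
  assumes "depends k f"
    and "\<And>m. k \<le> m \<Longrightarrow> \<exists>c T. pbounded m T \<and>
        (\<forall>z \<sigma>. (\<forall>v\<ge>m. \<sigma> v = 0) \<longrightarrow> runs (word z) c \<sigma> (T z \<sigma>) (\<sigma>(m := f z \<sigma>)))"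
  shows "feasible k f"
  using assms by (simp add: feasible_def)

lemma feasibleD:
  assumes "feasible k f" "k \<le> m"
  obtains c T where "pbounded m T"
    "\<And>z \<sigma>. (\<And>v. v \<ge> m \<Longrightarrow> \<sigma> v = 0) \<Longrightarrow> runs (word z) c \<sigma> (T z \<sigma>) (\<sigma>(m := f z \<sigma>))"
  using assms unfolding feasible_def by blast

lemma feasible_weaken: "feasible k f \<Longrightarrow> k \<le> m \<Longrightarrow> feasible m f"
  by (auto simp: feasible_def depends_def)

text \<open>The result counter starts at zero, so \<open>runs_value\<close> bounds the result by the
  running time. Zeroing the counters from \<open>k\<close> on, which \<open>f\<close> ignores,
  provides the clean scratch space that the program expects.\<close>

lemma feasible_pbounded:
  assumes f: "feasible k f" and km: "k \<le> m"
  shows "pbounded m f"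
proof -
  obtain c T where c: "pbounded k T"
    "\<And>z \<sigma>. (\<And>v. v \<ge> k \<Longrightarrow> \<sigma> v = 0) \<Longrightarrow> runs (word z) c \<sigma> (T z \<sigma>) (\<sigma>(k := f z \<sigma>))"
    using feasibleD[OF f order_refl] by metis
  let ?g = "\<lambda>(z :: inp) (\<sigma> :: env) v. if v < k then \<sigma> v else 0"
  have le: "f z \<sigma> \<le> T z (?g z \<sigma>)" for z \<sigma>
  proof -
    have "f z \<sigma> = f z (?g z \<sigma>)" by (rule dependsD[OF feasible_depends[OF f]]) auto
    then show ?thesis using runs_value[OF c(2)[of "?g z \<sigma>" z], of k] by simp
  qed
  have "pbounded k (\<lambda>z \<sigma>. T z (?g z \<sigma>))"
    by (rule pbounded_subst[OF c(1)]) (auto intro: pbounded_var)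
  from pbounded_weaken[OF pbounded_mono[OF this le] km] show ?thesis .
qed

lemma feasible_0: "feasible k (\<lambda>z \<sigma>. 0)"
proof (rule feasibleI)
  show "\<exists>c T. pbounded m T \<and> (\<forall>z \<sigma>. (\<forall>v\<ge>m. \<sigma> v = 0) \<longrightarrow>
      runs (word z) c \<sigma> (T z \<sigma>) (\<sigma>(m := 0)))" for m
    using runs_Skip by (intro exI[of _ Skip] exI[of _ "\<lambda>_ _. 0"]) (auto simp: pbounded_const fun_upd_idem)
qed (auto simp: depends_def)

lemma feasible_var:
  assumes "j < k"
  shows "feasible k (\<lambda>z \<sigma>. \<sigma> j)"
proof (rule feasibleI)
  fix m assume "k \<le> m"
  then have "runs (word z) (duplicate j m (Suc m)) \<sigma> (12 * \<sigma> j + 3) (\<sigma>(m := \<sigma> j))"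
    if "\<forall>v\<ge>m. \<sigma> v = 0" for z \<sigma>
    using runs_duplicate[of "word z" j m "Suc m" \<sigma>] assms that by auto
  moreover have "pbounded m (\<lambda>z \<sigma>. 12 * \<sigma> j + 3)"
    using assms \<open>k \<le> m\<close> by (intro pbounded_intros) auto
  ultimately show "\<exists>c T. pbounded m T \<and> (\<forall>z \<sigma>. (\<forall>v\<ge>m. \<sigma> v = 0) \<longrightarrow>
      runs (word z) c \<sigma> (T z \<sigma>) (\<sigma>(m := \<sigma> j)))"
    by (intro exI[of _ "duplicate j m (Suc m)"] exI[of _ "\<lambda>z \<sigma>. 12 * \<sigma> j + 3"]) blast
qed (use assms in \<open>auto simp: depends_def\<close>)

lemma feasible_Suc:
  assumes "feasible k f"
  shows "feasible k (\<lambda>z \<sigma>. Suc (f z \<sigma>))"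
proof (rule feasibleI)
  fix m assume "k \<le> m"
  then obtain c T where c: "pbounded m T"
    "\<And>z \<sigma>. (\<And>v. v \<ge> m \<Longrightarrow> \<sigma> v = 0) \<Longrightarrow> runs (word z) c \<sigma> (T z \<sigma>) (\<sigma>(m := f z \<sigma>))"
    using feasibleD[OF assms] by metis
  have "runs (word z) (Seq c (Inc m)) \<sigma> (T z \<sigma> + 1 + 1) (\<sigma>(m := Suc (f z \<sigma>)))"
    if "\<forall>v\<ge>m. \<sigma> v = 0" for z \<sigma>
    using runs_Seq[OF c(2) runs_Inc[of _ m]] that by simp
  moreover have "pbounded m (\<lambda>z \<sigma>. T z \<sigma> + 1 + 1)"
    by (intro pbounded_intros c)
  ultimately show "\<exists>c T. pbounded m T \<and> (\<forall>z \<sigma>. (\<forall>v\<ge>m. \<sigma> v = 0) \<longrightarrow>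
      runs (word z) c \<sigma> (T z \<sigma>) (\<sigma>(m := Suc (f z \<sigma>))))"
    by (intro exI[of _ "Seq c (Inc m)"] exI[of _ "\<lambda>z \<sigma>. T z \<sigma> + 1 + 1"]) blast
qed (use feasible_depends[OF assms] in \<open>auto simp: depends_def\<close>)

lemma feasible_const: "feasible k (\<lambda>z \<sigma>. c)"
  by (induction c) (auto intro: feasible_0 feasible_Suc)

text \<open>The result counter is itself a head on a copy of the word; it moves right until it sees
  the blank behind the word.\<close>

lemma feasible_word_length: "feasible k (\<lambda>z \<sigma>. length (word z))"
proof (rule feasibleI)
  fix m assume "k \<le> m"
  let ?L = "Loop m {1, 2, 3, 5, 6, 7} (Inc m)"
  have "runs (word z) ?L \<sigma> (length (word z) * (1 + 2) + 1) (\<sigma>(m := length (word z)))"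
    if "\<forall>v\<ge>m. \<sigma> v = 0" for z \<sigma>
  proof -
    let ?S = "\<lambda>i. \<sigma>(m := i)"
    have "runs (word z) (Inc m) (?S i) 1 (?S (Suc i))" for i
      using runs_Inc[of "word z" m "?S i"] by simp
    moreover have "cell (word z) i \<in> {1, 2, 3, 5, 6, 7}" if "i < length (word z)" for i
      using that input_symbol_bounds[of "word z ! i"] by (auto simp: cell_def)
    ultimately have "runs (word z) ?L (?S 0) (length (word z) * (1 + 2) + 1) (?S (length (word z)))"
      using runs_Loop[of "length (word z)" "word z" ?S m "{1, 2, 3, 5, 6, 7}" "Inc m" 1]
      by (simp add: cell_def)
    moreover have "?S 0 = \<sigma>" using that by auto
    ultimately show ?thesis by simp
  qed
  moreover have "pbounded m (\<lambda>z \<sigma>. length (word z) * (1 + 2) + 1)"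
    by (intro pbounded_intros)
  ultimately show "\<exists>c T. pbounded m T \<and> (\<forall>z \<sigma>. (\<forall>v\<ge>m. \<sigma> v = 0) \<longrightarrow>
      runs (word z) c \<sigma> (T z \<sigma>) (\<sigma>(m := length (word z))))"
    by (intro exI[of _ ?L] exI[of _ "\<lambda>z \<sigma>. length (word z) * (1 + 2) + 1"]) blast
qed (auto simp: depends_def)

definition letter :: "inp \<Rightarrow> nat \<Rightarrow> nat" where
  "letter z n = (if n < length (word z) then input_symbol (word z ! n) else 0)"

fun assign :: "nat \<Rightarrow> nat \<Rightarrow> com" where
  "assign v 0 = clear v"
| "assign v (Suc a) = Seq (assign v a) (Inc v)"

lemma runs_assign: "w \<noteq> [] \<Longrightarrow> runs w (assign v a) s (3 * s v + 1 + 2 * a) (s(v := a))"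
proof (induction a)
  case 0
  then show ?case using runs_clear[of w v s] by (simp del: fun_upd_apply)
next
  case (Suc a)
  have "s(v := a, v := Suc ((s(v := a)) v)) = s(v := Suc a)" by simp
  then show ?case using runs_Seq[OF Suc.IH[OF Suc.prems] runs_Inc[of _ v]]
    by (simp del: fun_upd_apply)
qed

text \<open>Once the argument is in counter \<open>m\<close>, the symbol under that head is the
  answer. Branching moves it into the control, which then overwrites the counter by a constant;
  modulo 4 removes the mark at position 0.\<close>

lemma feasible_letter:
  assumes "feasible k f"
  shows "feasible k (\<lambda>z \<sigma>. letter z (f z \<sigma>))"
proof (rule feasibleI)
  fix m assume km: "k \<le> m"
  then obtain c T where c: "pbounded m T"
    "\<And>z \<sigma>. (\<And>v. v \<ge> m \<Longrightarrow> \<sigma> v = 0) \<Longrightarrow> runs (word z) c \<sigma> (T z \<sigma>) (\<sigma>(m := f z \<sigma>))"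
    using feasibleD[OF assms] by metis
  let ?d = "Cond m {1, 5} (assign m 1) (Cond m {2, 6} (assign m 2) (Cond m {3, 7} (assign m 3) (assign m 0)))"
  let ?T = "\<lambda>z \<sigma>. T z \<sigma> + (3 * f z \<sigma> + 10) + 1"
  have "runs (word z) (Seq c ?d) \<sigma> (?T z \<sigma>) (\<sigma>(m := letter z (f z \<sigma>)))"
    if "\<forall>v\<ge>m. \<sigma> v = 0" for z \<sigma>
  proof (rule runs_Seq)
    show "runs (word z) c \<sigma> (T z \<sigma>) (\<sigma>(m := f z \<sigma>))" using c(2) that by auto
    let ?s = "\<sigma>(m := f z \<sigma>)"
    have a: "runs (word z) (assign m a) ?s (3 * f z \<sigma> + 7) (\<sigma>(m := a))" if "a \<le> 3" for a
      by (rule runs_mono[OF runs_assign[of _ m a ?s, simplified]]) (use that in auto)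
    have L: "letter z (f z \<sigma>) \<le> 3" "letter z (f z \<sigma>) = cell (word z) (f z \<sigma>) mod 4"
      using input_symbol_bounds[of "word z ! f z \<sigma>"] by (auto simp: letter_def cell_def)
    let ?X = "cell (word z) (f z \<sigma>)" and ?w = "word z"
    have 3: "runs ?w (Cond m {3, 7} (assign m 3) (assign m 0)) ?s (3 * f z \<sigma> + 7 + 1)
        (\<sigma>(m := if ?X \<in> {3, 7} then 3 else 0))"
      by (rule runs_Cond) (use a[of 3] a[of 0] in \<open>simp del: assign.simps insert_iff\<close>)
    have 2: "runs ?w (Cond m {2, 6} (assign m 2) (Cond m {3, 7} (assign m 3) (assign m 0))) ?s
        (3 * f z \<sigma> + 7 + 1 + 1) (\<sigma>(m := if ?X \<in> {2, 6} then 2 else if ?X \<in> {3, 7} then 3 else 0))"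
      by (rule runs_Cond) (use runs_mono[OF a[of 2]] 3 in \<open>simp del: assign.simps insert_iff\<close>)
    have 1: "runs ?w ?d ?s (3 * f z \<sigma> + 7 + 1 + 1 + 1) (\<sigma>(m := if ?X \<in> {1, 5} then 1 else
        if ?X \<in> {2, 6} then 2 else if ?X \<in> {3, 7} then 3 else 0))"
      by (rule runs_Cond) (use runs_mono[OF a[of 1]] 2 in \<open>simp del: assign.simps insert_iff\<close>)
    have "?X \<in> {0, 1, 2, 3, 4, 5, 6, 7}" using cell_less[of "word z" "f z \<sigma>"] by fastforce
    then have "(if ?X \<in> {1, 5} then 1 else if ?X \<in> {2, 6} then 2 else if ?X \<in> {3, 7} then 3 else 0) =
        letter z (f z \<sigma>)" using L(2) by auto
    then show "runs (word z) ?d ?s (3 * f z \<sigma> + 10) (\<sigma>(m := letter z (f z \<sigma>)))"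
      using 1 by (auto elim: runs_mono simp del: assign.simps insert_iff)
  qed
  moreover have "pbounded m ?T"
    by (intro pbounded_intros c feasible_pbounded[OF assms km])
  ultimately show "\<exists>c T. pbounded m T \<and> (\<forall>z \<sigma>. (\<forall>v\<ge>m. \<sigma> v = 0) \<longrightarrow>
      runs (word z) c \<sigma> (T z \<sigma>) (\<sigma>(m := letter z (f z \<sigma>))))"
    by (intro exI[of _ "Seq c ?d"] exI[of _ ?T]) blast
qed (use feasible_depends[OF assms] in \<open>auto simp: depends_def\<close>, metis)

text \<open>The argument is computed above the level of the call; the previous value of counter \<open>j\<close> is
  parked in counter \<open>m + 2\<close> while the program for \<open>h\<close> runs.\<close>

lemma feasible_subst:
  assumes h: "feasible n h" and a: "feasible k a" and j: "j \<le> k"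
    and n: "n \<le> k \<or> (n = Suc k \<and> j = k)"
  shows "feasible k (\<lambda>z \<sigma>. h z (\<sigma>(j := a z \<sigma>)))"
proof (rule feasibleI)
  have "h z (\<sigma>(j := a z \<sigma>)) = h z (\<sigma>'(j := a z \<sigma>'))" if "\<forall>v<k. \<sigma> v = \<sigma>' v" for z \<sigma> \<sigma>'
  proof (rule dependsD[OF feasible_depends[OF h]])
    have "a z \<sigma> = a z \<sigma>'" using that by (intro dependsD[OF feasible_depends[OF a]]) auto
    then show "(\<sigma>(j := a z \<sigma>)) v = (\<sigma>'(j := a z \<sigma>')) v" if "v < n" for v
      using that n \<open>\<forall>v<k. \<sigma> v = \<sigma>' v\<close> by auto
  qed
  then show "depends k (\<lambda>z \<sigma>. h z (\<sigma>(j := a z \<sigma>)))" by (auto simp: depends_def)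
next
  fix m assume km: "k \<le> m"
  obtain ca Ta where ca: "pbounded (Suc m) Ta"
    "\<And>z \<sigma>. (\<And>v. v \<ge> Suc m \<Longrightarrow> \<sigma> v = 0) \<Longrightarrow> runs (word z) ca \<sigma> (Ta z \<sigma>) (\<sigma>(Suc m := a z \<sigma>))"
    using feasibleD[OF a, of "Suc m"] km by (metis le_Suc_eq)
  have "n \<le> m + 3" using n km by auto
  then obtain ch Th where ch: "pbounded (m + 3) Th"
    "\<And>z \<sigma>. (\<And>v. v \<ge> m + 3 \<Longrightarrow> \<sigma> v = 0) \<Longrightarrow> runs (word z) ch \<sigma> (Th z \<sigma>) (\<sigma>(m + 3 := h z \<sigma>))"
    using feasibleD[OF h] by metis
  let ?h = "\<lambda>z \<sigma>. h z (\<sigma>(j := a z \<sigma>))"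
  let ?c = "Seq ca (Seq (transfer j (m + 2)) (Seq (transfer (Suc m) j)
      (Seq ch (Seq (clear j) (Seq (transfer (m + 2) j) (transfer (m + 3) m))))))"
  let ?g = "\<lambda>z \<sigma>. \<sigma>(j := a z \<sigma>, m + 2 := \<sigma> j)"
  \<comment> \<open>Rebuilds the environment in which \<open>ch\<close> starts from the counters
    below \<open>m\<close>, so that its running time can be bounded in terms of them. For
    \<open>j = m\<close> the parked value is that of a scratch counter, hence 0.\<close>
  let ?g' = "\<lambda>z \<sigma> v. if v = j then a z \<sigma> else if v = m + 2 then (if j < m then \<sigma> j else 0) else if v < m then \<sigma> v else 0"
  let ?T = "\<lambda>z \<sigma>. Ta z (\<lambda>v. if v < m then \<sigma> v else 0)
     + ((5 * (\<Sum>v<m. \<sigma> v) + 1) + ((5 * a z \<sigma> + 1) + (Th z (?g' z \<sigma>)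
     + ((3 * a z \<sigma> + 1) + ((5 * (\<Sum>v<m. \<sigma> v) + 1) + (5 * ?h z \<sigma> + 1) + 1) + 1) + 1) + 1) + 1) + 1"
  have run: "runs (word z) ?c \<sigma> (?T z \<sigma>) (\<sigma>(m := ?h z \<sigma>))" if z0: "\<forall>v\<ge>m. \<sigma> v = 0" for z \<sigma>
  proof -
    have jm: "j \<le> m" using j km by simp
    have s_le: "\<sigma> j \<le> (\<Sum>v<m. \<sigma> v)"
      using z0 jm by (cases "j < m") (auto intro: member_le_sum)
    let ?s1 = "\<sigma>(Suc m := a z \<sigma>)"
    let ?s2 = "?s1(j := 0, m + 2 := \<sigma> j)"
    let ?s3 = "?g z \<sigma>"
    let ?s4 = "?s3(m + 3 := ?h z \<sigma>)"
    let ?s5 = "?s4(j := 0)"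
    let ?s6 = "?s5(m + 2 := 0, j := \<sigma> j)"
    have 1: "runs (word z) ca \<sigma> (Ta z (\<lambda>v. if v < m then \<sigma> v else 0)) ?s1"
    proof -
      have "(\<lambda>v. if v < m then \<sigma> v else 0) = \<sigma>" using z0 by auto
      then show ?thesis using ca(2)[of \<sigma> z] z0 by simp
    qed
    have 2: "runs (word z) (transfer j (m + 2)) ?s1 (5 * (\<Sum>v<m. \<sigma> v) + 1) ?s2"
      using runs_mono[OF runs_transfer[of "word z" j "m + 2" ?s1], of "5 * (\<Sum>v<m. \<sigma> v) + 1" ] z0 jm s_le by simp
    have e3: "?s2(Suc m := 0, j := ?s2 j + ?s2 (Suc m)) = ?s3"
      using z0 jm by (auto simp: fun_eq_iff)
    have 3: "runs (word z) (transfer (Suc m) j) ?s2 (5 * a z \<sigma> + 1) ?s3"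
      using runs_transfer[of "word z" "Suc m" j ?s2] jm unfolding e3 by simp
    have hh: "h z ?s3 = ?h z \<sigma>"
      using n km by (intro dependsD[OF feasible_depends[OF h]]) auto
    have gg: "?g' z \<sigma> = ?s3" using z0 jm by (auto simp: fun_eq_iff)
    have 4: "runs (word z) ch ?s3 (Th z (?g' z \<sigma>)) ?s4"
      using ch(2)[of ?s3 z] z0 jm unfolding hh gg by simp
    have 5: "runs (word z) (clear j) ?s4 (3 * a z \<sigma> + 1) ?s5"
      using runs_clear[of "word z" j ?s4] jm by simp
    have 6: "runs (word z) (transfer (m + 2) j) ?s5 (5 * (\<Sum>v<m. \<sigma> v) + 1) ?s6"
      using runs_mono[OF runs_transfer[of "word z" "m + 2" j ?s5], of "5 * (\<Sum>v<m. \<sigma> v) + 1"] jm s_le by simp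
    have e7: "?s6(m + 3 := 0, m := ?s6 m + ?s6 (m + 3)) = \<sigma>(m := ?h z \<sigma>)"
      using z0 jm by (auto simp: fun_eq_iff)
    have 7: "runs (word z) (transfer (m + 3) m) ?s6 (5 * ?h z \<sigma> + 1) (\<sigma>(m := ?h z \<sigma>))"
      using runs_transfer[of "word z" "m + 3" m ?s6] jm unfolding e7 by simp
    show ?thesis by (rule runs_Seq[OF 1 runs_Seq[OF 2 runs_Seq[OF 3 runs_Seq[OF 4 runs_Seq[OF 5 runs_Seq[OF 6 7]]]]]])
  qed
  have pa: "pbounded m a" by (rule feasible_pbounded[OF a km])
  have pcut: "pbounded m (\<lambda>z \<sigma>. if v < m then \<sigma> v else 0)" for v
    by (cases "v < m") (auto intro: pbounded_intros)
  have "pbounded m ?h"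
  proof (rule pbounded_mono)
    show "pbounded m (\<lambda>z \<sigma>. h z (\<lambda>v. if v = j then a z \<sigma> else if v < m then \<sigma> v else 0))"
      by (rule pbounded_subst[OF feasible_pbounded[OF h order_refl]]) (intro pbounded_if pbounded_intros pa)
    show "h z (\<sigma>(j := a z \<sigma>)) \<le> h z (\<lambda>v. if v = j then a z \<sigma> else if v < m then \<sigma> v else 0)" for z \<sigma>
      using n km by (intro eq_imp_le dependsD[OF feasible_depends[OF h]]) auto
  qed
  moreover have "pbounded m (\<lambda>z \<sigma>. Th z (?g' z \<sigma>))"
    by (rule pbounded_subst[OF ch(1)]) (intro pbounded_if pbounded_intros pa)
  moreover have "pbounded m (\<lambda>z \<sigma>. Ta z (\<lambda>v. if v < m then \<sigma> v else 0))"
    by (rule pbounded_subst[OF ca(1)]) (use pcut in auto)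
  ultimately have "pbounded m ?T" by (intro pbounded_intros pa) auto
  then show "\<exists>c T. pbounded m T \<and> (\<forall>z \<sigma>. (\<forall>v\<ge>m. \<sigma> v = 0) \<longrightarrow>
      runs (word z) c \<sigma> (T z \<sigma>) (\<sigma>(m := ?h z \<sigma>)))"
    using run by (intro exI[of _ ?c] exI[of _ ?T]) blast
qed

text \<open>Bounded recursion in the style of Cobham: iterating a polynomial-time step stays
  polynomial because all intermediate values obey the bound \<open>B\<close>. The step
  \<open>h\<close> is required to be feasible for arbitrary feasible arguments instead of fixed
  counters, so that nested constructions are handled by plain introduction rules.\<close>

lemma feasible_rec:
  assumes n: "feasible k n" and g: "feasible k g"
    and h: "\<And>m a b. k \<le> m \<Longrightarrow> feasible m a \<Longrightarrow> feasible m b \<Longrightarrow> feasible m (\<lambda>z \<sigma>. h z \<sigma> (a z \<sigma>) (b z \<sigma>))"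
    and B: "pbounded k B"
    and bd: "\<And>z \<sigma> i. i \<le> n z \<sigma> \<Longrightarrow> rec_nat (g z \<sigma>) (h z \<sigma>) i \<le> B z \<sigma>"
  shows "feasible k (\<lambda>z \<sigma>. rec_nat (g z \<sigma>) (h z \<sigma>) (n z \<sigma>))"
proof (rule feasibleI)
  let ?R = "\<lambda>z \<sigma>. rec_nat (g z \<sigma>) (h z \<sigma>)"
  have dep: "h z \<sigma> i x = h z \<sigma>' i x" if "\<And>v. v < k \<Longrightarrow> \<sigma> v = \<sigma>' v" for z \<sigma> \<sigma>' i x
    using dependsD[OF feasible_depends[OF h[OF order_refl feasible_const[of k i] feasible_const[of k x]]] that] by simp
  show "depends k (\<lambda>z \<sigma>. ?R z \<sigma> (n z \<sigma>))"
    unfolding depends_def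
  proof (intro allI impI)
    fix z \<sigma> \<sigma>' assume *: "\<forall>v<k. \<sigma> v = (\<sigma>' v :: nat)"
    have "h z \<sigma> i x = h z \<sigma>' i x" for i x by (rule dep) (use * in simp)
    then have "h z \<sigma> = h z \<sigma>'" by (intro ext)
    moreover have "g z \<sigma> = g z \<sigma>'" by (rule dependsD[OF feasible_depends[OF g]]) (use * in simp)
    moreover have "n z \<sigma> = n z \<sigma>'" by (rule dependsD[OF feasible_depends[OF n]]) (use * in simp)
    ultimately show "?R z \<sigma> (n z \<sigma>) = ?R z \<sigma>' (n z \<sigma>')" by simp
  qed
  fix m assume km: "k \<le> m"
  obtain cn Tn where cn: "pbounded m Tn"
    "\<And>z \<sigma>. (\<And>v. v \<ge> m \<Longrightarrow> \<sigma> v = 0) \<Longrightarrow> runs (word z) cn \<sigma> (Tn z \<sigma>) (\<sigma>(m := n z \<sigma>))"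
    using feasibleD[OF n km] by metis
  obtain cg Tg where cg: "pbounded (Suc m) Tg"
    "\<And>z \<sigma>. (\<And>v. v \<ge> Suc m \<Longrightarrow> \<sigma> v = 0) \<Longrightarrow> runs (word z) cg \<sigma> (Tg z \<sigma>) (\<sigma>(Suc m := g z \<sigma>))"
    using feasibleD[OF g, of "Suc m"] km by (metis le_Suc_eq)
  have "feasible (m + 3) (\<lambda>z \<sigma>. h z \<sigma> (\<sigma> (m + 2)) (\<sigma> (m + 1)))"
    using km by (intro h feasible_var) auto
  from feasibleD[OF this order_refl] obtain ch Th where ch: "pbounded (m + 3) Th"
    "\<And>z \<sigma>. (\<And>v. v \<ge> m + 3 \<Longrightarrow> \<sigma> v = 0) \<Longrightarrow>
       runs (word z) ch \<sigma> (Th z \<sigma>) (\<sigma>(m + 3 := h z \<sigma> (\<sigma> (m + 2)) (\<sigma> (m + 1))))"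
    by metis
  obtain p where p: "\<And>z \<sigma>. Th z \<sigma> \<le> poly p (length (word z) + (\<Sum>v<m + 3. \<sigma> v))"
    using ch(1) by (auto simp: pbounded_def)
  \<comment> \<open>Counter \<open>m\<close> holds the number of remaining rounds,
    \<open>m + 1\<close> the accumulator and \<open>m + 2\<close> the index of the round.\<close>
  let ?body = "Seq (Dec m) (Seq ch (Seq (clear (m + 1)) (Seq (transfer (m + 3) (m + 1)) (Inc (m + 2)))))"
  let ?c = "Seq cn (Seq cg (Seq (Loop m {..<4} ?body) (Seq (clear (m + 2)) (transfer (m + 1) m))))"
  \<comment> \<open>A cost for \<open>ch\<close> that is the same in all rounds: remaining rounds,
    accumulator and index are replaced by their bounds.\<close>
  let ?Th = "\<lambda>z \<sigma>. poly p (length (word z) + ((\<Sum>v<m. \<sigma> v) + (n z \<sigma> + (B z \<sigma> + n z \<sigma>))))"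
  let ?Tb = "\<lambda>z \<sigma>. 1 + (?Th z \<sigma> + ((3 * B z \<sigma> + 1) + ((5 * B z \<sigma> + 1) + 1 + 1) + 1) + 1) + 1"
  let ?cut = "\<lambda>(z :: inp) (\<sigma> :: env) v. if v = m then n z \<sigma> else if v < m then \<sigma> v else 0"
  let ?T = "\<lambda>z \<sigma>. Tn z \<sigma> + (Tg z (?cut z \<sigma>)
     + ((n z \<sigma> * (?Tb z \<sigma> + 2) + 1) + ((3 * n z \<sigma> + 1) + (5 * B z \<sigma> + 1) + 1) + 1) + 1) + 1"
  have run: "runs (word z) ?c \<sigma> (?T z \<sigma>) (\<sigma>(m := ?R z \<sigma> (n z \<sigma>)))" if z0: "\<forall>v\<ge>m. \<sigma> v = 0" for z \<sigma>
  proof -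
    let ?N = "n z \<sigma>"
    let ?S = "\<lambda>i. \<sigma>(m := ?N - i, m + 1 := ?R z \<sigma> i, m + 2 := i)"
    have 1: "runs (word z) cn \<sigma> (Tn z \<sigma>) (\<sigma>(m := ?N))" using cn(2) z0 by auto
    have "g z (\<sigma>(m := ?N)) = g z \<sigma>"
      using km by (intro dependsD[OF feasible_depends[OF g]]) auto
    moreover have "?cut z \<sigma> = \<sigma>(m := ?N)" using z0 by (auto simp: fun_eq_iff)
    moreover have "?S 0 = \<sigma>(m := ?N, Suc m := g z \<sigma>)" using z0 by (auto simp: fun_eq_iff)
    ultimately have 2: "runs (word z) cg (\<sigma>(m := ?N)) (Tg z (?cut z \<sigma>)) (?S 0)"
      using cg(2)[of "\<sigma>(m := ?N)" z] z0 by simp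
    have body: "runs (word z) ?body (?S i) (?Tb z \<sigma>) (?S (Suc i))" if i: "i < ?N" for i
    proof -
      let ?s1 = "(?S i)(m := ?N - Suc i)"
      let ?s2 = "?s1(m + 3 := ?R z \<sigma> (Suc i))"
      let ?s3 = "?s2(m + 1 := 0)"
      let ?s4 = "?s3(m + 3 := 0, m + 1 := ?R z \<sigma> (Suc i))"
      have R: "?R z \<sigma> i \<le> B z \<sigma>" "?R z \<sigma> (Suc i) \<le> B z \<sigma>" using bd[of i z \<sigma>] bd[of "Suc i" z \<sigma>] i by simp_all
      have "?s1 = (?S i)(m := ?S i m - 1)" by simp
      then have b1: "runs (word z) (Dec m) (?S i) 1 ?s1"
        using runs_Dec[of "word z" m "?S i"] by simp
      have "h z ?s1 (?s1 (m + 2)) (?s1 (m + 1)) = ?R z \<sigma> (Suc i)"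
        using dep[of ?s1 \<sigma> z i "?R z \<sigma> i"] km by simp
      moreover have "Th z ?s1 \<le> ?Th z \<sigma>"
      proof -
        have "(\<Sum>v<m + 3. ?s1 v) = (\<Sum>v<m. \<sigma> v) + (?N - Suc i + (?R z \<sigma> i + i))"
          by (simp add: eval_nat_numeral)
        also have "\<dots> \<le> (\<Sum>v<m. \<sigma> v) + (?N + (B z \<sigma> + ?N))" using R i by auto
        finally have "poly p (length (word z) + (\<Sum>v<m + 3. ?s1 v)) \<le> ?Th z \<sigma>"
          by (intro poly_nat_mono add_left_mono)
        then show ?thesis using p[of z ?s1] by (rule order_trans[rotated])
      qed
      ultimately have b2: "runs (word z) ch ?s1 (?Th z \<sigma>) ?s2"
        using runs_mono[OF ch(2)[of ?s1 z]] z0 by simp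
      have b3: "runs (word z) (clear (m + 1)) ?s2 (3 * B z \<sigma> + 1) ?s3"
        using R(1) by (intro runs_mono[OF runs_clear]) auto
      have "?s4 = ?s3(m + 3 := 0, m + 1 := ?s3 (m + 1) + ?s3 (m + 3))" by (auto simp: fun_eq_iff)
      then have b4: "runs (word z) (transfer (m + 3) (m + 1)) ?s3 (5 * B z \<sigma> + 1) ?s4"
        using R(2) runs_mono[OF runs_transfer[of "word z" "m + 3" "m + 1" ?s3], of "5 * B z \<sigma> + 1"] by simp
      have "?S (Suc i) = ?s4(m + 2 := Suc (?s4 (m + 2)))" using z0 by (auto simp: fun_eq_iff)
      then have b5: "runs (word z) (Inc (m + 2)) ?s4 1 (?S (Suc i))"
        using runs_Inc[of "word z" "m + 2" ?s4] by simp
      show ?thesis by (rule runs_Seq[OF b1 runs_Seq[OF b2 runs_Seq[OF b3 runs_Seq[OF b4 b5]]]])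
    qed
    have 3: "runs (word z) (Loop m {..<4} ?body) (?S 0) (?N * (?Tb z \<sigma> + 2) + 1) (?S ?N)"
    proof (rule runs_Loop[of ?N "word z" ?S m])
      show "cell (word z) (?S i m) \<in> {..<4}" if "i < ?N" for i
        using that cell_in_iff[of "word z" "?N - i"] by simp
      show "cell (word z) (?S ?N m) \<notin> {..<4}"
        using cell_in_iff[of "word z" 0] by simp
    qed (rule body)
    let ?s5 = "(?S ?N)(m + 2 := 0)"
    have 4: "runs (word z) (clear (m + 2)) (?S ?N) (3 * ?N + 1) ?s5"
      using runs_clear[of "word z" "m + 2" "?S ?N"] by simp
    have e5: "?s5(m + 1 := 0, m := ?s5 m + ?s5 (m + 1)) = \<sigma>(m := ?R z \<sigma> ?N)"
      using z0 by (auto simp: fun_eq_iff)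
    have 5: "runs (word z) (transfer (m + 1) m) ?s5 (5 * B z \<sigma> + 1) (\<sigma>(m := ?R z \<sigma> ?N))"
      using runs_mono[OF runs_transfer[of "word z" "m + 1" m ?s5], of "5 * B z \<sigma> + 1"] bd[of ?N z \<sigma>]
      unfolding e5 by simp
    show ?thesis by (rule runs_Seq[OF 1 runs_Seq[OF 2 runs_Seq[OF 3 runs_Seq[OF 4 5]]]])
  qed
  have pn: "pbounded m n" by (rule feasible_pbounded[OF n km])
  have pB: "pbounded m B" by (rule pbounded_weaken[OF B km])
  have "pbounded m (\<lambda>z \<sigma>. Tg z (?cut z \<sigma>))"
    by (rule pbounded_subst[OF cg(1)]) (intro pbounded_if pbounded_intros pn)
  then have "pbounded m ?T" by (intro pbounded_intros pn pB cn) auto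
  then show "\<exists>c T. pbounded m T \<and> (\<forall>z \<sigma>. (\<forall>v\<ge>m. \<sigma> v = 0) \<longrightarrow>
      runs (word z) c \<sigma> (T z \<sigma>) (\<sigma>(m := ?R z \<sigma> (n z \<sigma>))))"
    using run by (intro exI[of _ ?c] exI[of _ ?T]) blast
qed

lemma feasible_polytime_decidable:
  assumes "feasible 0 (\<lambda>z \<sigma>. f z)"
  shows "polytime_decidable (\<lambda>I X Y. f (I, X, Y) \<noteq> 0)"
proof -
  obtain c T where c: "pbounded 0 T"
    "\<And>z \<sigma>. (\<And>v. v \<ge> 0 \<Longrightarrow> \<sigma> v = 0) \<Longrightarrow> runs (word z) c \<sigma> (T z \<sigma>) (\<sigma>(0 := f z))"
    using feasibleD[OF assms order_refl] by metis
  obtain p where p: "\<And>z \<sigma>. T z \<sigma> \<le> poly p (length (word z))"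
    using c(1) by (auto simp: pbounded_def)
  define k where "k = Suc (Max (insert 0 (variables c)))"
  have "variables c \<subseteq> {..<k}" "0 < k"
    using finite_variables[of c] by (auto simp: k_def less_Suc_eq_le)
  from com_to_tm[OF this] obtain M where M: "turing_machine M"
    "\<And>w s t n. w \<noteq> [] \<Longrightarrow> steps w t (c, \<lambda>_. 0) (Skip, s) \<Longrightarrow> 2 * length w + 4 + t \<le> n \<Longrightarrow>
      fst ((tm_step M ^^ n) (initial_config M w)) = (if s 0 \<noteq> 0 then accept_state M else reject_state M)"
    by blast
  have "fst ((tm_step M ^^ poly ([:4, 2:] + p) (length (triple_word I X Y)))
                  (initial_config M (triple_word I X Y))) =
           (if f (I, X, Y) \<noteq> 0 then accept_state M else reject_state M)" for I X Y
  proof -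
    have w: "word (I, X, Y) = triple_word I X Y" by (simp add: word_def)
    have "runs (word (I, X, Y)) c (\<lambda>_. 0) (T (I, X, Y) (\<lambda>_. 0)) ((\<lambda>_. 0)(0 := f (I, X, Y)))"
      using c(2) by simp
    then obtain t where t: "t \<le> poly p (length (triple_word I X Y))"
      "steps (triple_word I X Y) t (c, \<lambda>_. 0) (Skip, (\<lambda>_. 0)(0 := f (I, X, Y)))"
      using p unfolding runs_def w by (metis le_trans w)
    show ?thesis using M(2)[OF _ t(2)] t(1) word_nonempty[of "(I, X, Y)"] by (simp add: w)
  qed
  then show ?thesis unfolding polytime_decidable_def using M(1) by blast
qed


section \<open>Arithmetic and logic on polynomially bounded numbers\<close>

lemma feasible_add:
  assumes "feasible k f" "feasible k g"
  shows "feasible k (\<lambda>z \<sigma>. f z \<sigma> + g z \<sigma>)"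
proof -
  have r: "rec_nat x (\<lambda>i y. Suc y) n = x + n" for x n by (induction n) auto
  have "feasible k (\<lambda>z \<sigma>. rec_nat (f z \<sigma>) (\<lambda>i y. Suc y) (g z \<sigma>))"
    by (rule feasible_rec[OF assms(2,1) _ pbounded_add[OF feasible_pbounded[OF assms(1) order_refl]
          feasible_pbounded[OF assms(2) order_refl]]]) (auto simp: r intro: feasible_Suc)
  then show ?thesis by (simp add: r)
qed

lemma feasible_mult:
  assumes "feasible k f" "feasible k g"
  shows "feasible k (\<lambda>z \<sigma>. f z \<sigma> * g z \<sigma>)"
proof -
  have r: "rec_nat 0 (\<lambda>i y. y + x) n = x * n" for x n :: nat by (induction n) auto
  have "feasible k (\<lambda>z \<sigma>. rec_nat 0 (\<lambda>i y. y + f z \<sigma>) (g z \<sigma>))"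
    by (rule feasible_rec[OF assms(2) feasible_const _ pbounded_mult[OF feasible_pbounded[OF assms(1) order_refl]
          feasible_pbounded[OF assms(2) order_refl]]])
       (auto simp: r intro!: feasible_add feasible_weaken[OF assms(1)])
  then show ?thesis by (simp add: r)
qed

lemma feasible_diff:
  assumes "feasible k f" "feasible k g"
  shows "feasible k (\<lambda>z \<sigma>. f z \<sigma> - g z \<sigma>)"
proof -
  have pred: "feasible m (\<lambda>z \<sigma>. a z \<sigma> - 1)" if a: "feasible m a" for m a
  proof -
    \<comment> \<open>A recursion that ignores its accumulator and returns the index of the last
      round computes the predecessor.\<close>
    have r: "rec_nat 0 (\<lambda>i y. i) n = n - 1" for n :: nat by (cases n) auto
    have "feasible m (\<lambda>z \<sigma>. rec_nat 0 (\<lambda>i y. i) (a z \<sigma>))"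
      by (rule feasible_rec[OF a feasible_const _ feasible_pbounded[OF a order_refl]]) (auto simp: r)
    then show ?thesis by (simp add: r)
  qed
  have r: "rec_nat x (\<lambda>i y. y - 1) n = x - n" for x n :: nat by (induction n) auto
  have "feasible k (\<lambda>z \<sigma>. rec_nat (f z \<sigma>) (\<lambda>i y. y - 1) (g z \<sigma>))"
    by (rule feasible_rec[OF assms(2,1) _ feasible_pbounded[OF assms(1) order_refl]]) (auto simp del: One_nat_def simp: r intro: pred)
  then show ?thesis by (simp only: r)
qed

definition checkable :: "nat \<Rightarrow> (inp \<Rightarrow> env \<Rightarrow> bool) \<Rightarrow> bool" where
  "checkable k P \<longleftrightarrow> feasible k (\<lambda>z \<sigma>. of_bool (P z \<sigma>))"

lemma checkable_le:
  assumes "feasible k f" "feasible k g"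
  shows "checkable k (\<lambda>z \<sigma>. f z \<sigma> \<le> g z \<sigma>)"
proof -
  have "(\<lambda>z \<sigma>. of_bool (f z \<sigma> \<le> g z \<sigma>)) = (\<lambda>z \<sigma>. 1 - (f z \<sigma> - g z \<sigma>))" by (auto simp: fun_eq_iff)
  then show ?thesis unfolding checkable_def by (simp only:) (intro feasible_diff feasible_const assms)
qed

lemma checkable_not:
  assumes "checkable k P"
  shows "checkable k (\<lambda>z \<sigma>. \<not> P z \<sigma>)"
proof -
  have "(\<lambda>z \<sigma>. of_bool (\<not> P z \<sigma>) :: nat) = (\<lambda>z \<sigma>. 1 - of_bool (P z \<sigma>))" by (auto simp: fun_eq_iff)
  then show ?thesis using assms unfolding checkable_def by (simp only:) (intro feasible_diff feasible_const)
qed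

lemma checkable_conj: "checkable k P \<Longrightarrow> checkable k Q \<Longrightarrow> checkable k (\<lambda>z \<sigma>. P z \<sigma> \<and> Q z \<sigma>)"
  unfolding checkable_def of_bool_conj by (rule feasible_mult)

lemma checkable_disj:
  assumes "checkable k P" "checkable k Q"
  shows "checkable k (\<lambda>z \<sigma>. P z \<sigma> \<or> Q z \<sigma>)"
proof -
  have "checkable k (\<lambda>z \<sigma>. \<not> (\<not> P z \<sigma> \<and> \<not> Q z \<sigma>))" by (intro checkable_not checkable_conj assms)
  then show ?thesis by simp
qed

lemma checkable_imp: "checkable k P \<Longrightarrow> checkable k Q \<Longrightarrow> checkable k (\<lambda>z \<sigma>. P z \<sigma> \<longrightarrow> Q z \<sigma>)"
  unfolding imp_conv_disj by (intro checkable_disj checkable_not)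

lemma checkable_less:
  assumes "feasible k f" "feasible k g"
  shows "checkable k (\<lambda>z \<sigma>. f z \<sigma> < g z \<sigma>)"
  unfolding not_le[symmetric] by (intro checkable_not checkable_le assms)

lemma checkable_eq:
  assumes "feasible k f" "feasible k g"
  shows "checkable k (\<lambda>z \<sigma>. f z \<sigma> = g z \<sigma>)"
  unfolding order_eq_iff by (intro checkable_conj checkable_le assms)

lemma feasible_if:
  assumes "checkable k P" "feasible k f" "feasible k g"
  shows "feasible k (\<lambda>z \<sigma>. if P z \<sigma> then f z \<sigma> else g z \<sigma>)"
proof -
  have "(\<lambda>z \<sigma>. if P z \<sigma> then f z \<sigma> else g z \<sigma>) =
      (\<lambda>z \<sigma>. of_bool (P z \<sigma>) * f z \<sigma> + (1 - of_bool (P z \<sigma>)) * g z \<sigma>)" by (auto simp: fun_eq_iff)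
  then show ?thesis using assms unfolding checkable_def
    by (simp only:) (intro feasible_add feasible_mult feasible_diff feasible_const)
qed

lemma feasible_of_bool: "checkable k P \<Longrightarrow> feasible k (\<lambda>z \<sigma>. of_bool (P z \<sigma>))"
  by (simp add: checkable_def)

text \<open>The recursion needs a bound for the summands. It comes from letting the fresh counter
  \<open>k\<close> carry the index: the resulting function of one more counter is polynomially
  bounded, and the index is below \<open>n\<close>.\<close>

lemma feasible_sum:
  assumes n: "feasible k n"
    and f: "\<And>m a. k \<le> m \<Longrightarrow> feasible m a \<Longrightarrow> feasible m (\<lambda>z \<sigma>. f z \<sigma> (a z \<sigma>))"
  shows "feasible k (\<lambda>z \<sigma>. \<Sum>i<n z \<sigma>. f z \<sigma> i)"
proof -
  have r: "rec_nat 0 (\<lambda>i y. y + g i) n = (\<Sum>i<n. g i)" for g n by (induction n) auto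
  let ?F = "\<lambda>z \<sigma>. f z \<sigma> (\<sigma> k)"
  have "feasible (Suc k) ?F" by (intro f feasible_var) auto
  then obtain p where p: "\<And>z \<sigma>. ?F z \<sigma> \<le> poly p (length (word z) + (\<Sum>v<Suc k. \<sigma> v))"
    using feasible_pbounded[OF _ order_refl] unfolding pbounded_def by blast
  let ?B = "\<lambda>z \<sigma>. n z \<sigma> * poly p (length (word z) + ((\<Sum>v<k. \<sigma> v) + n z \<sigma>))"
  have pn: "pbounded k n" by (rule feasible_pbounded[OF n order_refl])
  have B: "pbounded k ?B" by (intro pbounded_intros pn)
  have le: "f z \<sigma> i \<le> poly p (length (word z) + ((\<Sum>v<k. \<sigma> v) + n z \<sigma>))" if i: "i < n z \<sigma>" for z \<sigma> i
  proof -
    have "f z \<sigma> i = f z (\<sigma>(k := i)) i"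
      by (rule dependsD[OF feasible_depends[OF f[OF order_refl feasible_const]]]) simp
    also have "\<dots> \<le> poly p (length (word z) + (\<Sum>v<Suc k. (\<sigma>(k := i)) v))"
      using p[of z "\<sigma>(k := i)"] by simp
    also have "\<dots> \<le> poly p (length (word z) + ((\<Sum>v<k. \<sigma> v) + n z \<sigma>))"
      using i by (intro poly_nat_mono) simp
    finally show ?thesis .
  qed
  have bd: "(\<Sum>j<i. f z \<sigma> j) \<le> ?B z \<sigma>" if "i \<le> n z \<sigma>" for z \<sigma> i
  proof -
    have "(\<Sum>j<i. f z \<sigma> j) \<le> (\<Sum>j<i. poly p (length (word z) + ((\<Sum>v<k. \<sigma> v) + n z \<sigma>)))"
      using that le by (intro sum_mono) auto
    also have "\<dots> \<le> ?B z \<sigma>" using that by simp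
    finally show ?thesis .
  qed
  have "feasible k (\<lambda>z \<sigma>. rec_nat 0 (\<lambda>i y. y + f z \<sigma> i) (n z \<sigma>))"
    by (rule feasible_rec[OF n feasible_const _ B]) (use bd in \<open>auto simp: r intro!: feasible_add f\<close>)
  then show ?thesis by (simp add: r)
qed

lemma checkable_all:
  assumes n: "feasible k n"
    and P: "\<And>m a. k \<le> m \<Longrightarrow> feasible m a \<Longrightarrow> checkable m (\<lambda>z \<sigma>. P z \<sigma> (a z \<sigma>))"
  shows "checkable k (\<lambda>z \<sigma>. \<forall>i<n z \<sigma>. P z \<sigma> i)"
proof -
  have "checkable k (\<lambda>z \<sigma>. (\<Sum>i<n z \<sigma>. of_bool (\<not> P z \<sigma> i)) \<le> (0 :: nat))"
    by (intro checkable_le feasible_sum feasible_const n feasible_of_bool checkable_not P)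
  moreover have "(\<Sum>i<n z \<sigma>. of_bool (\<not> P z \<sigma> i)) \<le> (0 :: nat) \<longleftrightarrow> (\<forall>i<n z \<sigma>. P z \<sigma> i)" for z \<sigma>
    by auto
  ultimately show ?thesis by (simp only:)
qed

text \<open>Halving amounts to counting the positive even numbers up to the argument.\<close>

lemma feasible_div2:
  assumes f: "feasible k f"
  shows "feasible k (\<lambda>z \<sigma>. f z \<sigma> div 2)"
proof -
  have "x div 2 = (\<Sum>i<x. of_bool (2 * Suc i \<le> x))" for x :: nat
  proof -
    have "{i. i < x \<and> 2 * Suc i \<le> x} = {..<x div 2}" by auto
    moreover have "(\<Sum>i<x. of_bool (2 * Suc i \<le> x)) = card {i. i < x \<and> 2 * Suc i \<le> x}"
      by (simp add: sum.If_cases of_bool_def Collect_conj_eq lessThan_def)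
    ultimately show ?thesis by simp
  qed
  moreover have "feasible k (\<lambda>z \<sigma>. \<Sum>i<f z \<sigma>. of_bool (2 * Suc i \<le> f z \<sigma>))"
    by (intro feasible_sum f feasible_of_bool checkable_le feasible_mult feasible_const feasible_Suc feasible_weaken[OF f])
  ultimately show ?thesis by (simp only:)
qed

text \<open>A counter that \<open>f\<close> ignores may be filled with 0.\<close>

lemma feasible_strengthen: "feasible (Suc k) f \<Longrightarrow> depends k f \<Longrightarrow> feasible k f"
proof -
  assume f: "feasible (Suc k) f" "depends k f"
  have "feasible k (\<lambda>z \<sigma>. f z (\<sigma>(k := 0)))"
    by (rule feasible_subst[OF f(1) feasible_const]) auto
  moreover have "f z (\<sigma>(k := 0)) = f z \<sigma>" for z \<sigma> by (rule dependsD[OF f(2)]) auto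
  ultimately show ?thesis by simp
qed


section \<open>Reading the three parts of the input\<close>

text \<open>Reading beyond the end yields \<open>False\<close>. Scans of malformed strings are
  thereby total, and a run of ones always ends.\<close>

definition bit :: "bool list \<Rightarrow> nat \<Rightarrow> bool" where
  "bit L j \<longleftrightarrow> j < length L \<and> L ! j"

definition accessible :: "(inp \<Rightarrow> bool list) \<Rightarrow> bool" where
  "accessible L \<longleftrightarrow> (\<forall>k. feasible k (\<lambda>z \<sigma>. length (L z))) \<and>
     (\<forall>k a. feasible k a \<longrightarrow> checkable k (\<lambda>z \<sigma>. bit (L z) (a z \<sigma>)))"

lemma feasible_length: "accessible L \<Longrightarrow> feasible k (\<lambda>z \<sigma>. length (L z))"
  by (simp add: accessible_def)

lemma checkable_bit: "accessible L \<Longrightarrow> feasible k a \<Longrightarrow> checkable k (\<lambda>z \<sigma>. bit (L z) (a z \<sigma>))"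
  by (simp add: accessible_def)

lemma sum_of_bool_less: "l \<le> N \<Longrightarrow> (\<Sum>i<N. of_bool (i < l)) = (l :: nat)"
proof -
  assume "l \<le> N"
  then have "{..<N} \<inter> {i. i < l} = {..<l}" by auto
  then show ?thesis by (simp add: of_bool_def sum.If_cases)
qed

lemma letter_word:
  "letter (I, X, Y) j =
     (if j < length I then input_symbol (Some (I ! j))
      else if j = length I then 1
      else if j < length I + 1 + length X then input_symbol (Some (X ! (j - (length I + 1))))
      else if j = length I + 1 + length X then 1
      else if j < length I + 1 + length X + 1 + length Y
        then input_symbol (Some (Y ! (j - (length I + 1 + length X + 1)))) else 0)"
  by (auto simp: letter_def word_def triple_word_def nth_append nth_Cons')

lemma input_symbol_Some: "input_symbol (Some b) \<noteq> 1" "input_symbol (Some b) \<noteq> Suc 0" "input_symbol (Some b) = 3 \<longleftrightarrow> b"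
  by (cases b; simp)+

text \<open>The separator is the only letter 1, so the first part is as long as the initial stretch
  without this letter. The length is written as a sum of truth values because such sums are known to
  be feasible.\<close>

lemma length_I: "(\<Sum>i<length (word z). of_bool (\<forall>j<Suc i. letter z j \<noteq> 1)) = length (fst z)"
proof -
  obtain I X Y where z: "z = (I, X, Y)" by (cases z)
  have a: "letter z j \<noteq> 1" if "j < length I" for j
    using that by (simp add: z letter_word input_symbol_Some)
  have b: "letter z (length I) = 1" by (simp add: z letter_word)
  have iff: "(\<forall>j<Suc i. letter z j \<noteq> 1) \<longleftrightarrow> i < length I" for i
    using a b by (meson less_Suc_eq_le less_trans_Suc linorder_not_le order_less_le_trans)
  have "(\<Sum>i<length (word z). of_bool (i < length I)) = length I"
    by (rule sum_of_bool_less) (simp add: z word_def triple_word_def)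
  then show ?thesis by (simp only: iff) (simp add: z)
qed

lemma length_X: "(\<Sum>i<length (word z). of_bool (\<forall>j<Suc i. letter z (length (fst z) + 1 + j) \<noteq> 1)) = length (fst (snd z))"
proof -
  obtain I X Y where z: "z = (I, X, Y)" by (cases z)
  have a: "letter z (length (fst z) + 1 + j) \<noteq> 1" if "j < length X" for j
    using that by (simp add: z letter_word input_symbol_Some)
  have b: "letter z (length (fst z) + 1 + length X) = 1" by (simp add: z letter_word)
  have iff: "(\<forall>j<Suc i. letter z (length (fst z) + 1 + j) \<noteq> 1) \<longleftrightarrow> i < length X" for i
    using a b by (meson less_Suc_eq_le less_trans_Suc linorder_not_le order_less_le_trans)
  have "(\<Sum>i<length (word z). of_bool (i < length X)) = length X"
    by (rule sum_of_bool_less) (simp add: z word_def triple_word_def)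
  then show ?thesis by (simp only: iff) (simp add: z)
qed

lemma accessible_I: "accessible fst"
proof -
  have len: "feasible k (\<lambda>z \<sigma>. length (fst z))" for k
    unfolding length_I[symmetric]
    by (intro feasible_sum feasible_word_length feasible_of_bool checkable_all feasible_Suc checkable_not
        checkable_eq feasible_letter feasible_const)
  have "bit (fst z) j \<longleftrightarrow> j < length (fst z) \<and> letter z j = 3" for z :: inp and j
    by (cases z) (auto simp: bit_def letter_word input_symbol_Some)
  then show ?thesis unfolding accessible_def
    by (simp only:) (intro conjI allI impI len checkable_conj checkable_less checkable_eq feasible_letter feasible_const)
qed

lemma accessible_X: "accessible (\<lambda>z. fst (snd z))"
proof -
  note I = feasible_length[OF accessible_I]
  have len: "feasible k (\<lambda>z \<sigma>. length (fst (snd z)))" for k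
    unfolding length_X[symmetric]
    by (intro feasible_sum feasible_word_length feasible_of_bool checkable_all feasible_Suc checkable_not
        checkable_eq feasible_letter feasible_const feasible_add I)
  have "bit (fst (snd z)) j \<longleftrightarrow> j < length (fst (snd z)) \<and> letter z (length (fst z) + 1 + j) = 3" for z :: inp and j
    by (cases z) (auto simp: bit_def letter_word input_symbol_Some)
  then show ?thesis unfolding accessible_def
    by (simp only:) (intro conjI allI impI len checkable_conj checkable_less checkable_eq feasible_letter
      feasible_const feasible_add I)
qed

lemma accessible_Y: "accessible (\<lambda>z. snd (snd z))"
proof -
  note IX = feasible_length[OF accessible_I] feasible_length[OF accessible_X]
  have l: "length (snd (snd z)) = length (word z) - (length (fst z) + length (fst (snd z)) + 2)" for z :: inp
    by (cases z) (simp add: word_def triple_word_def)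
  have len: "feasible k (\<lambda>z \<sigma>. length (snd (snd z)))" for k
    unfolding l by (intro feasible_diff feasible_word_length feasible_add IX feasible_const)
  have "bit (snd (snd z)) j \<longleftrightarrow> j < length (snd (snd z)) \<and>
      letter z (length (fst z) + 1 + length (fst (snd z)) + 1 + j) = 3" for z :: inp and j
    by (cases z) (auto simp: bit_def letter_word input_symbol_Some)
  then show ?thesis unfolding accessible_def
    by (simp only:) (intro conjI allI impI len checkable_conj checkable_less checkable_eq feasible_letter
      feasible_const feasible_add IX)
qed


section \<open>Binary numbers\<close>

text \<open>A number is handled through a digit function whose digits may be any polynomially bounded numbers,
  not only 0 and 1; so sums, products and indexed sums need no carries.  Carries are computed only when two
  numbers are compared.\<close>

definition digit_function :: "nat \<Rightarrow> (inp \<Rightarrow> env \<Rightarrow> nat \<Rightarrow> nat) \<Rightarrow> bool" where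
  "digit_function k f \<longleftrightarrow> (\<forall>m a. k \<le> m \<longrightarrow> feasible m a \<longrightarrow> feasible m (\<lambda>z \<sigma>. f z \<sigma> (a z \<sigma>)))"

text \<open>\<open>D\<close> is a feasible number of digits. Since the digits vanish from
  \<open>D\<close> on, the range of summation may be enlarged, which brings two numbers to a common
  length.\<close>

definition big :: "nat \<Rightarrow> (inp \<Rightarrow> env \<Rightarrow> nat) \<Rightarrow> bool" where
  "big k F \<longleftrightarrow> (\<exists>f D. digit_function k f \<and> feasible k D \<and>
     (\<forall>z \<sigma>. F z \<sigma> = (\<Sum>d<D z \<sigma>. f z \<sigma> d * 2 ^ d)) \<and> (\<forall>z \<sigma> d. D z \<sigma> \<le> d \<longrightarrow> f z \<sigma> d = 0))"

lemma bigI: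
  assumes "digit_function k f" "feasible k D" "\<And>z \<sigma>. F z \<sigma> = (\<Sum>d<D z \<sigma>. f z \<sigma> d * 2 ^ d)"
    "\<And>z \<sigma> d. D z \<sigma> \<le> d \<Longrightarrow> f z \<sigma> d = 0"
  shows "big k F"
  using assms unfolding big_def by blast

lemma bigE:
  assumes "big k F"
  obtains f D where "digit_function k f" "feasible k D" "\<And>z \<sigma>. F z \<sigma> = (\<Sum>d<D z \<sigma>. f z \<sigma> d * 2 ^ d)"
    "\<And>z \<sigma> d. D z \<sigma> \<le> d \<Longrightarrow> f z \<sigma> d = 0"
  using assms unfolding big_def by blast

lemma digit_functionD: "digit_function k f \<Longrightarrow> k \<le> m \<Longrightarrow> feasible m a \<Longrightarrow> feasible m (\<lambda>z \<sigma>. f z \<sigma> (a z \<sigma>))"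
  by (simp add: digit_function_def)

lemma digit_functionI:
  "(\<And>m a. k \<le> m \<Longrightarrow> feasible m a \<Longrightarrow> feasible m (\<lambda>z \<sigma>. f z \<sigma> (a z \<sigma>))) \<Longrightarrow> digit_function k f"
  by (simp add: digit_function_def)

lemma digit_function_depends:
  assumes f: "digit_function k f" and eq: "\<And>v. v < k \<Longrightarrow> \<sigma> v = \<sigma>' v"
  shows "f z \<sigma> d = f z \<sigma>' d"
proof -
  have "feasible k (\<lambda>z \<sigma>. f z \<sigma> d)" by (rule digit_functionD[OF f order_refl feasible_const[of k d]])
  from dependsD[OF feasible_depends[OF this] eq] show ?thesis by simp
qed

lemma big_depends: "big k F \<Longrightarrow> depends k F"
proof (elim bigE)
  fix f D assume *: "digit_function k f" "feasible k D" "\<And>z \<sigma>. F z \<sigma> = (\<Sum>d<D z \<sigma>. f z \<sigma> d * 2 ^ d)"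
  show "depends k F" unfolding depends_def
  proof (intro allI impI)
    fix z \<sigma> \<sigma>' assume eq: "\<forall>v<k. \<sigma> v = (\<sigma>' v :: nat)"
    have "f z \<sigma> d = f z \<sigma>' d" for d by (rule digit_function_depends[OF *(1)]) (use eq in simp)
    moreover have "D z \<sigma> = D z \<sigma>'" by (rule dependsD[OF feasible_depends[OF *(2)]]) (use eq in simp)
    ultimately show "F z \<sigma> = F z \<sigma>'" by (simp add: *(3))
  qed
qed

lemma big_digits:
  assumes n: "feasible k n"
    and f: "\<And>m a. k \<le> m \<Longrightarrow> feasible m a \<Longrightarrow> feasible m (\<lambda>z \<sigma>. f z \<sigma> (a z \<sigma>))"
  shows "big k (\<lambda>z \<sigma>. \<Sum>d<n z \<sigma>. f z \<sigma> d * 2 ^ d)"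
proof (rule bigI[OF _ n])
  show "digit_function k (\<lambda>z \<sigma> d. if d < n z \<sigma> then f z \<sigma> d else 0)"
    by (rule digit_functionI) (intro feasible_if checkable_less feasible_const f feasible_weaken[OF n])
qed auto

lemma big_feasible:
  assumes "feasible k f"
  shows "big k f"
proof -
  have "big k (\<lambda>z \<sigma>. \<Sum>d<1. f z \<sigma> * 2 ^ d)"
    by (rule big_digits[OF feasible_const]) (rule feasible_weaken[OF assms])
  then show ?thesis by simp
qed

lemma digit_sum_extend:
  assumes "\<And>d. D \<le> d \<Longrightarrow> f d = (0 :: nat)" "D \<le> E"
  shows "(\<Sum>d<D. f d * 2 ^ d) = (\<Sum>d<E. f d * 2 ^ d)"
  using assms by (intro sum.mono_neutral_left) auto

lemma big_add:
  assumes "big k F" "big k G"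
  shows "big k (\<lambda>z \<sigma>. F z \<sigma> + G z \<sigma>)"
proof -
  obtain f D where f: "digit_function k f" "feasible k D" "\<And>z \<sigma>. F z \<sigma> = (\<Sum>d<D z \<sigma>. f z \<sigma> d * 2 ^ d)"
    "\<And>z \<sigma> d. D z \<sigma> \<le> d \<Longrightarrow> f z \<sigma> d = 0" using assms(1) unfolding big_def by blast
  obtain g E where g: "digit_function k g" "feasible k E" "\<And>z \<sigma>. G z \<sigma> = (\<Sum>d<E z \<sigma>. g z \<sigma> d * 2 ^ d)"
    "\<And>z \<sigma> d. E z \<sigma> \<le> d \<Longrightarrow> g z \<sigma> d = 0" using assms(2) unfolding big_def by blast
  show ?thesis
  proof (rule bigI)
    show "digit_function k (\<lambda>z \<sigma> d. f z \<sigma> d + g z \<sigma> d)"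
      by (intro digit_functionI feasible_add digit_functionD[OF f(1)] digit_functionD[OF g(1)])
    show "feasible k (\<lambda>z \<sigma>. D z \<sigma> + E z \<sigma>)" by (intro feasible_add f g)
    show "F z \<sigma> + G z \<sigma> = (\<Sum>d<D z \<sigma> + E z \<sigma>. (f z \<sigma> d + g z \<sigma> d) * 2 ^ d)" for z \<sigma>
      using digit_sum_extend[of "D z \<sigma>" "f z \<sigma>" "D z \<sigma> + E z \<sigma>", OF f(4)]
        digit_sum_extend[of "E z \<sigma>" "g z \<sigma>" "D z \<sigma> + E z \<sigma>", OF g(4)]
      by (simp add: f(3) g(3) algebra_simps sum.distrib)
  qed (simp add: f(4) g(4))
qed

text \<open>The Cauchy product. As the digits vanish from \<open>D\<close> and \<open>E\<close> on,
  the rectangle of index pairs may be enlarged to the triangle \<open>i + j < D + E\<close>, which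
  is then summed along its diagonals.\<close>

lemma digit_convolution:
  assumes "\<And>d. D \<le> d \<Longrightarrow> f d = (0 :: nat)" "\<And>d. E \<le> d \<Longrightarrow> g d = 0"
  shows "(\<Sum>d<D. f d * 2 ^ d) * (\<Sum>d<E. g d * 2 ^ d) = (\<Sum>d<D + E. (\<Sum>i<Suc d. f i * g (d - i)) * 2 ^ d)"
proof -
  let ?h = "\<lambda>i j. f i * g j * 2 ^ (i + j)"
  have fg: "f d > 0 \<Longrightarrow> d < D" "g d > 0 \<Longrightarrow> d < E" for d
    using assms[of d] by (cases "D \<le> d"; cases "E \<le> d"; simp)+
  have "(\<Sum>d<D. f d * 2 ^ d) * (\<Sum>d<E. g d * 2 ^ d) = (\<Sum>(i, j)\<in>{..<D} \<times> {..<E}. ?h i j)"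
    by (simp add: sum_product sum.cartesian_product power_add mult_ac)
  also have "\<dots> = (\<Sum>(i, j)\<in>{(i, j). i + j < D + E}. ?h i j)"
  proof (rule sum.mono_neutral_left)
    show "finite {(i, j). i + j < D + E}"
      by (rule finite_subset[of _ "{..<D + E} \<times> {..<D + E}"]) auto
    show "\<forall>x\<in>{(i, j). i + j < D + E} - {..<D} \<times> {..<E}. (case x of (i, j) \<Rightarrow> ?h i j) = 0"
      using fg by auto
  qed auto
  also have "\<dots> = (\<Sum>d<D + E. \<Sum>i\<le>d. ?h i (d - i))"
    by (rule sum.triangle_reindex)
  also have "\<dots> = (\<Sum>d<D + E. (\<Sum>i<Suc d. f i * g (d - i)) * 2 ^ d)"
    by (intro sum.cong) (auto simp: sum_distrib_right lessThan_Suc_atMost intro!: sum.cong)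
  finally show ?thesis .
qed

lemma big_mult:
  assumes "big k F" "big k G"
  shows "big k (\<lambda>z \<sigma>. F z \<sigma> * G z \<sigma>)"
proof -
  obtain f D where f: "digit_function k f" "feasible k D" "\<And>z \<sigma>. F z \<sigma> = (\<Sum>d<D z \<sigma>. f z \<sigma> d * 2 ^ d)"
    "\<And>z \<sigma> d. D z \<sigma> \<le> d \<Longrightarrow> f z \<sigma> d = 0" using assms(1) unfolding big_def by blast
  obtain g E where g: "digit_function k g" "feasible k E" "\<And>z \<sigma>. G z \<sigma> = (\<Sum>d<E z \<sigma>. g z \<sigma> d * 2 ^ d)"
    "\<And>z \<sigma> d. E z \<sigma> \<le> d \<Longrightarrow> g z \<sigma> d = 0" using assms(2) unfolding big_def by blast
  show ?thesis
  proof (rule bigI)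
    show "digit_function k (\<lambda>z \<sigma> d. \<Sum>i<Suc d. f z \<sigma> i * g z \<sigma> (d - i))"
    proof (rule digit_functionI)
      fix m a assume a: "k \<le> m" "feasible m a"
      show "feasible m (\<lambda>z \<sigma>. \<Sum>i<Suc (a z \<sigma>). f z \<sigma> i * g z \<sigma> (a z \<sigma> - i))"
        using a by (intro feasible_sum feasible_Suc feasible_mult digit_functionD[OF f(1)]
            digit_functionD[OF g(1)] feasible_diff) (auto intro: feasible_weaken)
    qed
    show "feasible k (\<lambda>z \<sigma>. D z \<sigma> + E z \<sigma>)" by (intro feasible_add f g)
    show "F z \<sigma> * G z \<sigma> = (\<Sum>d<D z \<sigma> + E z \<sigma>. (\<Sum>i<Suc d. f z \<sigma> i * g z \<sigma> (d - i)) * 2 ^ d)" for z \<sigma>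
      unfolding f(3) g(3) by (rule digit_convolution) (use f(4) g(4) in auto)
    show "(\<Sum>i<Suc d. f z \<sigma> i * g z \<sigma> (d - i)) = 0" if "D z \<sigma> + E z \<sigma> \<le> d" for z \<sigma> d
    proof (intro sum.neutral ballI)
      fix i show "f z \<sigma> i * g z \<sigma> (d - i) = 0"
        using that f(4)[of z \<sigma> i] g(4)[of z \<sigma> "d - i"] by (cases "D z \<sigma> \<le> i") auto
    qed
  qed
qed

lemma big_if:
  assumes P: "checkable k P" and "big k F" "big k G"
  shows "big k (\<lambda>z \<sigma>. if P z \<sigma> then F z \<sigma> else G z \<sigma>)"
proof -
  have "big k (\<lambda>z \<sigma>. of_bool (P z \<sigma>) * F z \<sigma> + of_bool (\<not> P z \<sigma>) * G z \<sigma>)"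
    by (intro big_add big_mult big_feasible feasible_of_bool checkable_not assms)
  moreover have "of_bool (P z \<sigma>) * F z \<sigma> + of_bool (\<not> P z \<sigma>) * G z \<sigma> = (if P z \<sigma> then F z \<sigma> else G z \<sigma>)" for z \<sigma>
    by simp
  ultimately show ?thesis by (simp only:)
qed

lemma feasible_upd:
  assumes "feasible (Suc k) h" "k \<le> m" "feasible m b"
  shows "feasible m (\<lambda>z \<sigma>. h z (\<sigma>(k := b z \<sigma>)))"
  using assms by (intro feasible_subst[OF assms(1)]) auto

text \<open>The digit position \<open>a\<close> refers to the environment before counter
  \<open>k\<close> is overwritten, so it is parked in another counter. Counter \<open>n\<close>
  cannot serve because \<open>k\<close> may equal \<open>n\<close>; with \<open>Suc n\<close> the
  result is feasible one level too high, which \<open>feasible_strengthen\<close> repairs.\<close>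

lemma digit_function_upd:
  assumes f: "digit_function (Suc k) f" and km: "k \<le> m" and b: "feasible m b"
  shows "digit_function m (\<lambda>z \<sigma> d. f z (\<sigma>(k := b z \<sigma>)) d)"
proof (rule digit_functionI)
  fix n a assume n: "m \<le> n" and a: "feasible n a"
  have bn: "feasible n b" by (rule feasible_weaken[OF b n])
  let ?h = "\<lambda>z \<sigma>. f z \<sigma> (\<sigma> (Suc n))"
  let ?g = "\<lambda>z \<sigma>. f z (\<sigma>(k := b z \<sigma>)) (\<sigma> (Suc n))"
  have "feasible (Suc (Suc n)) ?h" using km n by (intro digit_functionD[OF f] feasible_var) auto
  then have "feasible (Suc (Suc n)) (\<lambda>z \<sigma>. ?h z (\<sigma>(k := b z \<sigma>)))"
    using km n by (intro feasible_subst[of "Suc (Suc n)"] feasible_weaken[OF bn]) auto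
  then have g: "feasible (Suc (Suc n)) ?g" using km n by simp
  have "feasible (Suc n) (\<lambda>z \<sigma>. ?g z (\<sigma>(Suc n := a z \<sigma>)))"
    by (intro feasible_upd[OF g] feasible_weaken[OF a]) auto
  moreover have "?g z (\<sigma>(Suc n := a z \<sigma>)) = f z (\<sigma>(k := b z \<sigma>)) (a z \<sigma>)" for z \<sigma>
  proof -
    have "b z (\<sigma>(Suc n := a z \<sigma>)) = b z \<sigma>" by (rule dependsD[OF feasible_depends[OF bn]]) auto
    moreover have "f z (\<sigma>(Suc n := a z \<sigma>, k := b z \<sigma>)) d = f z (\<sigma>(k := b z \<sigma>)) d" for d
      using km n by (intro digit_function_depends[OF f]) auto
    ultimately show ?thesis by simp
  qed
  ultimately have *: "feasible (Suc n) (\<lambda>z \<sigma>. f z (\<sigma>(k := b z \<sigma>)) (a z \<sigma>))" by (simp only:)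
  have "depends n (\<lambda>z \<sigma>. f z (\<sigma>(k := b z \<sigma>)) (a z \<sigma>))"
    unfolding depends_def
  proof (intro allI impI)
    fix z \<sigma> \<sigma>' assume eq: "\<forall>v<n. \<sigma> v = (\<sigma>' v :: nat)"
    have "a z \<sigma> = a z \<sigma>'" by (rule dependsD[OF feasible_depends[OF a]]) (use eq in simp)
    moreover have "b z \<sigma> = b z \<sigma>'" by (rule dependsD[OF feasible_depends[OF bn]]) (use eq in simp)
    moreover have "f z (\<sigma>(k := x)) d = f z (\<sigma>'(k := x)) d" for x d
      by (rule digit_function_depends[OF f]) (use eq km n in auto)
    ultimately show "f z (\<sigma>(k := b z \<sigma>)) (a z \<sigma>) = f z (\<sigma>'(k := b z \<sigma>')) (a z \<sigma>')" by simp
  qed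
  then show "feasible n (\<lambda>z \<sigma>. f z (\<sigma>(k := b z \<sigma>)) (a z \<sigma>))"
    by (rule feasible_strengthen[OF *])
qed

lemma big_upd:
  assumes "big (Suc k) F" "k \<le> m" "feasible m b"
  shows "big m (\<lambda>z \<sigma>. F z (\<sigma>(k := b z \<sigma>)))"
proof -
  obtain f D where f: "digit_function (Suc k) f" "feasible (Suc k) D" "\<And>z \<sigma>. F z \<sigma> = (\<Sum>d<D z \<sigma>. f z \<sigma> d * 2 ^ d)"
    "\<And>z \<sigma> d. D z \<sigma> \<le> d \<Longrightarrow> f z \<sigma> d = 0" using assms(1) unfolding big_def by blast
  show ?thesis
    by (rule bigI[OF digit_function_upd[OF f(1) assms(2,3)] feasible_upd[OF f(2) assms(2,3)]]) (auto simp: f(3,4))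
qed

text \<open>The summands are added digit by digit without carries; the sum of their digit counts is
  a common length for all of them.\<close>

lemma big_sum:
  assumes n: "feasible k n"
    and F: "\<And>m a. k \<le> m \<Longrightarrow> feasible m a \<Longrightarrow> big m (\<lambda>z \<sigma>. F z \<sigma> (a z \<sigma>))"
  shows "big k (\<lambda>z \<sigma>. \<Sum>i<n z \<sigma>. F z \<sigma> i)"
proof -
  have "big (Suc k) (\<lambda>z \<sigma>. F z \<sigma> (\<sigma> k))" by (intro F feasible_var) auto
  then obtain f D where f: "digit_function (Suc k) f" "feasible (Suc k) D"
    "\<And>z \<sigma>. F z \<sigma> (\<sigma> k) = (\<Sum>d<D z \<sigma>. f z \<sigma> d * 2 ^ d)"
    "\<And>z \<sigma> d. D z \<sigma> \<le> d \<Longrightarrow> f z \<sigma> d = 0" unfolding big_def by blast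
  have F': "F z \<sigma> i = (\<Sum>d<D z (\<sigma>(k := i)). f z (\<sigma>(k := i)) d * 2 ^ d)" for z \<sigma> i
  proof -
    have "F z \<sigma> i = F z (\<sigma>(k := i)) i"
      by (rule dependsD[OF big_depends[OF F[OF order_refl feasible_const]]]) simp
    then show ?thesis using f(3)[of z "\<sigma>(k := i)"] by simp
  qed
  show ?thesis
  proof (rule bigI)
    show "digit_function k (\<lambda>z \<sigma> d. \<Sum>i<n z \<sigma>. f z (\<sigma>(k := i)) d)"
    proof (rule digit_functionI)
      fix m a assume a: "k \<le> m" "feasible m a"
      show "feasible m (\<lambda>z \<sigma>. \<Sum>i<n z \<sigma>. f z (\<sigma>(k := i)) (a z \<sigma>))"
      proof (rule feasible_sum)
        fix m' b assume b: "m \<le> m'" "feasible m' b"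
        show "feasible m' (\<lambda>z \<sigma>. f z (\<sigma>(k := b z \<sigma>)) (a z \<sigma>))"
          by (rule digit_functionD[OF digit_function_upd[OF f(1) order_trans[OF a(1) b(1)] b(2)] order_refl
                feasible_weaken[OF a(2) b(1)]])
      qed (rule feasible_weaken[OF n a(1)])
    qed
    let ?D = "\<lambda>z \<sigma>. \<Sum>i<n z \<sigma>. D z (\<sigma>(k := i))"
    show "feasible k ?D"
    proof (rule feasible_sum[OF n])
      fix m a assume "k \<le> m" "feasible m a"
      then show "feasible m (\<lambda>z \<sigma>. D z (\<sigma>(k := a z \<sigma>)))" by (rule feasible_upd[OF f(2)])
    qed
    have le: "D z (\<sigma>(k := i)) \<le> ?D z \<sigma>" if "i < n z \<sigma>" for z \<sigma> i
      using that by (intro member_le_sum) auto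
    show "(\<Sum>i<n z \<sigma>. F z \<sigma> i) = (\<Sum>d<?D z \<sigma>. (\<Sum>i<n z \<sigma>. f z (\<sigma>(k := i)) d) * 2 ^ d)" for z \<sigma>
    proof -
      have "(\<Sum>i<n z \<sigma>. F z \<sigma> i) = (\<Sum>i<n z \<sigma>. \<Sum>d<?D z \<sigma>. f z (\<sigma>(k := i)) d * 2 ^ d)"
        unfolding F' by (intro sum.cong refl digit_sum_extend f(4) le) auto
      also have "\<dots> = (\<Sum>d<?D z \<sigma>. \<Sum>i<n z \<sigma>. f z (\<sigma>(k := i)) d * 2 ^ d)" by (rule sum.swap)
      finally show ?thesis by (simp add: sum_distrib_right)
    qed
    show "(\<Sum>i<n z \<sigma>. f z (\<sigma>(k := i)) d) = 0" if "?D z \<sigma> \<le> d" for z \<sigma> d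
    proof (intro sum.neutral ballI)
      fix i assume "i \<in> {..<n z \<sigma>}"
      then have "D z (\<sigma>(k := i)) \<le> d" using le[of i z \<sigma>] that by simp
      then show "f z (\<sigma>(k := i)) d = 0" by (rule f(4))
    qed
  qed
qed

text \<open>The carries of the difference of two numbers, shifted by an upper bound \<open>S\<close> for the digits
  that are subtracted.\<close>

definition carry :: "nat \<Rightarrow> (nat \<Rightarrow> nat) \<Rightarrow> (nat \<Rightarrow> nat) \<Rightarrow> nat \<Rightarrow> nat" where
  "carry S f g = rec_nat S (\<lambda>d c. (c + (f d + (S - g d))) div 2)"

text \<open>A difference is negative exactly if its floor quotient by \<open>2 ^ n\<close> is, and
  this quotient is the last carry minus the shift \<open>S\<close>.\<close>

lemma carry_less_iff:
  assumes "\<And>d. d < n \<Longrightarrow> g d \<le> S"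
  shows "(\<Sum>d<n. f d * 2 ^ d) < (\<Sum>d<n. g d * 2 ^ d) \<longleftrightarrow> carry S f g n < S"
proof -
  \<comment> \<open>Invariant: for the difference of the lowest \<open>m\<close> digits,
    \<open>l\<close> is the remainder modulo \<open>2 ^ m\<close> and the carry minus
    \<open>S\<close> the quotient. The natural subtraction \<open>S - g d\<close> is exact because
    \<open>g d \<le> S\<close>.\<close>
  have "\<exists>l. 0 \<le> l \<and> l < 2 ^ m \<and>
      (\<Sum>d<m. int (f d) * 2 ^ d) - (\<Sum>d<m. int (g d) * 2 ^ d) = l + 2 ^ m * (int (carry S f g m) - int S)"
    if "m \<le> n" for m
    using that
  proof (induction m)
    case 0
    then show ?case by (auto simp: carry_def)
  next
    case (Suc m)
    then obtain l where l: "0 \<le> l" "l < 2 ^ m"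
      "(\<Sum>d<m. int (f d) * 2 ^ d) - (\<Sum>d<m. int (g d) * 2 ^ d) = l + 2 ^ m * (int (carry S f g m) - int S)"
      by auto
    let ?x = "carry S f g m + (f m + (S - g m))"
    have x: "int ?x = int (carry S f g m) + int (f m) + int S - int (g m)"
      using assms[of m] Suc.prems by simp
    have c: "int (carry S f g (Suc m)) = int ?x div 2"
      by (simp add: carry_def zdiv_int)
    have split: "l + 2 ^ m * (y - 2 * s) = (l + 2 ^ m * (y mod 2)) + 2 ^ Suc m * (y div 2 - s)" for y s :: int
    proof -
      obtain q r where "y = 2 * q + r" "y div 2 = q" "y mod 2 = r" by (metis mult_div_mod_eq)
      then show ?thesis by (simp only:) (simp add: algebra_simps)
    qed
    have small: "l + 2 ^ m * (y mod 2) < 2 ^ Suc m" for y :: int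
    proof -
      have "2 ^ m * (y mod 2) \<le> 2 ^ m * 1" by (intro mult_left_mono) auto
      then have "2 ^ m * (y mod 2) \<le> 2 ^ m" by (simp only: mult_1_right)
      then show ?thesis using l(2) unfolding power_Suc by linarith
    qed
    have "(\<Sum>d<Suc m. int (f d) * 2 ^ d) - (\<Sum>d<Suc m. int (g d) * 2 ^ d)
        = l + 2 ^ m * (int ?x - 2 * int S)"
      using l(3) x by (simp add: algebra_simps)
    also have "\<dots> = (l + 2 ^ m * (int ?x mod 2)) + 2 ^ Suc m * (int (carry S f g (Suc m)) - int S)"
      unfolding c by (rule split)
    finally have "(\<Sum>d<Suc m. int (f d) * 2 ^ d) - (\<Sum>d<Suc m. int (g d) * 2 ^ d) =
       (l + 2 ^ m * (int ?x mod 2)) + 2 ^ Suc m * (int (carry S f g (Suc m)) - int S)" .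
    moreover have "0 \<le> l + 2 ^ m * (int ?x mod 2)" using l by simp
    moreover have "l + 2 ^ m * (int ?x mod 2) < 2 ^ Suc m" by (rule small)
    ultimately show ?case by blast
  qed
  from this[OF order_refl] obtain l :: int where l: "0 \<le> l" "l < 2 ^ n"
    "(\<Sum>d<n. int (f d) * 2 ^ d) - (\<Sum>d<n. int (g d) * 2 ^ d) = l + 2 ^ n * (int (carry S f g n) - int S)"
    by blast
  have "(\<Sum>d<n. f d * 2 ^ d) < (\<Sum>d<n. g d * 2 ^ d) \<longleftrightarrow>
      int (\<Sum>d<n. f d * 2 ^ d) < int (\<Sum>d<n. g d * 2 ^ d)" by (simp only: of_nat_less_iff)
  also have "\<dots> \<longleftrightarrow> l + 2 ^ n * (int (carry S f g n) - int S) < 0"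
  proof -
    have "int (\<Sum>d<n. f d * 2 ^ d) - int (\<Sum>d<n. g d * 2 ^ d) = l + 2 ^ n * (int (carry S f g n) - int S)"
      using l(3) by simp
    then show ?thesis by linarith
  qed
  also have "\<dots> \<longleftrightarrow> int (carry S f g n) - int S < 0"
  proof
    assume "l + 2 ^ n * (int (carry S f g n) - int S) < 0"
    then have "2 ^ n * (int (carry S f g n) - int S) < 0" using l(1) by simp
    then show "int (carry S f g n) - int S < 0" by (simp add: mult_less_0_iff)
  next
    assume "int (carry S f g n) - int S < 0"
    then have "2 ^ n * (int (carry S f g n) - int S) \<le> 2 ^ n * (- 1)" by (intro mult_left_mono) auto
    then show "l + 2 ^ n * (int (carry S f g n) - int S) < 0" using l(2) by simp
  qed
  finally show ?thesis by simp
qed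

lemma carry_le: "carry S f g n \<le> S + (\<Sum>d<n. f d)"
  by (induction n) (auto simp: carry_def)

lemma checkable_big_less:
  assumes "big k F" "big k G"
  shows "checkable k (\<lambda>z \<sigma>. F z \<sigma> < G z \<sigma>)"
proof -
  obtain f D where f: "digit_function k f" "feasible k D" "\<And>z \<sigma>. F z \<sigma> = (\<Sum>d<D z \<sigma>. f z \<sigma> d * 2 ^ d)"
    "\<And>z \<sigma> d. D z \<sigma> \<le> d \<Longrightarrow> f z \<sigma> d = 0" using assms(1) unfolding big_def by blast
  obtain g E where g: "digit_function k g" "feasible k E" "\<And>z \<sigma>. G z \<sigma> = (\<Sum>d<E z \<sigma>. g z \<sigma> d * 2 ^ d)"
    "\<And>z \<sigma> d. E z \<sigma> \<le> d \<Longrightarrow> g z \<sigma> d = 0" using assms(2) unfolding big_def by blast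
  let ?n = "\<lambda>z \<sigma>. D z \<sigma> + E z \<sigma>"
  \<comment> \<open>The sum of the digits of \<open>G\<close> is a feasible upper bound for each of
    them.\<close>
  let ?S = "\<lambda>z \<sigma>. \<Sum>d<?n z \<sigma>. g z \<sigma> d"
  let ?B = "\<lambda>z \<sigma>. ?S z \<sigma> + (\<Sum>d<?n z \<sigma>. f z \<sigma> d)"
  have n: "feasible k ?n" by (intro feasible_add f g)
  have S: "feasible k ?S" by (intro feasible_sum n digit_functionD[OF g(1)])
  have B: "feasible k ?B" by (intro feasible_add S feasible_sum n digit_functionD[OF f(1)])
  have "F z \<sigma> < G z \<sigma> \<longleftrightarrow> carry (?S z \<sigma>) (f z \<sigma>) (g z \<sigma>) (?n z \<sigma>) < ?S z \<sigma>" for z \<sigma>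
  proof -
    have "F z \<sigma> = (\<Sum>d<?n z \<sigma>. f z \<sigma> d * 2 ^ d)" "G z \<sigma> = (\<Sum>d<?n z \<sigma>. g z \<sigma> d * 2 ^ d)"
      unfolding f(3) g(3) by (intro digit_sum_extend f(4) g(4); simp)+
    moreover have "g z \<sigma> d \<le> ?S z \<sigma>" if "d < ?n z \<sigma>" for d using that by (intro member_le_sum) auto
    ultimately show ?thesis using carry_less_iff[of "?n z \<sigma>" "g z \<sigma>" "?S z \<sigma>" "f z \<sigma>"] by simp
  qed
  moreover have "feasible k (\<lambda>z \<sigma>. carry (?S z \<sigma>) (f z \<sigma>) (g z \<sigma>) (?n z \<sigma>))"
    unfolding carry_def
  proof (rule feasible_rec[OF n S _ feasible_pbounded[OF B order_refl]])
    fix m a b assume a: "k \<le> m" "feasible m a" "feasible m b"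
    show "feasible m (\<lambda>z \<sigma>. (b z \<sigma> + (f z \<sigma> (a z \<sigma>) + (?S z \<sigma> - g z \<sigma> (a z \<sigma>)))) div 2)"
      using a by (intro feasible_div2 feasible_add feasible_diff digit_functionD[OF f(1)]
         digit_functionD[OF g(1)] feasible_weaken[OF S]) auto
  next
    fix z \<sigma> i assume "i \<le> ?n z \<sigma>"
    then have "(\<Sum>d<i. f z \<sigma> d) \<le> (\<Sum>d<?n z \<sigma>. f z \<sigma> d)" by (intro sum_mono2) auto
    then have "carry (?S z \<sigma>) (f z \<sigma>) (g z \<sigma>) i \<le> ?B z \<sigma>"
      using carry_le[of "?S z \<sigma>" "f z \<sigma>" "g z \<sigma>" i] by simp
    then show "rec_nat (?S z \<sigma>) (\<lambda>d c. (c + (f z \<sigma> d + (?S z \<sigma> - g z \<sigma> d))) div 2) i \<le> ?B z \<sigma>"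
      by (simp add: carry_def)
  qed
  ultimately show ?thesis using checkable_less[OF _ S] by simp
qed

section \<open>Signed numbers as differences\<close>

definition bigint :: "nat \<Rightarrow> (inp \<Rightarrow> env \<Rightarrow> int) \<Rightarrow> bool" where
  "bigint k F \<longleftrightarrow> (\<exists>A B. big k A \<and> big k B \<and> (\<forall>z \<sigma>. F z \<sigma> = int (A z \<sigma>) - int (B z \<sigma>)))"

lemma bigintI: "big k A \<Longrightarrow> big k B \<Longrightarrow> (\<And>z \<sigma>. F z \<sigma> = int (A z \<sigma>) - int (B z \<sigma>)) \<Longrightarrow> bigint k F"
  unfolding bigint_def by blast

lemma bigintE:
  assumes "bigint k F"
  obtains A B where "big k A" "big k B" "\<And>z \<sigma>. F z \<sigma> = int (A z \<sigma>) - int (B z \<sigma>)"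
  using assms unfolding bigint_def by blast

lemma bigint_big: "big k F \<Longrightarrow> bigint k (\<lambda>z \<sigma>. int (F z \<sigma>))"
  by (rule bigintI[OF _ big_feasible[OF feasible_const[of k 0]]]) auto

lemma bigint_uminus: "bigint k F \<Longrightarrow> bigint k (\<lambda>z \<sigma>. - F z \<sigma>)"
  by (elim bigintE, rule bigintI) auto

lemma bigint_add: "bigint k F \<Longrightarrow> bigint k G \<Longrightarrow> bigint k (\<lambda>z \<sigma>. F z \<sigma> + G z \<sigma>)"
  apply (elim bigintE)
  subgoal for A B A' B' by (rule bigintI[of k "\<lambda>z \<sigma>. A z \<sigma> + A' z \<sigma>" "\<lambda>z \<sigma>. B z \<sigma> + B' z \<sigma>"]) (auto intro: big_add)
  done

lemma bigint_mult:
  assumes "bigint k F" "bigint k G"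
  shows "bigint k (\<lambda>z \<sigma>. F z \<sigma> * G z \<sigma>)"
proof -
  obtain A B where A: "big k A" "big k B" "\<And>z \<sigma>. F z \<sigma> = int (A z \<sigma>) - int (B z \<sigma>)"
    using assms(1) unfolding bigint_def by blast
  obtain A' B' where B: "big k A'" "big k B'" "\<And>z \<sigma>. G z \<sigma> = int (A' z \<sigma>) - int (B' z \<sigma>)"
    using assms(2) unfolding bigint_def by blast
  show ?thesis
    by (rule bigintI[OF big_add[OF big_mult[OF A(1) B(1)] big_mult[OF A(2) B(2)]]
          big_add[OF big_mult[OF A(1) B(2)] big_mult[OF A(2) B(1)]]])
       (simp add: A(3) B(3) algebra_simps)
qed

lemma bigint_if:
  "checkable k P \<Longrightarrow> bigint k F \<Longrightarrow> bigint k G \<Longrightarrow> bigint k (\<lambda>z \<sigma>. if P z \<sigma> then F z \<sigma> else G z \<sigma>)"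
  apply (elim bigintE)
  subgoal for A B A' B'
    by (rule bigintI[of k "\<lambda>z \<sigma>. if P z \<sigma> then A z \<sigma> else A' z \<sigma>" "\<lambda>z \<sigma>. if P z \<sigma> then B z \<sigma> else B' z \<sigma>"])
       (auto intro: big_if)
  done

lemma bigint_sum:
  assumes n: "feasible k n"
    and F: "\<And>m a. k \<le> m \<Longrightarrow> feasible m a \<Longrightarrow> bigint m (\<lambda>z \<sigma>. F z \<sigma> (a z \<sigma>))"
  shows "bigint k (\<lambda>z \<sigma>. \<Sum>i<n z \<sigma>. F z \<sigma> i)"
proof -
  have "bigint (Suc k) (\<lambda>z \<sigma>. F z \<sigma> (\<sigma> k))" by (intro F feasible_var) auto
  then obtain A B where AB: "big (Suc k) A" "big (Suc k) B" "\<And>z \<sigma>. F z \<sigma> (\<sigma> k) = int (A z \<sigma>) - int (B z \<sigma>)"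
    unfolding bigint_def by blast
  have F': "F z \<sigma> i = int (A z (\<sigma>(k := i))) - int (B z (\<sigma>(k := i)))" for z \<sigma> i
  proof -
    \<comment> \<open>That \<open>F\<close> at a constant index ignores counter \<open>k\<close> is
      read off from a decomposition at level \<open>k\<close>, which may differ from
      \<open>A\<close> and \<open>B\<close>.\<close>
    obtain A' B' where *: "big k A'" "big k B'" "\<And>z \<sigma>. F z \<sigma> i = int (A' z \<sigma>) - int (B' z \<sigma>)"
      using F[OF order_refl feasible_const[of k i]] unfolding bigint_def by blast
    have "A' z \<sigma> = A' z (\<sigma>(k := i))" by (rule dependsD[OF big_depends[OF *(1)]]) simp
    moreover have "B' z \<sigma> = B' z (\<sigma>(k := i))" by (rule dependsD[OF big_depends[OF *(2)]]) simp
    ultimately have "F z \<sigma> i = F z (\<sigma>(k := i)) i" by (simp add: *(3))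
    then show ?thesis using AB(3)[of z "\<sigma>(k := i)"] by simp
  qed
  have "big k (\<lambda>z \<sigma>. \<Sum>i<n z \<sigma>. A z (\<sigma>(k := i)))" if A: "big (Suc k) A" for A
  proof (rule big_sum[OF n])
    fix m a assume "k \<le> m" "feasible m a"
    then show "big m (\<lambda>z \<sigma>. A z (\<sigma>(k := a z \<sigma>)))" by (rule big_upd[OF A])
  qed
  from this[OF AB(1)] this[OF AB(2)] show ?thesis
    by (rule bigintI) (simp add: F' sum_subtractf)
qed

lemma checkable_bigint_less: "bigint k F \<Longrightarrow> bigint k G \<Longrightarrow> checkable k (\<lambda>z \<sigma>. F z \<sigma> < G z \<sigma>)"
proof (elim bigintE)
  fix A B A' B'
  assume *: "big k A" "big k B" "\<And>z \<sigma>. F z \<sigma> = int (A z \<sigma>) - int (B z \<sigma>)"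
    "big k A'" "big k B'" "\<And>z \<sigma>. G z \<sigma> = int (A' z \<sigma>) - int (B' z \<sigma>)"
  have "F z \<sigma> < G z \<sigma> \<longleftrightarrow> A z \<sigma> + B' z \<sigma> < A' z \<sigma> + B z \<sigma>" for z \<sigma> by (auto simp: *(3,6))
  moreover have "checkable k (\<lambda>z \<sigma>. A z \<sigma> + B' z \<sigma> < A' z \<sigma> + B z \<sigma>)"
    by (intro checkable_big_less big_add *)
  ultimately show ?thesis by (simp only:)
qed

lemma checkable_bigint_le: "bigint k F \<Longrightarrow> bigint k G \<Longrightarrow> checkable k (\<lambda>z \<sigma>. F z \<sigma> \<le> G z \<sigma>)"
  unfolding not_less[symmetric] by (intro checkable_not checkable_bigint_less)


section \<open>Farkas' lemma\<close>

type_synonym ineq = "(nat \<Rightarrow> real) \<times> real"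

text \<open>Nonnegative combinations of inequalities, where \<open>(a, b)\<close> stands for the
  inequality with left-hand coefficients \<open>a\<close> and right-hand side
  \<open>b\<close>.\<close>

inductive_set cone :: "ineq set \<Rightarrow> ineq set" for S where
  cone_zero: "(\<lambda>_. 0, 0) \<in> cone S"
| cone_base: "p \<in> S \<Longrightarrow> p \<in> cone S"
| cone_add: "(a, b) \<in> cone S \<Longrightarrow> (a', b') \<in> cone S \<Longrightarrow> (\<lambda>i. a i + a' i, b + b') \<in> cone S"
| cone_scale: "(a, b) \<in> cone S \<Longrightarrow> 0 \<le> c \<Longrightarrow> (\<lambda>i. c * a i, c * b) \<in> cone S"

lemma separating_real:
  fixes L U :: "real set"
  assumes "finite L" "finite U" "\<And>l u. l \<in> L \<Longrightarrow> u \<in> U \<Longrightarrow> l \<le> u"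
  shows "\<exists>t. (\<forall>l\<in>L. l \<le> t) \<and> (\<forall>u\<in>U. t \<le> u)"
proof (cases "L = {}")
  case True
  then show ?thesis
    using assms(2) by (intro exI[of _ "if U = {} then 0 else Min U"]) auto
next
  case False
  then show ?thesis using assms by (intro exI[of _ "Max L"]) auto
qed

text \<open>Fourier-Motzkin elimination of the last variable.\<close>

lemma infeasible_cone:
  assumes "finite S" "\<And>y. \<exists>(a, b)\<in>S. \<not> (\<Sum>i<n. a i * y i) \<le> b"
  shows "\<exists>a b. (a, b) \<in> cone S \<and> (\<forall>i<n. a i = 0) \<and> b < 0"
  using assms
proof (induction n arbitrary: S)
  case 0
  then show ?case by (fastforce intro: cone_base)
next
  case (Suc n)
  let ?P = "{p \<in> S. fst p n > 0}" and ?N = "{p \<in> S. fst p n < 0}" and ?Z = "{p \<in> S. fst p n = 0}"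
  \<comment> \<open>For \<open>p\<close> in \<open>?P\<close> and \<open>q\<close> in
    \<open>?N\<close> both factors are positive, and variable \<open>n\<close> cancels.\<close>
  define comb :: "ineq \<Rightarrow> ineq \<Rightarrow> ineq" where
    "comb p q = ((\<lambda>i. (- fst q n) * fst p i + fst p n * fst q i), (- fst q n) * snd p + fst p n * snd q)" for p q
  define S' where "S' = ?Z \<union> (\<lambda>(p, q). comb p q) ` (?P \<times> ?N)"
  have fin: "finite S'" unfolding S'_def using Suc.prems(1) by (intro finite_UnI finite_imageI finite_cartesian_product) auto
  have inf: "\<exists>(a, b)\<in>S'. \<not> (\<Sum>i<n. a i * y i) \<le> b" for y
  proof (rule ccontr)
    assume "\<not> ?thesis"
    then have sat: "(\<Sum>i<n. fst p i * y i) \<le> snd p" if "p \<in> S'" for p using that by force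
    let ?s = "\<lambda>p. \<Sum>i<n. fst p i * y i"
    \<comment> \<open>Solved for variable \<open>n\<close>, the inequalities of \<open>?P\<close>
      bound it from above and those of \<open>?N\<close> from below; the combined inequalities state
      that no lower bound exceeds an upper bound.\<close>
    let ?b = "\<lambda>p. (snd p - ?s p) / fst p n"
    have "l \<le> u" if l: "l \<in> ?b ` ?N" and u: "u \<in> ?b ` ?P" for l u
    proof -
      obtain q where q: "q \<in> S" "fst q n < 0" "l = ?b q" using l by blast
      obtain p where p: "p \<in> S" "fst p n > 0" "u = ?b p" using u by blast
      have "comb p q \<in> S'" using p q by (auto simp: S'_def intro!: rev_image_eqI[of "(p, q)"])
      from sat[OF this] have "(- fst q n) * ?s p + fst p n * ?s q \<le> (- fst q n) * snd p + fst p n * snd q"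
        by (simp add: comb_def sum.distrib sum_distrib_left algebra_simps sum_negf sum_subtractf)
      then have *: "fst q n * (snd p - ?s p) \<le> fst p n * (snd q - ?s q)" by (simp add: algebra_simps)
      have "snd p - ?s p = u * fst p n" "snd q - ?s q = l * fst q n" using p q by auto
      with * have "(fst q n * fst p n) * u \<le> (fst q n * fst p n) * l" by (simp only:) (simp add: mult_ac)
      then show ?thesis using p(2) q(2) by (simp add: mult_le_cancel_left_neg mult_neg_pos)
    qed
    then obtain t where t: "\<forall>l\<in>?b ` ?N. l \<le> t" "\<forall>u\<in>?b ` ?P. t \<le> u"
      using separating_real[of "?b ` ?N" "?b ` ?P"] Suc.prems(1) by auto
    have "(\<Sum>i<Suc n. fst p i * (y(n := t)) i) \<le> snd p" if p: "p \<in> S" for p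
    proof -
      have e: "(\<Sum>i<Suc n. fst p i * (y(n := t)) i) = ?s p + fst p n * t" by simp
      consider "fst p n = 0" | "fst p n > 0" | "fst p n < 0" by linarith
      then show ?thesis
      proof cases
        case 1
        then show ?thesis using sat[of p] p unfolding e by (simp add: S'_def)
      next
        case 2
        then have "t \<le> ?b p" using t(2) p by blast
        then show ?thesis using 2 unfolding e by (simp add: pos_le_divide_eq mult.commute)
      next
        case 3
        then have "?b p \<le> t" using t(1) p by blast
        then show ?thesis using 3 unfolding e by (simp add: neg_divide_le_eq mult.commute)
      qed
    qed
    then show False using Suc.prems(2)[of "y(n := t)"] by force
  qed
  obtain a b where ab: "(a, b) \<in> cone S'" "\<forall>i<n. a i = 0" "b < 0" using Suc.IH[OF fin inf] by blast
  have "p \<in> cone S \<and> fst p n = 0" if "p \<in> cone S'" for p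
    using that
  proof (induction rule: cone.induct)
    case (cone_base p)
    then consider "p \<in> S" "fst p n = 0" | r q where "r \<in> S" "fst r n > 0" "q \<in> S" "fst q n < 0" "p = comb r q"
      by (auto simp: S'_def)
    then show ?case
    proof cases
      case 1
      then show ?thesis by (auto intro: cone.cone_base)
    next
      case 2
      have "(\<lambda>i. (- fst q n) * fst r i, (- fst q n) * snd r) \<in> cone S"
        using 2 by (intro cone_scale cone.cone_base) auto
      moreover have "(\<lambda>i. fst r n * fst q i, fst r n * snd q) \<in> cone S"
        using 2 by (intro cone_scale cone.cone_base) auto
      ultimately show ?thesis using cone_add 2(5) unfolding comb_def by force
    qed
  qed (auto intro: cone.intros)
  from this[OF ab(1)] ab show ?case by (auto simp: less_Suc_eq)
qed

text \<open>In a derivation of the contradiction the rows get multipliers \<open>l\<close>, the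
  upper bounds \<open>\<mu>\<close> and the lower bounds some \<open>\<nu>\<close>. Column by column
  the three parts cancel; dropping the nonnegative \<open>\<nu>\<close> leaves the inequality stated
  for each column.\<close>

lemma farkas_box:
  fixes W :: "nat \<Rightarrow> nat \<Rightarrow> real" and t :: "nat \<Rightarrow> real"
  assumes infeasible: "\<nexists>y. (\<forall>j<n. 0 \<le> y j \<and> y j \<le> R) \<and> (\<forall>i<m. t i + (\<Sum>j<n. W i j * y j) \<le> 0)"
  shows "\<exists>l \<mu>. (\<forall>i. 0 \<le> l i) \<and> (\<forall>j. 0 \<le> \<mu> j) \<and>
     (\<forall>j<n. 0 \<le> (\<Sum>i<m. l i * W i j) + \<mu> j) \<and> R * (\<Sum>j<n. \<mu> j) < (\<Sum>i<m. l i * t i)"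
proof -
  let ?e = "\<lambda>j i. if i = j then 1 else 0 :: real"
  define S where "S = (\<lambda>i. (W i, - t i)) ` {..<m} \<union> (\<lambda>j. (?e j, R)) ` {..<n} \<union> (\<lambda>j. (\<lambda>i. - ?e j i, 0)) ` {..<n}"
  have e: "(\<Sum>i<n. ?e j i * y i) = y j" "(\<Sum>i<n. - ?e j i * y i) = - y j" if "j < n" for j and y :: "nat \<Rightarrow> real"
  proof -
    have "(\<Sum>i<n. ?e j i * y i) = (\<Sum>i<n. if i = j then y i else 0)" by (intro sum.cong) auto
    then show "(\<Sum>i<n. ?e j i * y i) = y j" using that by (simp add: sum.delta)
    then show "(\<Sum>i<n. - ?e j i * y i) = - y j" by (simp add: sum_negf)
  qed
  have "\<exists>(a, b)\<in>S. \<not> (\<Sum>i<n. a i * y i) \<le> b" for y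
  proof (rule ccontr)
    assume "\<not> ?thesis"
    then have sat: "(\<Sum>i<n. a i * y i) \<le> b" if "(a, b) \<in> S" for a b using that by blast
    have "t i + (\<Sum>j<n. W i j * y j) \<le> 0" if "i < m" for i
      using sat[of "W i" "- t i"] that by (auto simp: S_def)
    moreover have "y j \<le> R" "0 \<le> y j" if "j < n" for j
      using sat[of "?e j" R] sat[of "\<lambda>i. - ?e j i" 0] that e[OF that, of y] by (auto simp: S_def)
    ultimately show False using infeasible by blast
  qed
  moreover have "finite S" by (simp add: S_def)
  ultimately obtain a b where ab: "(a, b) \<in> cone S" "\<forall>i<n. a i = 0" "b < 0"
    using infeasible_cone[of S n] by blast
  \<comment> \<open>Induction on the derivation of an inequality in the cone makes the multipliers
    explicit.\<close>
  have "\<exists>l \<mu> \<nu>. (\<forall>i. 0 \<le> l i) \<and> (\<forall>j. 0 \<le> \<mu> j) \<and> (\<forall>j. 0 \<le> \<nu> j) \<and>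
      (\<forall>j<n. fst p j = (\<Sum>i<m. l i * W i j) + \<mu> j - \<nu> j) \<and>
      snd p = R * (\<Sum>j<n. \<mu> j) - (\<Sum>i<m. l i * t i)" if "p \<in> cone S" for p
    using that
  proof (induction rule: cone.induct)
    case cone_zero
    show ?case by (intro exI[of _ "\<lambda>_. 0"]) auto
  next
    case (cone_base p)
    then consider i where "i < m" "p = (W i, - t i)" | j where "j < n" "p = (?e j, R)"
      | j where "j < n" "p = (\<lambda>i. - ?e j i, 0)" by (auto simp: S_def)
    then show ?case
    proof cases
      case 1
      have "(\<Sum>k<m. ?e i k * g k) = g i" for g
        using 1(1) sum.delta[of "{..<m}" i g] by (simp add: if_distrib[of "\<lambda>x. x * _"] cong: if_cong)
      then show ?thesis using 1
        by (intro exI[of _ "?e i"] exI[of _ "\<lambda>_. 0"]) auto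
    next
      case 2
      then show ?thesis by (intro exI[of _ "\<lambda>_. 0"] exI[of _ "?e j"] exI[of _ "\<lambda>_. 0"] conjI) auto
    next
      case 3
      then show ?thesis by (intro exI[of _ "\<lambda>_. 0"] exI[of _ "\<lambda>_. 0"] exI[of _ "?e j"] conjI) auto
    qed
  next
    case (cone_add a b a' b')
    then obtain l \<mu> \<nu> l' \<mu>' \<nu>' where *: "\<forall>i. 0 \<le> l i" "\<forall>j. 0 \<le> \<mu> j" "\<forall>j. 0 \<le> \<nu> j"
      "\<forall>j<n. a j = (\<Sum>i<m. l i * W i j) + \<mu> j - \<nu> j" "b = R * (\<Sum>j<n. \<mu> j) - (\<Sum>i<m. l i * t i)"
      "\<forall>i. 0 \<le> l' i" "\<forall>j. 0 \<le> \<mu>' j" "\<forall>j. 0 \<le> \<nu>' j"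
      "\<forall>j<n. a' j = (\<Sum>i<m. l' i * W i j) + \<mu>' j - \<nu>' j" "b' = R * (\<Sum>j<n. \<mu>' j) - (\<Sum>i<m. l' i * t i)"
      using cone_add.IH unfolding fst_conv snd_conv by blast
    then show ?case
      by (intro exI[of _ "\<lambda>i. l i + l' i"] exI[of _ "\<lambda>i. \<mu> i + \<mu>' i"] exI[of _ "\<lambda>i. \<nu> i + \<nu>' i"])
         (auto simp: algebra_simps sum.distrib)
  next
    case (cone_scale a b c)
    then obtain l \<mu> \<nu> where *: "\<forall>i. 0 \<le> l i" "\<forall>j. 0 \<le> \<mu> j" "\<forall>j. 0 \<le> \<nu> j"
      "\<forall>j<n. a j = (\<Sum>i<m. l i * W i j) + \<mu> j - \<nu> j" "b = R * (\<Sum>j<n. \<mu> j) - (\<Sum>i<m. l i * t i)"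
      using cone_scale.IH unfolding fst_conv snd_conv by blast
    then show ?case using cone_scale(2)
      by (intro exI[of _ "\<lambda>i. c * l i"] exI[of _ "\<lambda>i. c * \<mu> i"] exI[of _ "\<lambda>i. c * \<nu> i"])
         (simp add: * right_diff_distrib distrib_left sum_distrib_left mult_ac)
  qed
  from this[OF ab(1)] obtain l \<mu> \<nu> where *: "\<forall>i. 0 \<le> l i" "\<forall>j. 0 \<le> \<mu> j" "\<forall>j. 0 \<le> \<nu> j"
      "\<forall>j<n. a j = (\<Sum>i<m. l i * W i j) + \<mu> j - \<nu> j" "b = R * (\<Sum>j<n. \<mu> j) - (\<Sum>i<m. l i * t i)"
    by auto
  have "0 \<le> (\<Sum>i<m. l i * W i j) + \<mu> j" if "j < n" for j
    using *(3,4) ab(2) that by (metis add_diff_cancel_left' diff_add_cancel add_0)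
  then show ?thesis using *(1,2,5) ab(3) by (intro exI[of _ l] exI[of _ \<mu>]) auto
qed


section \<open>Small vertices\<close>

abbreviation dotp :: "nat \<Rightarrow> (nat \<Rightarrow> real) \<Rightarrow> (nat \<Rightarrow> real) \<Rightarrow> real" where
  "dotp n a x \<equiv> \<Sum>i<n. a i * x i"

text \<open>Phrased by the kernel and with functions as rows, so that a row can be exchanged by a
  function update.\<close>

definition nonsingular :: "nat \<Rightarrow> (nat \<Rightarrow> nat \<Rightarrow> real) \<Rightarrow> bool" where
  "nonsingular n A \<longleftrightarrow> (\<forall>v. (\<forall>i<n. dotp n (A i) v = 0) \<longrightarrow> (\<forall>j<n. v j = 0))"

lemma mult_mat_vec_index:
  "i < n \<Longrightarrow> (mat n n (\<lambda>(i, j). A i j) *\<^sub>v vec n v) $ i = dotp n (A i) v" for A :: "nat \<Rightarrow> nat \<Rightarrow> real"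
  by (simp add: scalar_prod_def lessThan_atLeast0)

lemma nonsingular_det: "nonsingular n A \<longleftrightarrow> det (mat n n (\<lambda>(i, j). A i j)) \<noteq> 0"
proof -
  let ?G = "mat n n (\<lambda>(i, j). A i j)"
  have "det ?G = 0 \<longleftrightarrow> (\<exists>v. v \<in> carrier_vec n \<and> v \<noteq> 0\<^sub>v n \<and> ?G *\<^sub>v v = 0\<^sub>v n)"
    by (rule det_0_iff_vec_prod_zero) simp
  also have "\<dots> \<longleftrightarrow> \<not> nonsingular n A"
  proof
    assume "\<exists>v. v \<in> carrier_vec n \<and> v \<noteq> 0\<^sub>v n \<and> ?G *\<^sub>v v = 0\<^sub>v n"
    then obtain v where v: "v \<in> carrier_vec n" "v \<noteq> 0\<^sub>v n" "?G *\<^sub>v v = 0\<^sub>v n" by blast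
    have vv: "v = vec n (($) v)" using v(1) by auto
    have "dotp n (A i) (($) v) = 0" if "i < n" for i
      using mult_mat_vec_index[OF that, of A "($) v"] v(3) that unfolding vv[symmetric] by simp
    moreover have "\<exists>j<n. v $ j \<noteq> 0" using v(1,2) by (metis carrier_vecD eq_vecI index_zero_vec)
    ultimately show "\<not> nonsingular n A" unfolding nonsingular_def by blast
  next
    assume "\<not> nonsingular n A"
    then obtain v j where v: "\<forall>i<n. dotp n (A i) v = 0" "j < n" "v j \<noteq> 0" by (auto simp: nonsingular_def)
    have "?G *\<^sub>v vec n v = 0\<^sub>v n"
    proof (rule eq_vecI)
      fix i assume "i < dim_vec (0\<^sub>v n :: real vec)"
      then show "(?G *\<^sub>v vec n v) $ i = 0\<^sub>v n $ i" using mult_mat_vec_index[of i n A v] v(1) by simp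
    qed simp
    moreover have "vec n v \<noteq> 0\<^sub>v n" using v(2,3) by (metis index_vec index_zero_vec(1))
    ultimately show "\<exists>v. v \<in> carrier_vec n \<and> v \<noteq> 0\<^sub>v n \<and> ?G *\<^sub>v v = 0\<^sub>v n" by (intro exI[of _ "vec n v"]) simp
  qed
  finally show ?thesis by blast
qed

text \<open>Column \<open>k\<close> of the adjugate is orthogonal to all rows except row
  \<open>k\<close>, with which its product is the determinant.\<close>

lemma nonsingular_dual:
  assumes "nonsingular n A" "k < n"
  shows "\<exists>d. dotp n (A k) d \<noteq> 0 \<and> (\<forall>i<n. i \<noteq> k \<longrightarrow> dotp n (A i) d = 0)"
proof -
  let ?G = "mat n n (\<lambda>(i, j). A i j)"
  have G: "?G \<in> carrier_mat n n" by simp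
  have "dotp n (A i) (\<lambda>j. adj_mat ?G $$ (j, k)) = (if i = k then det ?G else 0)" if "i < n" for i
  proof -
    have "(?G * adj_mat ?G) $$ (i, k) = dotp n (A i) (\<lambda>j. adj_mat ?G $$ (j, k))"
      using that assms(2) adj_mat(1)[OF G]
      by (subst index_mult_mat(1)) (auto simp add: scalar_prod_def lessThan_atLeast0)
    from this[symmetric] show ?thesis unfolding adj_mat(2)[OF G] using that assms(2) by simp
  qed
  then show ?thesis using assms nonsingular_det[of n A] by (intro exI[of _ "\<lambda>j. adj_mat ?G $$ (j, k)"]) auto
qed

lemma dotp_linear: "dotp n b (\<lambda>j. \<alpha> * v j + \<beta> * d j) = \<alpha> * dotp n b v + \<beta> * dotp n b d"
  by (simp add: algebra_simps sum.distrib sum_distrib_left)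

text \<open>Steinitz exchange, starting from the unit vectors.\<close>

lemma nonsingular_rows:
  assumes "\<And>d. (\<forall>a\<in>T. dotp n a d = 0) \<Longrightarrow> \<forall>j<n. d j = 0"
  shows "\<exists>A. nonsingular n A \<and> (\<forall>i<n. A i \<in> T)"
proof -
  have "nonsingular n (\<lambda>i j. if j = i then 1 else 0)"
    by (auto simp: nonsingular_def if_distrib[of "\<lambda>x. x * _"] cong: if_cong)
  moreover have "\<forall>A. nonsingular n A \<longrightarrow> card {i. i < n \<and> A i \<in> T} < Suc n"
  proof (intro allI impI)
    fix A :: "nat \<Rightarrow> nat \<Rightarrow> real"
    have "card {i. i < n \<and> A i \<in> T} \<le> card {..<n}" by (intro card_mono) auto
    then show "card {i. i < n \<and> A i \<in> T} < Suc n" by simp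
  qed
  ultimately obtain A where A: "nonsingular n A"
    "\<And>B. nonsingular n B \<Longrightarrow> card {i. i < n \<and> B i \<in> T} \<le> card {i. i < n \<and> A i \<in> T}"
    using ex_has_greatest_nat[of "nonsingular n" _ "\<lambda>A. card {i. i < n \<and> A i \<in> T}" "Suc n"] by blast
  have "A k \<in> T" if k: "k < n" for k
  proof (rule ccontr)
    assume kT: "A k \<notin> T"
    obtain d where d: "dotp n (A k) d \<noteq> 0" "\<And>i. i < n \<Longrightarrow> i \<noteq> k \<Longrightarrow> dotp n (A i) d = 0"
      using nonsingular_dual[OF A(1) k] by blast
    have "\<exists>j<n. d j \<noteq> 0"
    proof (rule ccontr)
      assume "\<not> ?thesis"
      then have "dotp n (A k) d = 0" by (intro sum.neutral) auto
      then show False using d(1) by simp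
    qed
    then obtain a where a: "a \<in> T" "dotp n a d \<noteq> 0" using assms[of d] by blast
    have "nonsingular n (A(k := a))"
      unfolding nonsingular_def
    proof (intro allI impI)
      fix v j assume v: "\<forall>i<n. dotp n ((A(k := a)) i) v = 0" and j: "j < n"
      have va: "dotp n a v = 0" using v k by (metis fun_upd_same)
      have vi: "dotp n (A i) v = 0" if "i < n" "i \<noteq> k" for i using v that by (metis fun_upd_other)
      \<comment> \<open>All rows of \<open>A\<close> annihilate this combination: row
        \<open>k\<close> by the choice of the two coefficients, the other rows because they
        annihilate \<open>v\<close> and \<open>d\<close>. So it vanishes, and multiplying it by
        \<open>a\<close> shows that row \<open>k\<close> annihilates \<open>v\<close> as
        well.\<close>
      let ?w = "\<lambda>j. dotp n (A k) d * v j + (- dotp n (A k) v) * d j"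
      note lin = dotp_linear[where \<alpha> = "dotp n (A k) d" and v = v and \<beta> = "- dotp n (A k) v" and d = d and n = n]
      have "dotp n (A i) ?w = 0" if "i < n" for i
        unfolding lin using d(2) vi that by (cases "i = k") auto
      then have w: "?w j = 0" if "j < n" for j 
        using A(1)[unfolded nonsingular_def, rule_format, of ?w j] that by blast
      have "dotp n a ?w = 0" using w by (intro sum.neutral) auto
      then have "dotp n (A k) v = 0" unfolding lin using va a(2) by simp
      then show "v j = 0" using w[OF j] d(1) by simp
    qed
    from A(2)[OF this] have "card {i. i < n \<and> (A(k := a)) i \<in> T} \<le> card {i. i < n \<and> A i \<in> T}" .
    moreover have "{i. i < n \<and> (A(k := a)) i \<in> T} = insert k {i. i < n \<and> A i \<in> T}" using k a(1) by auto
    ultimately show False using kT by simp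
  qed
  then show ?thesis using A(1) by blast
qed

text \<open>The Leibniz formula has \<open>fact n\<close> terms, each a product of \<open>n\<close>
  entries.\<close>

lemma abs_det_le:
  fixes A :: "int mat"
  assumes A: "A \<in> carrier_mat n n" and M: "\<And>i j. i < n \<Longrightarrow> j < n \<Longrightarrow> \<bar>A $$ (i, j)\<bar> \<le> M"
  shows "\<bar>det A\<bar> \<le> fact n * M ^ n"
proof -
  have "\<bar>det A\<bar> \<le> (\<Sum>p\<in>{p. p permutes {0..<n}}. \<bar>signof p * (\<Prod>i = 0..<n. A $$ (i, p i))\<bar>)"
    unfolding det_def'[OF A] by (rule sum_abs)
  also have "\<dots> \<le> (\<Sum>p\<in>{p. p permutes {0..<n}}. M ^ n)"
  proof (rule sum_mono)
    fix p assume p: "p \<in> {p. p permutes {0..<n}}"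
    have "\<bar>signof p * (\<Prod>i = 0..<n. A $$ (i, p i))\<bar> = (\<Prod>i = 0..<n. \<bar>A $$ (i, p i)\<bar>)"
      by (simp add: abs_mult sign_def abs_prod)
    also have "\<dots> \<le> (\<Prod>i = 0..<n. M)"
    proof (intro prod_mono conjI)
      fix i assume i: "i \<in> {0..<n}"
      then have "p i < n" using p permutes_in_image[of p "{0..<n}" i] by auto
      then show "\<bar>A $$ (i, p i)\<bar> \<le> M" using M i by auto
    qed auto
    finally show "\<bar>signof p * (\<Prod>i = 0..<n. A $$ (i, p i))\<bar> \<le> M ^ n" by simp
  qed
  also have "\<dots> = fact n * M ^ n" by (simp add: card_permutations[of _ n])
  finally show ?thesis .
qed

definition holds :: "nat \<Rightarrow> (nat \<Rightarrow> int) \<times> int \<Rightarrow> (nat \<Rightarrow> real) \<Rightarrow> bool" where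
  "holds n s x \<longleftrightarrow> (\<Sum>i<n. of_int (fst s i) * x i) \<le> of_int (snd s)"

text \<open>Cramer's rule over the integers. Numerators and the common denominator are absolute
  values of determinants, which is correct because the solution is nonnegative.\<close>

lemma small_solution:
  assumes ns: "nonsingular n (\<lambda>i j. of_int (fst (r i) j))"
    and M: "\<And>i j. i < n \<Longrightarrow> j < n \<Longrightarrow> \<bar>fst (r i) j\<bar> \<le> int M" "\<And>i. i < n \<Longrightarrow> \<bar>snd (r i)\<bar> \<le> int M"
    and x: "\<And>i. i < n \<Longrightarrow> (\<Sum>j<n. of_int (fst (r i) j) * x j) = of_int (snd (r i))" "\<And>i. i < n \<Longrightarrow> 0 \<le> x i"
  shows "\<exists>(p :: nat \<Rightarrow> nat) q. 0 < q \<and> q \<le> fact n * M ^ n \<and> (\<forall>i<n. p i \<le> fact n * M ^ n \<and> x i = real (p i) / real q)"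
proof -
  define A :: "int mat" where "A = mat n n (\<lambda>(i, j). fst (r i) j)"
  define C where "C k = mat n n (\<lambda>(i, j). if j = k then snd (r i) else fst (r i) j)" for k
  let ?A = "map_mat real_of_int A"
  have A: "A \<in> carrier_mat n n" "\<And>k. C k \<in> carrier_mat n n" by (auto simp: A_def C_def)
  have A': "?A = mat n n (\<lambda>(i, j). of_int (fst (r i) j))" by (auto simp: A_def)
  have dA: "det ?A = of_int (det A)" "det (map_mat real_of_int (C k)) = of_int (det (C k))" for k
    by (simp_all add: of_int_hom.hom_det)
  have nz: "det A \<noteq> 0" using ns nonsingular_det[of n] dA(1) unfolding A' by auto
  have cr: "of_int (det (C k)) = x k * of_int (det A)" if k: "k < n" for k
  proof -
    have "replace_col ?A (?A *\<^sub>v vec n x) k = map_mat real_of_int (C k)"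
    proof (rule eq_matI)
      fix i j assume ij: "i < dim_row (map_mat real_of_int (C k))" "j < dim_col (map_mat real_of_int (C k))"
      then have "(?A *\<^sub>v vec n x) $ i = of_int (snd (r i))"
        using mult_mat_vec_index[of i n "\<lambda>i j. of_int (fst (r i) j)" x] x(1) unfolding A' by (simp add: C_def)
      then show "replace_col ?A (?A *\<^sub>v vec n x) k $$ (i, j) = map_mat real_of_int (C k) $$ (i, j)"
        using ij by (simp add: replace_col_def A_def C_def)
    qed (auto simp: replace_col_def A_def C_def)
    then show ?thesis using cramer_lemma_mat[of ?A n "vec n x" k] A(1) k dA by simp
  qed
  have bA: "\<bar>det A\<bar> \<le> fact n * int M ^ n" by (rule abs_det_le[OF A(1)]) (simp add: A_def M)
  have bC: "\<bar>det (C k)\<bar> \<le> fact n * int M ^ n" for k by (rule abs_det_le[OF A(2)]) (simp add: C_def M)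
  let ?p = "\<lambda>k. nat \<bar>det (C k)\<bar>" and ?q = "nat \<bar>det A\<bar>"
  have f: "int (fact n * M ^ n) = fact n * int M ^ n" by simp
  have "x k = real (?p k) / real ?q" if k: "k < n" for k
  proof -
    have "real (?p k) = \<bar>x k * of_int (det A)\<bar>" using cr[OF k] by (simp flip: of_int_abs)
    also have "\<dots> = x k * real ?q" using x(2)[OF k] by (simp add: abs_mult)
    finally show ?thesis using nz by simp
  qed
  moreover have "?p k \<le> fact n * M ^ n" for k using bC[of k] unfolding f[symmetric] by linarith
  moreover have "?q \<le> fact n * M ^ n" using bA unfolding f[symmetric] by linarith
  moreover have "0 < ?q" using nz by simp
  ultimately show ?thesis by (intro exI[of _ ?p] exI[of _ ?q]) blast
qed

text \<open>Integral coefficients from a fixed range leave only finitely many constraints, even for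
  families indexed by all scenarios and multipliers.\<close>

lemma finite_bounded_constraints:
  fixes S :: "((nat \<Rightarrow> int) \<times> int) set"
  assumes S: "\<And>s i. s \<in> S \<Longrightarrow> i < n \<Longrightarrow> \<bar>fst s i\<bar> \<le> int M" "\<And>s i. s \<in> S \<Longrightarrow> n \<le> i \<Longrightarrow> fst s i = 0"
      "\<And>s. s \<in> S \<Longrightarrow> \<bar>snd s\<bar> \<le> int M"
  shows "finite S"
proof (rule finite_subset)
  show "S \<subseteq> {a. \<forall>i. (i \<in> {..<n} \<longrightarrow> a i \<in> {- int M..int M}) \<and> (i \<notin> {..<n} \<longrightarrow> a i = 0)} \<times> {- int M..int M}"
    using S by (force simp: abs_le_iff minus_le_iff)
  show "finite ({a. \<forall>i. (i \<in> {..<n} \<longrightarrow> a i \<in> {- int M..int M}) \<and> (i \<notin> {..<n} \<longrightarrow> a i = 0)} \<times> {- int M..int M})"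
    by (intro finite_cartesian_product finite_set_of_finite_funs) auto
qed

text \<open>Among the feasible points that are at least as good as \<open>x\<close>, one with the largest number of
  tight constraints is a vertex: otherwise it could be moved along a line until another constraint
  becomes tight.\<close>

lemma small_vertex:
  fixes S :: "((nat \<Rightarrow> int) \<times> int) set" and f :: "nat \<Rightarrow> real"
  assumes S: "\<And>s i. s \<in> S \<Longrightarrow> i < n \<Longrightarrow> \<bar>fst s i\<bar> \<le> int M" "\<And>s i. s \<in> S \<Longrightarrow> n \<le> i \<Longrightarrow> fst s i = 0"
      "\<And>s. s \<in> S \<Longrightarrow> \<bar>snd s\<bar> \<le> int M"
    and box: "\<And>x i. (\<And>s. s \<in> S \<Longrightarrow> holds n s x) \<Longrightarrow> i < n \<Longrightarrow> 0 \<le> x i \<and> x i \<le> \<beta>"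
    and x: "\<And>s. s \<in> S \<Longrightarrow> holds n s x"
  shows "\<exists>(p :: nat \<Rightarrow> nat) q. 0 < q \<and> q \<le> fact n * M ^ n \<and> (\<forall>i<n. p i \<le> fact n * M ^ n) \<and>
     (\<forall>s\<in>S. holds n s (\<lambda>i. real (p i) / real q)) \<and> dotp n f x \<le> dotp n f (\<lambda>i. real (p i) / real q)"
proof -
  have fin: "finite S" by (rule finite_bounded_constraints[OF S])
  let ?v = "\<lambda>s y. dotp n (\<lambda>i. real_of_int (fst s i)) y"
  define good where "good y \<longleftrightarrow> (\<forall>s\<in>S. holds n s y) \<and> dotp n f x \<le> dotp n f y" for y
  define tight where "tight y = {s \<in> S. ?v s y = of_int (snd s)}" for y :: "nat \<Rightarrow> real"
  have "good x" using x by (simp add: good_def)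
  moreover have "\<forall>y. good y \<longrightarrow> card (tight y) < Suc (card S)"
    using fin by (auto simp: tight_def less_Suc_eq_le intro!: card_mono)
  ultimately obtain y where y: "good y" "\<And>y'. good y' \<Longrightarrow> card (tight y') \<le> card (tight y)"
    using ex_has_greatest_nat[of good x "\<lambda>y. card (tight y)" "Suc (card S)"] by blast
  have vertex: "\<forall>j<n. d j = 0" if d: "\<forall>s\<in>tight y. ?v s d = 0" for d
  proof (rule ccontr)
    assume "\<not> (\<forall>j<n. d j = 0)"
    then obtain j where j: "j < n" "d j \<noteq> 0" by blast
    \<comment> \<open>Both orientations of the line keep the tight constraints tight; the chosen one
      does not decrease the objective.\<close>
    define e where "e = (if 0 \<le> dotp n f d then d else (\<lambda>i. - d i))"
    have e: "0 \<le> dotp n f e" "e j \<noteq> 0" "\<And>s. s \<in> tight y \<Longrightarrow> ?v s e = 0"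
      using d j by (auto simp: e_def sum_negf)
    have move: "?v s (\<lambda>i. y i + t * e i) = ?v s y + t * ?v s e" for s t
      by (simp add: algebra_simps sum.distrib sum_distrib_left)
    have movef: "dotp n f (\<lambda>i. y i + t * e i) = dotp n f y + t * dotp n f e" for t
      by (simp add: algebra_simps sum.distrib sum_distrib_left)
    have hy: "?v s y \<le> of_int (snd s)" if "s \<in> S" for s using y(1) that by (auto simp: good_def holds_def)
    define I where "I = {s \<in> S. 0 < ?v s e}"
    have finI: "finite I" using fin by (simp add: I_def)
    have "I \<noteq> {}"
    proof
      assume I: "I = {}"
      \<comment> \<open>A step long enough to leave the interval from 0 to \<open>\<beta>\<close> in
        coordinate \<open>j\<close>. If no constraint stopped the movement, boundedness would be
        violated.\<close>
      define t where "t = (\<bar>\<beta>\<bar> + 1) / \<bar>e j\<bar>"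
      have t: "0 \<le> t" by (simp add: t_def)
      have "holds n s (\<lambda>i. y i + t * e i)" if s: "s \<in> S" for s
      proof -
        have "?v s e \<le> 0" 
        proof (rule ccontr)
          assume "\<not> ?v s e \<le> 0"
          then have "s \<in> I" using s by (simp add: I_def)
          then show False using I by simp
        qed
        then have "t * ?v s e \<le> 0" using t by (simp add: mult_nonneg_nonpos)
        then show ?thesis unfolding holds_def move using hy[OF s] by simp
      qed
      then have "0 \<le> y j + t * e j" "y j + t * e j \<le> \<beta>" using box[of "\<lambda>i. y i + t * e i", OF _ j(1)] by auto
      moreover have "0 \<le> y j" "y j \<le> \<beta>" using box[of y, OF _ j(1)] y(1) by (auto simp: good_def)
      ultimately have "\<bar>t * e j\<bar> \<le> \<beta>" by linarith
      moreover have "\<bar>t * e j\<bar> = \<bar>\<beta>\<bar> + 1" using e(2) by (simp add: t_def abs_mult)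
      ultimately show False by linarith
    qed
    \<comment> \<open>The ratio test: the smallest ratio is the step at which the first new
      constraint becomes tight.\<close>
    let ?r = "\<lambda>s. (of_int (snd s) - ?v s y) / ?v s e"
    define t where "t = Min (?r ` I)"
    have "t \<in> ?r ` I" unfolding t_def using finI \<open>I \<noteq> {}\<close> by (intro Min_in) auto
    then obtain s0 where s0: "s0 \<in> I" "t = ?r s0" by blast
    have tle: "t \<le> ?r s" if "s \<in> I" for s unfolding t_def using finI that by (intro Min_le) auto
    have t0: "0 \<le> t" using s0 hy[of s0] by (auto simp: I_def)
    let ?y = "\<lambda>i. y i + t * e i"
    have good: "good ?y"
      unfolding good_def
    proof (intro conjI ballI)
      fix s assume s: "s \<in> S"
      show "holds n s ?y"
      proof (cases "s \<in> I")
        case True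
        then have "t * ?v s e \<le> of_int (snd s) - ?v s y"
          using tle[OF True] by (simp add: I_def pos_le_divide_eq)
        then show ?thesis unfolding holds_def move by simp
      next
        case False
        then have "t * ?v s e \<le> 0" using s t0 by (auto simp: I_def mult_nonneg_nonpos)
        then show ?thesis unfolding holds_def move using hy[OF s] by simp
      qed
    next
      show "dotp n f x \<le> dotp n f ?y" unfolding movef using y(1) e(1) t0
        by (simp add: good_def add_increasing2)
    qed
    have "insert s0 (tight y) \<subseteq> tight ?y"
    proof
      fix s assume "s \<in> insert s0 (tight y)"
      then show "s \<in> tight ?y"
        unfolding tight_def mem_Collect_eq move using s0 e(3)[of s] by (auto simp: I_def tight_def)
    qed
    then have "card (insert s0 (tight y)) \<le> card (tight ?y)"
      using fin by (intro card_mono) (auto simp: tight_def)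
    moreover have "s0 \<notin> tight y" using s0(1) e(3)[of s0] by (auto simp: I_def)
    moreover have "finite (tight y)" using fin by (auto simp: tight_def)
    ultimately show False using y(2)[OF good] by simp
  qed
  \<comment> \<open>No nonzero direction is orthogonal to all tight rows, so \<open>n\<close> of
    them form a nonsingular system that is solved by \<open>y\<close>.\<close>
  let ?T = "(\<lambda>s i. real_of_int (fst s i)) ` tight y"
  obtain A where A: "nonsingular n A" "\<And>i. i < n \<Longrightarrow> A i \<in> ?T"
    using nonsingular_rows[of ?T n] vertex by auto
  have "\<forall>i. \<exists>s. i < n \<longrightarrow> s \<in> tight y \<and> A i = (\<lambda>j. real_of_int (fst s j))" using A(2) by blast
  then obtain r where r: "\<And>i. i < n \<Longrightarrow> r i \<in> tight y" "\<And>i. i < n \<Longrightarrow> A i = (\<lambda>j. real_of_int (fst (r i) j))"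
    by metis
  have ns: "nonsingular n (\<lambda>i j. of_int (fst (r i) j))"
    using A(1) r(2) by (simp add: nonsingular_def)
  have rS: "r i \<in> S" "?v (r i) y = of_int (snd (r i))" if "i < n" for i
    using r(1)[OF that] by (auto simp: tight_def)
  have y0: "0 \<le> y i" if "i < n" for i using box[of y, OF _ that] y(1) by (auto simp: good_def)
  have "\<exists>(p :: nat \<Rightarrow> nat) q. 0 < q \<and> q \<le> fact n * M ^ n \<and> (\<forall>i<n. p i \<le> fact n * M ^ n \<and> y i = real (p i) / real q)"
    by (rule small_solution[OF ns S(1)[OF rS(1)] S(3)[OF rS(1)] rS(2) y0])
  then obtain p :: "nat \<Rightarrow> nat" and q where pq: "0 < q" "q \<le> fact n * M ^ n"
    "\<And>i. i < n \<Longrightarrow> p i \<le> fact n * M ^ n" "\<And>i. i < n \<Longrightarrow> y i = real (p i) / real q"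
    by blast
  have "dotp n g (\<lambda>i. real (p i) / real q) = dotp n g y" for g
  proof (rule sum.cong[OF refl])
    fix i assume "i \<in> {..<n}"
    then have "y i = real (p i) / real q" using pq(4) by simp
    then show "g i * (real (p i) / real q) = g i * y i" by (simp only:)
  qed
  note eq = this
  have h: "holds n s (\<lambda>i. real (p i) / real q)" if "s \<in> S" for s
  proof -
    have "holds n s y" using y(1) that by (simp add: good_def)
    then show ?thesis unfolding holds_def eq[of "\<lambda>i. real_of_int (fst s i)"] .
  qed
  have "dotp n f x \<le> dotp n f y" using y(1) by (simp add: good_def)
  then have "dotp n f x \<le> dotp n f (\<lambda>i. real (p i) / real q)" unfolding eq[of f] .
  then show ?thesis
    by (intro exI[of _ p] exI[of _ q] conjI ballI allI impI pq(1,2) pq(3) h)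
qed


section \<open>The verifier\<close>

text \<open>The length of the initial stretch on which \<open>Q\<close> holds, capped at
  \<open>N\<close>. It is a sum of truth values so that the rules for sums and bounded quantifiers
  show that it is feasible.\<close>

definition run_length :: "nat \<Rightarrow> (nat \<Rightarrow> bool) \<Rightarrow> nat" where
  "run_length N Q = (\<Sum>s<N. of_bool (\<forall>s'<Suc s. Q s'))"

definition ones :: "bool list \<Rightarrow> nat \<Rightarrow> nat" where
  "ones I p = run_length (length I) (\<lambda>s. bit I (p + s))"

primrec dim_pos :: "bool list \<Rightarrow> nat \<Rightarrow> nat" where
  "dim_pos I 0 = 0"
| "dim_pos I (Suc i) = dim_pos I i + ones I (dim_pos I i) + 1"

definition dims :: "bool list \<Rightarrow> nat \<Rightarrow> nat" where
  "dims I i = ones I (dim_pos I i)"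

definition digits :: "bool list \<Rightarrow> nat \<Rightarrow> nat" where
  "digits I p = run_length (length I) (\<lambda>s. bit I (p + 2 * s))"

definition nat_end :: "bool list \<Rightarrow> nat \<Rightarrow> nat" where
  "nat_end I p = p + 2 * digits I p + 1"

definition nat_at :: "bool list \<Rightarrow> nat \<Rightarrow> nat" where
  "nat_at I p = (\<Sum>s<digits I p. of_bool (bit I (p + 2 * s + 1)) * 2 ^ s)"

text \<open>No leading zeros: the inspected position is the one of the most significant digit, just
  before the closing \<open>False\<close>.\<close>

definition canonical :: "bool list \<Rightarrow> nat \<Rightarrow> bool" where
  "canonical I p \<longleftrightarrow> digits I p = 0 \<or> bit I (p + 2 * digits I p - 1)"

text \<open>The entries start behind the bound, which follows the six dimensions. The
  \<open>+ 1\<close> skips the sign bit; numerator and denominator delimit themselves.\<close>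

definition entry_pos :: "bool list \<Rightarrow> nat \<Rightarrow> nat" where
  "entry_pos I = rec_nat (nat_end I (dim_pos I 6)) (\<lambda>_ r. nat_end I (nat_end I (r + 1)))"

definition denom_pos :: "bool list \<Rightarrow> nat \<Rightarrow> nat" where
  "denom_pos I j = nat_end I (entry_pos I j + 1)"

definition numer :: "bool list \<Rightarrow> nat \<Rightarrow> nat" where
  "numer I j = nat_at I (entry_pos I j + 1)"

definition denom :: "bool list \<Rightarrow> nat \<Rightarrow> nat" where
  "denom I j = nat_at I (denom_pos I j)"

text \<open>The dimensions \<open>n\<^sub>x, n\<^sub>u, n\<^sub>y, m\<^sub>x, m\<^sub>u, m\<^sub>y\<close> are \<open>d 0, \<dots>, d 5\<close>; the
  entries of \<open>a\<close>, \<open>b\<close>, \<open>A\<close>, \<open>W\<close>, the \<open>B\<^sub>k\<close> and the \<open>T\<^sub>k\<close> are numbered consecutively.\<close>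

definition off_A :: "(nat \<Rightarrow> nat) \<Rightarrow> nat" where "off_A d = d 3 + d 4"
definition off_W :: "(nat \<Rightarrow> nat) \<Rightarrow> nat" where "off_W d = off_A d + d 3 * d 0"
definition off_B :: "(nat \<Rightarrow> nat) \<Rightarrow> nat" where "off_B d = off_W d + d 5 * d 2"
definition off_T :: "(nat \<Rightarrow> nat) \<Rightarrow> nat" where "off_T d = off_B d + d 0 * (d 4 * d 1)"
definition entries :: "(nat \<Rightarrow> nat) \<Rightarrow> nat" where "entries d = off_T d + d 1 * (d 5 * d 0)"

definition ix_A :: "(nat \<Rightarrow> nat) \<Rightarrow> nat \<Rightarrow> nat \<Rightarrow> nat" where
  "ix_A d i j = off_A d + (i * d 0 + j)"
definition ix_W :: "(nat \<Rightarrow> nat) \<Rightarrow> nat \<Rightarrow> nat \<Rightarrow> nat" where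
  "ix_W d i j = off_W d + (i * d 2 + j)"
definition ix_B :: "(nat \<Rightarrow> nat) \<Rightarrow> nat \<Rightarrow> nat \<Rightarrow> nat \<Rightarrow> nat" where
  "ix_B d k i j = off_B d + (k * (d 4 * d 1) + (i * d 1 + j))"
definition ix_T :: "(nat \<Rightarrow> nat) \<Rightarrow> nat \<Rightarrow> nat \<Rightarrow> nat \<Rightarrow> nat" where
  "ix_T d k i j = off_T d + (k * (d 5 * d 0) + (i * d 0 + j))"

text \<open>The first equation says that parsing ends exactly at the end of the string. The last two
  conditions exclude a zero denominator and a negative zero. Lowest terms are checked elsewhere, by
  means of \<open>Y\<close>.\<close>

definition well_formed :: "bool list \<Rightarrow> bool" where
  "well_formed I \<longleftrightarrow> entry_pos I (entries (dims I)) = length I \<and> canonical I (dim_pos I 6) \<and>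
     (\<forall>j<entries (dims I). canonical I (entry_pos I j + 1) \<and> canonical I (denom_pos I j) \<and>
        digits I (denom_pos I j) \<noteq> 0 \<and> (bit I (entry_pos I j) \<longrightarrow> digits I (entry_pos I j + 1) \<noteq> 0))"

text \<open>A string encodes a vector of \<open>K\<close> natural numbers by interleaving their binary digits.\<close>

definition unpack :: "bool list \<Rightarrow> nat \<Rightarrow> nat \<Rightarrow> nat" where
  "unpack L K k = (\<Sum>s<length L. of_bool (bit L (s * K + k)) * 2 ^ s)"

text \<open>In the following the entries are given as \<open>c j / D\<close> and the first-stage solution as
  \<open>p k / q\<close>, with a common denominator each.\<close>

definition first_stage :: "(nat \<Rightarrow> nat) \<Rightarrow> nat \<Rightarrow> (nat \<Rightarrow> int) \<Rightarrow> nat \<Rightarrow> (nat \<Rightarrow> nat) \<Rightarrow> bool" where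
  "first_stage d R c q p \<longleftrightarrow> (\<forall>k<d 0. int (p k) \<le> int R * int q) \<and>
     (\<forall>i<d 3. (\<Sum>j<d 0. c (ix_A d i j) * int (p j)) \<le> c i * int q)"

text \<open>By Farkas' lemma, \<open>l\<close> and \<open>\<mu>\<close> certify that there is no second-stage solution for the scenario \<open>u\<close>.\<close>

definition refutes :: "(nat \<Rightarrow> nat) \<Rightarrow> nat \<Rightarrow> (nat \<Rightarrow> int) \<Rightarrow> nat \<Rightarrow> nat \<Rightarrow> (nat \<Rightarrow> nat) \<Rightarrow>
    (nat \<Rightarrow> nat) \<Rightarrow> (nat \<Rightarrow> nat) \<Rightarrow> (nat \<Rightarrow> nat) \<Rightarrow> bool" where
  "refutes d R c D q p u l \<mu> \<longleftrightarrow> (\<forall>k<d 1. int (u k) \<le> int R) \<and>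
     (\<forall>i<d 4. (\<Sum>j<d 1. \<Sum>k<d 0. c (ix_B d k i j) * int (p k) * int (u j)) \<le> c (d 3 + i) * int q) \<and>
     (\<forall>j<d 2. 0 \<le> (\<Sum>i<d 5. int (l i) * c (ix_W d i j)) + int D * int (\<mu> j)) \<and>
     int R * int q * int D * (\<Sum>j<d 2. int (\<mu> j)) <
       (\<Sum>i<d 5. int (l i) * (\<Sum>j<d 0. \<Sum>k<d 1. c (ix_T d k i j) * int (u k) * int (p j)))"

text \<open>Component 0 is the common denominator of the entries and component 1 that of the
  first-stage solution; then come the numerators of the solution and the absolute values of the
  scaled entries.\<close>

definition cert_X :: "inp \<Rightarrow> nat \<Rightarrow> nat" where
  "cert_X z k = unpack (fst (snd z)) (2 + dims (fst z) 0 + entries (dims (fst z))) k"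

text \<open>The scenario is followed by the multipliers of the rows and those of the upper
  bounds.\<close>

definition cert_Y :: "inp \<Rightarrow> nat \<Rightarrow> nat" where
  "cert_Y z k = unpack (snd (snd z)) (dims (fst z) 1 + dims (fst z) 5 + dims (fst z) 2) k"

definition coeff :: "inp \<Rightarrow> nat \<Rightarrow> int" where
  "coeff z j = (if bit (fst z) (entry_pos (fst z) j) then - int (cert_X z (2 + dims (fst z) 0 + j))
     else int (cert_X z (2 + dims (fst z) 0 + j)))"

text \<open>The certificate \<open>Y\<close> is used in two ways: to refute the first-stage solution, and to show that
  some entry of the instance is not in lowest terms.\<close>

definition verifier :: "inp \<Rightarrow> bool" where
  "verifier z \<longleftrightarrow> well_formed (fst z) \<and> 0 < int (cert_X z 0) \<and> 0 < int (cert_X z 1) \<and>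
     (\<forall>j<entries (dims (fst z)).
        int (cert_X z (2 + dims (fst z) 0 + j)) * int (denom (fst z) j) = int (numer (fst z) j) * int (cert_X z 0)) \<and>
     first_stage (dims (fst z)) (nat_at (fst z) (dim_pos (fst z) 6)) (coeff z) (cert_X z 1) (\<lambda>k. cert_X z (2 + k)) \<and>
     \<not> refutes (dims (fst z)) (nat_at (fst z) (dim_pos (fst z) 6)) (coeff z) (cert_X z 0) (cert_X z 1) (\<lambda>k. cert_X z (2 + k))
        (cert_Y z) (\<lambda>i. cert_Y z (dims (fst z) 1 + i)) (\<lambda>j. cert_Y z (dims (fst z) 1 + dims (fst z) 5 + j)) \<and>
     (\<forall>j<entries (dims (fst z)). \<not> (1 < int (unpack (snd (snd z)) 3 0) \<and>
        int (numer (fst z) j) = int (unpack (snd (snd z)) 3 0) * int (unpack (snd (snd z)) 3 1) \<and>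
        int (denom (fst z) j) = int (unpack (snd (snd z)) 3 0) * int (unpack (snd (snd z)) 3 2)))"

subsection \<open>The verifier runs in polynomial time\<close>

lemmas length_input = feasible_length[OF accessible_I] feasible_length[OF accessible_X] feasible_length[OF accessible_Y]
lemmas bit_input = checkable_bit[OF accessible_I] checkable_bit[OF accessible_X] checkable_bit[OF accessible_Y]

lemmas feasible_rules = feasible_const feasible_add feasible_mult feasible_Suc feasible_diff feasible_sum
  feasible_of_bool length_input
lemmas checkable_rules = checkable_not checkable_conj checkable_disj checkable_imp checkable_less checkable_le
  checkable_eq checkable_all bit_input

lemma feasible_run_length:
  assumes "feasible k N" "\<And>m a. k \<le> m \<Longrightarrow> feasible m a \<Longrightarrow> checkable m (\<lambda>z \<sigma>. Q z \<sigma> (a z \<sigma>))"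
  shows "feasible k (\<lambda>z \<sigma>. run_length (N z \<sigma>) (Q z \<sigma>))"
  unfolding run_length_def
proof (rule feasible_sum[OF assms(1)])
  fix m a assume m: "k \<le> m" "feasible m a"
  show "feasible m (\<lambda>z \<sigma>. of_bool (\<forall>s'<Suc (a z \<sigma>). Q z \<sigma> s'))"
    using m by (intro feasible_of_bool checkable_all feasible_Suc assms(2)) auto
qed

lemma feasible_ones:
  assumes a: "feasible k a"
  shows "feasible k (\<lambda>z \<sigma>. ones (fst z) (a z \<sigma>))"
  unfolding ones_def by (intro feasible_run_length length_input bit_input feasible_add feasible_weaken[OF a])

lemma feasible_dim_pos: "feasible k (\<lambda>z \<sigma>. dim_pos (fst z) i)"
  by (induction i) (simp_all only: dim_pos.simps, (intro feasible_rules feasible_ones)+)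

lemma feasible_dims: "feasible k (\<lambda>z \<sigma>. dims (fst z) i)"
  unfolding dims_def by (intro feasible_ones feasible_dim_pos)

lemma feasible_digits:
  assumes a: "feasible k a"
  shows "feasible k (\<lambda>z \<sigma>. digits (fst z) (a z \<sigma>))"
  unfolding digits_def
  by (intro feasible_run_length length_input bit_input feasible_add feasible_mult feasible_const feasible_weaken[OF a])

lemma feasible_nat_end: "feasible k a \<Longrightarrow> feasible k (\<lambda>z \<sigma>. nat_end (fst z) (a z \<sigma>))"
  unfolding nat_end_def by (intro feasible_rules feasible_digits)

lemma big_nat_at:
  assumes a: "feasible k a"
  shows "big k (\<lambda>z \<sigma>. nat_at (fst z) (a z \<sigma>))"
  unfolding nat_at_def
  by (intro big_digits feasible_digits a feasible_of_bool bit_input feasible_add feasible_mult feasible_const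
      feasible_weaken[OF a])

lemma checkable_canonical: "feasible k a \<Longrightarrow> checkable k (\<lambda>z \<sigma>. canonical (fst z) (a z \<sigma>))"
  unfolding canonical_def by (intro checkable_rules feasible_rules feasible_digits)

lemma digits_le: "digits I p \<le> length I"
proof -
  have "digits I p \<le> (\<Sum>s<length I. 1)" unfolding digits_def run_length_def by (intro sum_mono) auto
  then show ?thesis by simp
qed

lemma feasible_entry_pos:
  assumes a: "feasible k a"
  shows "feasible k (\<lambda>z \<sigma>. entry_pos (fst z) (a z \<sigma>))"
  unfolding entry_pos_def
proof (rule feasible_rec[OF a])
  show start: "feasible k (\<lambda>z \<sigma>. nat_end (fst z) (dim_pos (fst z) 6))"
    by (intro feasible_nat_end feasible_dim_pos)
  show "feasible m (\<lambda>z \<sigma>. nat_end (fst z) (nat_end (fst z) (y z \<sigma> + 1)))" if "feasible m y" for m y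
    using that by (intro feasible_nat_end feasible_add feasible_const)
  \<comment> \<open>An entry advances the position by 1 for its sign and by at most
    \<open>2 * length (fst z) + 1\<close> for each of its two numbers.\<close>
  let ?B = "\<lambda>z \<sigma>. nat_end (fst z) (dim_pos (fst z) 6) + a z \<sigma> * (4 * length (fst z) + 3)"
  show "pbounded k ?B"
    by (rule feasible_pbounded[OF _ order_refl]) (intro feasible_rules start a)
  show "rec_nat (nat_end (fst z) (dim_pos (fst z) 6)) (\<lambda>_ r. nat_end (fst z) (nat_end (fst z) (r + 1))) i \<le> ?B z \<sigma>"
    if "i \<le> a z \<sigma>" for z :: inp and \<sigma> i
  proof -
    let ?I = "fst z"
    have e: "nat_end ?I r \<le> r + (2 * length ?I + 1)" for r using digits_le[of ?I r] by (simp add: nat_end_def)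
    have "rec_nat (nat_end ?I (dim_pos ?I 6)) (\<lambda>_ r. nat_end ?I (nat_end ?I (r + 1))) i \<le>
        nat_end ?I (dim_pos ?I 6) + i * (4 * length ?I + 3)"
    proof (induction i)
      case (Suc i)
      let ?r = "rec_nat (nat_end ?I (dim_pos ?I 6)) (\<lambda>_ r. nat_end ?I (nat_end ?I (r + 1))) i"
      have "nat_end ?I (nat_end ?I (?r + 1)) \<le> ?r + (4 * length ?I + 3)"
        using e[of "nat_end ?I (?r + 1)"] e[of "?r + 1"] by linarith
      then show ?case using Suc by simp
    qed simp
    also have "\<dots> \<le> ?B z \<sigma>" using that by simp
    finally show ?thesis .
  qed
qed

lemma feasible_denom_pos: "feasible k a \<Longrightarrow> feasible k (\<lambda>z \<sigma>. denom_pos (fst z) (a z \<sigma>))"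
  unfolding denom_pos_def by (intro feasible_nat_end feasible_add feasible_entry_pos feasible_const)

lemma feasible_entries: "feasible k (\<lambda>z \<sigma>. entries (dims (fst z)))"
  unfolding entries_def off_T_def off_B_def off_W_def off_A_def by (intro feasible_rules feasible_dims)

lemma feasible_offsets:
  "feasible k (\<lambda>z \<sigma>. off_A (dims (fst z)))" "feasible k (\<lambda>z \<sigma>. off_W (dims (fst z)))"
  "feasible k (\<lambda>z \<sigma>. off_B (dims (fst z)))" "feasible k (\<lambda>z \<sigma>. off_T (dims (fst z)))"
  unfolding off_T_def off_B_def off_W_def off_A_def by (intro feasible_rules feasible_dims)+

lemma checkable_well_formed: "checkable k (\<lambda>z \<sigma>. well_formed (fst z))"
  unfolding well_formed_def
  by (intro checkable_rules feasible_rules checkable_canonical feasible_digits feasible_denom_pos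
      feasible_entry_pos feasible_entries feasible_dim_pos)

lemma big_unpack:
  assumes L: "accessible L" and K: "feasible k K" and a: "feasible k a"
  shows "big k (\<lambda>z \<sigma>. unpack (L z) (K z \<sigma>) (a z \<sigma>))"
  unfolding unpack_def
  by (intro big_digits feasible_length[OF L] feasible_of_bool checkable_bit[OF L] feasible_add feasible_mult
      feasible_weaken[OF K] feasible_weaken[OF a])

lemma big_cert_X: "feasible k a \<Longrightarrow> big k (\<lambda>z \<sigma>. cert_X z (a z \<sigma>))"
  unfolding cert_X_def by (intro big_unpack[OF accessible_X] feasible_rules feasible_dims feasible_entries)

lemma big_cert_Y: "feasible k a \<Longrightarrow> big k (\<lambda>z \<sigma>. cert_Y z (a z \<sigma>))"
  unfolding cert_Y_def by (intro big_unpack[OF accessible_Y] feasible_rules feasible_dims)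

lemma bigint_coeff: "feasible k a \<Longrightarrow> bigint k (\<lambda>z \<sigma>. coeff z (a z \<sigma>))"
  unfolding coeff_def
  by (intro bigint_if bit_input feasible_entry_pos bigint_uminus bigint_big big_cert_X feasible_rules feasible_dims)

lemma big_numer: "feasible k a \<Longrightarrow> big k (\<lambda>z \<sigma>. numer (fst z) (a z \<sigma>))"
  unfolding numer_def by (intro big_nat_at feasible_add feasible_entry_pos feasible_const)

lemma big_denom: "feasible k a \<Longrightarrow> big k (\<lambda>z \<sigma>. denom (fst z) (a z \<sigma>))"
  unfolding denom_def by (intro big_nat_at feasible_denom_pos)

lemma bigint_const: "bigint k (\<lambda>z \<sigma>. int c)"
  by (intro bigint_big big_feasible feasible_const)

lemma checkable_bigint_eq: "bigint k F \<Longrightarrow> bigint k G \<Longrightarrow> checkable k (\<lambda>z \<sigma>. F z \<sigma> = G z \<sigma>)"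
  unfolding order_eq_iff by (intro checkable_conj checkable_bigint_le)

lemmas ix_defs = ix_A_def ix_W_def ix_B_def ix_T_def

lemmas bigint_rules = bigint_mult bigint_add bigint_sum bigint_big bigint_coeff big_cert_X big_cert_Y big_numer
  big_denom big_nat_at big_unpack[OF accessible_Y] bigint_const[of _ 0, unfolded of_nat_0]
  bigint_const[of _ 1, unfolded of_nat_1]

lemma checkable_first_stage:
  "checkable k (\<lambda>z \<sigma>. first_stage (dims (fst z)) (nat_at (fst z) (dim_pos (fst z) 6)) (coeff z) (cert_X z 1)
     (\<lambda>k. cert_X z (2 + k)))"
  unfolding first_stage_def ix_defs
  by (intro checkable_conj checkable_all checkable_bigint_le bigint_rules feasible_const feasible_add feasible_mult
      feasible_dims feasible_dim_pos feasible_offsets; (assumption | erule feasible_weaken, assumption))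

lemma checkable_refutes:
  "checkable k (\<lambda>z \<sigma>. refutes (dims (fst z)) (nat_at (fst z) (dim_pos (fst z) 6)) (coeff z) (cert_X z 0) (cert_X z 1)
     (\<lambda>k. cert_X z (2 + k)) (cert_Y z) (\<lambda>i. cert_Y z (dims (fst z) 1 + i))
     (\<lambda>j. cert_Y z (dims (fst z) 1 + dims (fst z) 5 + j)))"
  unfolding refutes_def ix_defs
  by (intro checkable_conj checkable_all checkable_bigint_le checkable_bigint_less bigint_rules feasible_const
      feasible_add feasible_mult feasible_dims feasible_dim_pos feasible_offsets;
      (assumption | erule feasible_weaken, assumption | erule feasible_weaken, erule order_trans, assumption))

lemma checkable_verifier: "checkable k (\<lambda>z \<sigma>. verifier z)"
  unfolding verifier_def
  by (intro checkable_conj checkable_not checkable_all checkable_bigint_eq checkable_bigint_less bigint_rules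
      checkable_well_formed checkable_first_stage checkable_refutes
      feasible_const feasible_add feasible_dims feasible_entries)

lemma polytime_verifier: "polytime_decidable (\<lambda>I X Y. verifier (I, X, Y))"
proof -
  have "feasible 0 (\<lambda>z \<sigma>. of_bool (verifier z))" using checkable_verifier by (simp add: checkable_def)
  from feasible_polytime_decidable[OF this] show ?thesis by simp
qed


section \<open>Decoding instances\<close>

lemma run_length_eq:
  assumes "\<And>s. s < n \<Longrightarrow> Q s" "\<not> Q n" "n \<le> N"
  shows "run_length N Q = n"
proof -
  have "(\<forall>s'<Suc s. Q s') \<longleftrightarrow> s < n" for s
    using assms(1,2) by (meson less_Suc_eq_le less_trans_Suc linorder_not_le order_less_le_trans)
  then show ?thesis unfolding run_length_def by (simp only:) (rule sum_of_bool_less[OF assms(3)])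
qed

text \<open>The assumption is met in the applications because no bit is set beyond the end of the
  string.\<close>

lemma run_length_props:
  assumes "\<not> Q N"
  shows "run_length N Q \<le> N" "s < run_length N Q \<Longrightarrow> Q s" "\<not> Q (run_length N Q)"
proof -
  define n where "n = (LEAST n. \<not> Q n)"
  have n: "\<not> Q n" "n \<le> N" "\<And>s. s < n \<Longrightarrow> Q s"
    unfolding n_def using LeastI[of "\<lambda>n. \<not> Q n", OF assms] Least_le[of "\<lambda>n. \<not> Q n", OF assms]
    by (auto dest: not_less_Least)
  from run_length_eq[of n Q N] n have "run_length N Q = n" by blast
  with n show "run_length N Q \<le> N" "s < run_length N Q \<Longrightarrow> Q s" "\<not> Q (run_length N Q)" by auto
qed

lemma bit_drop: "bit I (p + s) = bit (drop p I) s"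
  by (auto simp: bit_def)

lemma ones_eq:
  assumes "drop p I = encode_dim n @ ys"
  shows "ones I p = n" "drop (p + n + 1) I = ys" "p + n + 1 \<le> length I"
proof -
  have len: "length I - p = n + 1 + length ys" using arg_cong[OF assms, of length] by (simp add: encode_dim_def)
  show "ones I p = n"
    unfolding ones_def bit_drop assms using len
    by (intro run_length_eq) (auto simp: bit_def encode_dim_def nth_append)
  show "p + n + 1 \<le> length I" using len by linarith
  have "drop (n + 1) (drop p I) = ys" unfolding assms by (simp add: encode_dim_def)
  then show "drop (p + n + 1) I = ys" by (simp add: add_ac)
qed

text \<open>The converse of \<open>ones_eq\<close>: on an arbitrary string the scanned part is the
  code of the number found, provided that the scan ends inside the string.\<close>

lemma drop_ones:
  assumes "p + ones I p < length I"
  shows "drop p I = encode_dim (ones I p) @ drop (p + ones I p + 1) I"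
proof -
  let ?n = "ones I p" and ?L = "drop p I"
  have nb: "\<not> bit I (p + length I)" by (simp add: bit_def)
  have b: "\<And>s. s < ?n \<Longrightarrow> bit I (p + s)" "\<not> bit I (p + ?n)"
    using run_length_props[of "\<lambda>s. bit I (p + s)", OF nb] unfolding ones_def by auto
  have "take (?n + 1) ?L = encode_dim ?n"
  proof (rule nth_equalityI)
    show l: "length (take (?n + 1) ?L) = length (encode_dim ?n)" using assms by (simp add: encode_dim_def)
    fix i assume "i < length (take (?n + 1) ?L)"
    then have "i < ?n + 1" by simp
    then show "take (?n + 1) ?L ! i = encode_dim ?n ! i"
      using b assms by (cases "i < ?n") (auto simp: encode_dim_def nth_append bit_def less_Suc_eq)
  qed
  moreover have "drop (?n + 1) ?L = drop (p + ?n + 1) I" by (simp add: add_ac)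
  ultimately show ?thesis using append_take_drop_id[of "?n + 1" ?L] by simp
qed

section \<open>Digit strings, their values and their self-delimiting codes\<close>

fun bin_value :: "bool list \<Rightarrow> nat" where
  "bin_value [] = 0"
| "bin_value (b # bs) = of_bool b + 2 * bin_value bs"

lemma bin_value_sum: "bin_value bs = (\<Sum>s<length bs. of_bool (bs ! s) * 2 ^ s)"
proof (induction bs)
  case (Cons b bs)
  show ?case by (simp add: Cons sum.lessThan_Suc_shift sum_distrib_left mult_ac del: sum.lessThan_Suc
      sum_of_bool_mult_eq sum_mult_of_bool_eq)
qed simp

lemma binary_digits_pos: "0 < n \<Longrightarrow> binary_digits n = odd n # binary_digits (n div 2)"
  by (cases n) auto

lemma bin_value_digits: "bin_value (binary_digits n) = n"
proof (induction n rule: less_induct)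
  case (less n)
  show ?case
  proof (cases "n = 0")
    case False
    then have "bin_value (binary_digits (n div 2)) = n div 2" by (intro less) auto
    then show ?thesis using False by (simp add: binary_digits_pos)
  qed simp
qed

lemma last_binary_digits: "0 < n \<Longrightarrow> binary_digits n \<noteq> [] \<and> last (binary_digits n)"
proof (induction n rule: less_induct)
  case (less n)
  show ?case
  proof (cases "n = 1")
    case False
    then show ?thesis using less by (simp add: binary_digits_pos)
  qed (simp add: binary_digits_pos)
qed

lemma binary_digits_eq_Nil: "binary_digits n = [] \<longleftrightarrow> n = 0"
  using last_binary_digits by (cases n) auto

lemma bin_value_pos: "bs \<noteq> [] \<Longrightarrow> last bs \<Longrightarrow> 0 < bin_value bs"
  by (induction bs) (auto split: if_splits)

text \<open>Without leading zeros a digit string is determined by its value; this is the purpose of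
  \<open>canonical\<close>.\<close>

lemma binary_digits_value: "bs = [] \<or> last bs \<Longrightarrow> binary_digits (bin_value bs) = bs"
proof (induction bs)
  case (Cons b bs)
  show ?case
  proof (cases "bs = []")
    case True
    then show ?thesis using Cons.prems by (simp add: binary_digits_pos)
  next
    case False
    then have "last bs" using Cons.prems by simp
    then show ?thesis using Cons.IH bin_value_pos[OF False] by (simp add: binary_digits_pos)
  qed
qed simp

text \<open>Codes of arbitrary digit strings, because a string that is being parsed may contain
  digits not yet known to be free of leading zeros.\<close>

definition spread :: "bool list \<Rightarrow> bool list" where
  "spread ds = concat (map (\<lambda>d. [True, d]) ds) @ [False]"

lemma encode_nat_spread: "encode_nat n = spread (binary_digits n)"
  by (simp add: encode_nat_def spread_def)

lemma spread_simps [simp]: "spread [] = [False]" "spread (d # ds) = True # d # spread ds"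
  by (simp_all add: spread_def)

lemma length_spread: "length (spread ds) = 2 * length ds + 1"
  by (induction ds) (auto simp: spread_def)

lemma spread_nth:
  "s < length ds \<Longrightarrow> (spread ds @ ys) ! (2 * s)" "s < length ds \<Longrightarrow> (spread ds @ ys) ! (2 * s + 1) = ds ! s"
  "\<not> (spread ds @ ys) ! (2 * length ds)"
proof -
  show "s < length ds \<Longrightarrow> (spread ds @ ys) ! (2 * s)"
  proof (induction ds arbitrary: s)
    case (Cons d ds)
    then show ?case by (cases s) auto
  qed simp
  show "s < length ds \<Longrightarrow> (spread ds @ ys) ! (2 * s + 1) = ds ! s"
  proof (induction ds arbitrary: s)
    case (Cons d ds)
    then show ?case by (cases s) auto
  qed simp
  show "\<not> (spread ds @ ys) ! (2 * length ds)" by (induction ds) auto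
qed

lemma spread_of_bits:
  assumes "\<And>s. s < n \<Longrightarrow> bit L (2 * s)" "\<not> bit L (2 * n)" "2 * n < length L"
  shows "L = spread (map (\<lambda>s. bit L (2 * s + 1)) [0..<n]) @ drop (2 * n + 1) L"
  using assms
proof (induction n arbitrary: L)
  case 0
  then show ?case by (cases L) (auto simp: spread_def bit_def)
next
  case (Suc n)
  obtain x y L' where L: "L = x # y # L'"
    using Suc.prems(3) by (cases L; cases "tl L") auto
  have b: "bit (x # y # L') (Suc (Suc s)) = bit L' s" for s by (simp add: bit_def)
  have "L' = spread (map (\<lambda>s. bit L' (2 * s + 1)) [0..<n]) @ drop (2 * n + 1) L'"
    
  proof (rule Suc.IH)
    show "bit L' (2 * s)" if "s < n" for s using Suc.prems(1)[of "Suc s"] that by (simp add: L b)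
  qed (use Suc.prems(2,3) in \<open>simp_all add: L b\<close>)
  moreover have "x" using Suc.prems(1)[of 0] by (simp add: L bit_def)
  moreover have "map (\<lambda>s. bit L (2 * s + 1)) [0..<Suc n] = y # map (\<lambda>s. bit L' (2 * s + 1)) [0..<n]"
    unfolding map_upt_Suc L by (simp add: b) (simp add: bit_def)
  ultimately show ?case by (simp only:) (simp add: L spread_def)
qed

lemma nat_at_eq:
  assumes "drop p I = encode_nat n @ ys"
  shows "nat_at I p = n" "canonical I p" "digits I p = length (binary_digits n)"
    "drop (nat_end I p) I = ys" "nat_end I p \<le> length I"
proof -
  let ?ds = "binary_digits n"
  have L: "drop p I = spread ?ds @ ys" using assms by (simp add: encode_nat_spread)
  have len: "length I - p = 2 * length ?ds + 1 + length ys" using arg_cong[OF L, of length] by (simp add: length_spread)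
  have b: "bit I (p + s) \<longleftrightarrow> s < length (spread ?ds @ ys) \<and> (spread ?ds @ ys) ! s" for s
    unfolding bit_drop[of I p s] L by (simp add: bit_def)
  show dg: "digits I p = length ?ds"
    unfolding digits_def b using len spread_nth(1)[of _ ?ds ys] spread_nth(3)[of ?ds ys]
    by (intro run_length_eq) (auto simp: length_spread)
  have b1: "bit I (p + 2 * s + 1) = ?ds ! s" if "s < length ?ds" for s
    using b[of "2 * s + 1"] spread_nth(2)[OF that, of ys] that by (simp add: length_spread add_ac)
  show "nat_at I p = n"
  proof -
    have "nat_at I p = bin_value ?ds" unfolding nat_at_def dg bin_value_sum 
      by (intro sum.cong refl) (use b1 in simp)
    then show ?thesis by (simp add: bin_value_digits)
  qed
  show "canonical I p"
  proof (cases "n = 0")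
    case False
    then have "?ds \<noteq> []" "last ?ds" using last_binary_digits[of n] by auto
    then have "bit I (p + 2 * (length ?ds - 1) + 1)" using b1[of "length ?ds - 1"] by (simp add: last_conv_nth)
    moreover have "p + 2 * (length ?ds - 1) + 1 = p + 2 * length ?ds - 1" using \<open>?ds \<noteq> []\<close> by (cases ?ds) auto
    ultimately show ?thesis by (simp add: canonical_def dg)
  qed (simp add: canonical_def dg)
  show "nat_end I p \<le> length I" using len by (simp add: nat_end_def dg)
  have "drop (2 * length ?ds + 1) (drop p I) = ys" unfolding L by (simp add: length_spread)
  then show "drop (nat_end I p) I = ys" by (simp add: nat_end_def dg add_ac)
qed

text \<open>The markers at even offsets show that the parsed part is the code of some digit string;
  canonicity makes it the digit string of its own value.\<close>

lemma drop_nat_at: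
  assumes "nat_end I p \<le> length I" "canonical I p"
  shows "drop p I = encode_nat (nat_at I p) @ drop (nat_end I p) I"
proof -
  let ?n = "digits I p" and ?L = "drop p I"
  let ?ds = "map (\<lambda>s. bit ?L (2 * s + 1)) [0..<?n]"
  have nb: "\<not> bit I (p + 2 * length I)" by (simp add: bit_def)
  have "bit ?L (2 * s)" if "s < ?n" for s
    using run_length_props(2)[of "\<lambda>s. bit I (p + 2 * s)", OF nb, of s] that bit_drop[of I p "2 * s"]
    unfolding digits_def by simp
  moreover have "\<not> bit ?L (2 * ?n)"
    using run_length_props(3)[of "\<lambda>s. bit I (p + 2 * s)", OF nb] bit_drop[of I p "2 * ?n"]
    unfolding digits_def by simp
  ultimately have L: "?L = spread ?ds @ drop (2 * ?n + 1) ?L"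
    using assms(1) by (intro spread_of_bits) (auto simp: nat_end_def)
  have "?ds = [] \<or> last ?ds"
  proof (cases "?n = 0")
    case False
    then have "last ?ds = bit I (p + (2 * (?n - 1) + 1))" 
      unfolding bit_drop[of I p "2 * (?n - 1) + 1"] by (simp add: last_conv_nth)
    moreover have "p + (2 * (?n - 1) + 1) = p + 2 * ?n - 1" using False by (cases ?n) auto
    ultimately show ?thesis using assms(2) False by (simp add: canonical_def)
  qed simp
  then have "binary_digits (bin_value ?ds) = ?ds" by (rule binary_digits_value)
  moreover have "bin_value ?ds = nat_at I p"
    unfolding bin_value_sum nat_at_def by (intro sum.cong) (auto simp: bit_drop[symmetric] add.assoc simp del: add_Suc_right)
  ultimately have "encode_nat (nat_at I p) = spread ?ds" by (simp add: encode_nat_spread)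
  moreover have "drop (2 * ?n + 1) ?L = drop (nat_end I p) I" by (simp add: nat_end_def add_ac)
  ultimately show ?thesis using L by simp
qed


section \<open>Parsing rational entries and whole instances\<close>

definition entry :: "bool list \<Rightarrow> nat \<Rightarrow> rat" where
  "entry I j = Rat.Fract (if bit I (entry_pos I j) then - int (numer I j) else int (numer I j)) (int (denom I j))"

lemma nat_end_gt: "p < nat_end I p"
  by (simp add: nat_end_def)

lemma entry_pos_Suc: "entry_pos I (Suc j) = nat_end I (denom_pos I j)"
  by (simp add: entry_pos_def denom_pos_def)

lemma entry_pos_0: "entry_pos I 0 = nat_end I (dim_pos I 6)"
  by (simp add: entry_pos_def)

lemma drop_eq_Cons: "drop p I = x # ys \<Longrightarrow> p < length I \<and> I ! p = x \<and> drop (Suc p) I = ys"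
  by (metis Cons_nth_drop_Suc drop_all leI list.distinct(1) list.inject)

text \<open>For a fraction in lowest terms \<open>quotient_of\<close> returns the given pair. The
  last assumption is there because zero is encoded with sign bit \<open>False\<close>.\<close>

lemma encode_rat_Fract:
  assumes "coprime n d" "0 < d" "s \<longrightarrow> n \<noteq> 0"
  shows "encode_rat (Rat.Fract (if s then - int n else int n) (int d)) = s # encode_nat n @ encode_nat d"
proof -
  have "quotient_of (Rat.Fract (if s then - int n else int n) (int d)) = (if s then - int n else int n, int d)"
    using assms(1,2) by (simp add: quotient_of_Fract normalize_stable)
  then show ?thesis using assms(3) by (auto simp: encode_rat_def encode_int_def)
qed

lemma canonical_pos:
  assumes "nat_end I p \<le> length I" "canonical I p"
  shows "nat_at I p = 0 \<longleftrightarrow> digits I p = 0"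
  using nat_at_eq(3)[OF drop_nat_at[OF assms]] binary_digits_eq_Nil[of "nat_at I p"] by simp

lemma drop_entry:
  assumes e: "entry_pos I (Suc j) \<le> length I"
    and c: "canonical I (entry_pos I j + 1)" "canonical I (denom_pos I j)" "digits I (denom_pos I j) \<noteq> 0"
      "bit I (entry_pos I j) \<longrightarrow> digits I (entry_pos I j + 1) \<noteq> 0"
    and cop: "coprime (numer I j) (denom I j)"
  shows "drop (entry_pos I j) I = encode_rat (entry I j) @ drop (entry_pos I (Suc j)) I"
proof -
  let ?p = "entry_pos I j"
  have e2: "nat_end I (denom_pos I j) \<le> length I" using e by (simp add: entry_pos_Suc)
  have e1: "nat_end I (?p + 1) \<le> length I"
    using e2 nat_end_gt[of "denom_pos I j" I] by (simp add: denom_pos_def)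
  have p: "?p < length I" using e1 nat_end_gt[of "?p + 1" I] by simp
  have "drop ?p I = bit I ?p # drop (?p + 1) I" using p by (simp add: bit_def Cons_nth_drop_Suc)
  also have "drop (?p + 1) I = encode_nat (numer I j) @ drop (denom_pos I j) I"
    unfolding numer_def denom_pos_def by (rule drop_nat_at[OF e1 c(1)])
  also have "drop (denom_pos I j) I = encode_nat (denom I j) @ drop (entry_pos I (Suc j)) I"
    unfolding denom_def entry_pos_Suc by (rule drop_nat_at[OF e2 c(2)])
  finally have "drop ?p I = bit I ?p # encode_nat (numer I j) @ encode_nat (denom I j) @ drop (entry_pos I (Suc j)) I" .
  moreover have "0 < denom I j" using canonical_pos[OF e2 c(2)] c(3) by (simp add: denom_def)
  moreover have "bit I ?p \<longrightarrow> numer I j \<noteq> 0" using canonical_pos[OF e1 c(1)] c(4) by (simp add: numer_def)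
  ultimately show ?thesis using encode_rat_Fract[OF cop, of "bit I ?p"] by (simp add: entry_def)
qed

lemma entry_eq:
  assumes "drop (entry_pos I j) I = encode_rat r @ ys"
  shows "entry I j = r" "drop (entry_pos I (Suc j)) I = ys" "entry_pos I (Suc j) \<le> length I"
    "canonical I (entry_pos I j + 1)" "canonical I (denom_pos I j)" "digits I (denom_pos I j) \<noteq> 0"
    "bit I (entry_pos I j) \<longrightarrow> digits I (entry_pos I j + 1) \<noteq> 0" "coprime (numer I j) (denom I j)" "0 < denom I j"
proof -
  obtain n d where nd: "quotient_of r = (n, d)" by (cases "quotient_of r")
  have d: "0 < d" and cop: "coprime n d" using nd quotient_of_denom_pos quotient_of_coprime by blast+
  let ?p = "entry_pos I j"
  have "drop ?p I = (n < 0) # encode_nat (nat \<bar>n\<bar>) @ encode_nat (nat d) @ ys"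
    using assms by (simp add: encode_rat_def nd encode_int_def)
  note 1 = drop_eq_Cons[OF this]
  then have b: "bit I ?p \<longleftrightarrow> n < 0" by (simp add: bit_def)
  have "drop (?p + 1) I = encode_nat (nat \<bar>n\<bar>) @ encode_nat (nat d) @ ys" using 1 by simp
  note 2 = nat_at_eq[OF this]
  have "drop (denom_pos I j) I = encode_nat (nat d) @ ys" using 2(4) by (simp add: denom_pos_def)
  note 3 = nat_at_eq[OF this]
  have num: "numer I j = nat \<bar>n\<bar>" and den: "denom I j = nat d" using 2(1) 3(1) by (simp_all add: numer_def denom_def)
  show "drop (entry_pos I (Suc j)) I = ys" "entry_pos I (Suc j) \<le> length I" using 3(4,5) by (simp_all add: entry_pos_Suc)
  show "canonical I (entry_pos I j + 1)" "canonical I (denom_pos I j)" using 2(2) 3(2) by auto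
  show "digits I (denom_pos I j) \<noteq> 0" using 3(3) d binary_digits_eq_Nil[of "nat d"] by simp
  show "bit I ?p \<longrightarrow> digits I (?p + 1) \<noteq> 0" using 2(3) b binary_digits_eq_Nil[of "nat \<bar>n\<bar>"]
    by (cases "n < 0") simp_all
  show "coprime (numer I j) (denom I j)" unfolding num den
    using cop d by (simp add: coprime_int_iff[symmetric])
  show "0 < denom I j" using d den by simp
  have "(if bit I ?p then - int (numer I j) else int (numer I j)) = n" using b num by auto
  then show "entry I j = r" using den d by (simp add: entry_def quotient_of_div[OF nd] Fract_of_int_quotient)
qed

text \<open>A code reveals only six dimensions, the bound and one sequence of rationals; the
  arrangement in vectors and matrices is left to the numbering of the entries.\<close>

definition encoding :: "(nat \<Rightarrow> nat) \<Rightarrow> nat \<Rightarrow> rat list \<Rightarrow> bool list" where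
  "encoding d R rs = concat (map (\<lambda>i. encode_dim (d i)) [0..<6]) @ encode_nat R @ concat (map encode_rat rs)"

lemma dims_eq:
  assumes "I = concat (map (\<lambda>i. encode_dim (d i)) [0..<n]) @ ys" "i \<le> n"
  shows "drop (dim_pos I i) I = concat (map (\<lambda>i. encode_dim (d i)) [i..<n]) @ ys \<and> (\<forall>j<i. dims I j = d j)"
  using assms(2)
proof (induction i)
  case 0
  then show ?case using assms(1) by simp
next
  case (Suc i)
  then have "drop (dim_pos I i) I = encode_dim (d i) @ concat (map (\<lambda>i. encode_dim (d i)) [Suc i..<n]) @ ys"
    by (simp add: upt_conv_Cons)
  note o = ones_eq[OF this]
  have "dims I i = d i" using o(1) by (simp add: dims_def)
  then show ?case using Suc o(1,2) by (simp add: less_Suc_eq)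
qed

lemma entries_eq:
  assumes "drop (entry_pos I 0) I = concat (map encode_rat rs)" "entry_pos I 0 \<le> length I" "i \<le> length rs"
  shows "drop (entry_pos I i) I = concat (map encode_rat (drop i rs)) \<and> entry_pos I i \<le> length I"
  using assms(3)
proof (induction i)
  case 0
  then show ?case using assms(1,2) by simp
next
  case (Suc i)
  then have "drop (entry_pos I i) I = encode_rat (rs ! i) @ concat (map encode_rat (drop (Suc i) rs))"
    by (simp add: Cons_nth_drop_Suc[symmetric])
  from entry_eq(2,3)[OF this] show ?case by simp
qed

lemma entries_cong: "(\<And>i. i < 6 \<Longrightarrow> d i = d' i) \<Longrightarrow> entries d = entries d'"
  by (simp add: entries_def off_T_def off_B_def off_W_def off_A_def)

lemma decode:
  assumes I: "I = encoding d R rs" and len: "length rs = entries d"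
  shows "well_formed I" "\<And>i. i < 6 \<Longrightarrow> dims I i = d i" "nat_at I (dim_pos I 6) = R"
    "\<And>j. j < entries d \<Longrightarrow> entry I j = rs ! j" "\<And>j. j < entries d \<Longrightarrow> coprime (numer I j) (denom I j)"
    "\<And>j. j < entries d \<Longrightarrow> 0 < denom I j"
proof -
  have *: "I = concat (map (\<lambda>i. encode_dim (d i)) [0..<6]) @ encode_nat R @ concat (map encode_rat rs)"
    using I by (simp add: encoding_def)
  from dims_eq[OF this order_refl] have d: "\<And>i. i < 6 \<Longrightarrow> dims I i = d i"
    and p6: "drop (dim_pos I 6) I = encode_nat R @ concat (map encode_rat rs)" by auto
  note R = nat_at_eq[OF p6]
  have e0: "drop (entry_pos I 0) I = concat (map encode_rat rs)" "entry_pos I 0 \<le> length I"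
    using R(4,5) by (simp_all add: entry_pos_0)
  note e = entries_eq[OF e0]
  have ent: "entries (dims I) = entries d" by (rule entries_cong) (rule d)
  have "drop (entry_pos I j) I = encode_rat (rs ! j) @ concat (map encode_rat (drop (Suc j) rs))" if "j < entries d" for j
    using e[of j] that len by (simp add: Cons_nth_drop_Suc[symmetric])
  note q = entry_eq[OF this]
  have "drop (entry_pos I (length rs)) I = []" "entry_pos I (length rs) \<le> length I" using e[OF order_refl] by auto
  then have "entry_pos I (entries d) = length I" using len by simp
  then show "well_formed I" unfolding well_formed_def ent using R(2) q(4-7) by blast
  show "\<And>i. i < 6 \<Longrightarrow> dims I i = d i" by (rule d)
  show "nat_at I (dim_pos I 6) = R" by (rule R(1))
  show "\<And>j. j < entries d \<Longrightarrow> entry I j = rs ! j" "\<And>j. j < entries d \<Longrightarrow> coprime (numer I j) (denom I j)"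
    "\<And>j. j < entries d \<Longrightarrow> 0 < denom I j" using q(1,8,9) by auto
qed

lemma entry_pos_mono: "i \<le> j \<Longrightarrow> entry_pos I i \<le> entry_pos I j"
proof (induction rule: dec_induct)
  case (step n)
  then show ?case using nat_end_gt[of "entry_pos I n + 1" I] nat_end_gt[of "denom_pos I n" I]
    by (simp add: entry_pos_Suc) (simp add: denom_pos_def)
qed simp

lemma well_formed_denom_pos:
  assumes wf: "well_formed I" and j: "j < entries (dims I)"
  shows "0 < denom I j"
proof -
  have "nat_end I (denom_pos I j) \<le> length I"
    using wf entry_pos_mono[of "Suc j" "entries (dims I)" I] j by (simp add: well_formed_def entry_pos_Suc)
  moreover have "canonical I (denom_pos I j)" "digits I (denom_pos I j) \<noteq> 0" using wf j by (simp_all add: well_formed_def)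
  ultimately show ?thesis using canonical_pos[of I "denom_pos I j"] by (simp add: denom_def)
qed

text \<open>The string is reconstructed backwards, because well-formedness fixes the position behind
  the last entry as the end of the string, and positions are monotone.\<close>

lemma well_formed_encoding:
  assumes wf: "well_formed I" and cop: "\<And>j. j < entries (dims I) \<Longrightarrow> coprime (numer I j) (denom I j)"
  shows "I = encoding (dims I) (nat_at I (dim_pos I 6)) (map (entry I) [0..<entries (dims I)])"
proof -
  let ?K = "entries (dims I)"
  have eK: "entry_pos I ?K = length I" and c6: "canonical I (dim_pos I 6)" using wf by (auto simp: well_formed_def)
  note mono = entry_pos_mono[of _ _ I]
  have ej: "drop (entry_pos I (?K - j)) I = concat (map (\<lambda>i. encode_rat (entry I i)) [?K - j..<?K])" if "j \<le> ?K" for j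
    using that
  proof (induction j)
    case 0
    then show ?case using eK by simp
  next
    case (Suc j)
    let ?i = "?K - Suc j"
    have i: "?i < ?K" "Suc ?i = ?K - j" using Suc.prems by auto
    have "drop (entry_pos I ?i) I = encode_rat (entry I ?i) @ drop (entry_pos I (Suc ?i)) I"
      using wf i(1) eK mono[of "Suc ?i" ?K] by (intro drop_entry cop) (auto simp: well_formed_def)
    then show ?case using Suc i by (simp add: upt_conv_Cons)
  qed
  have p6: "nat_end I (dim_pos I 6) \<le> length I" using mono[of 0 ?K] eK by (simp add: entry_pos_0)
  have "drop (dim_pos I 6) I = encode_nat (nat_at I (dim_pos I 6)) @ drop (entry_pos I 0) I"
    unfolding entry_pos_0 by (rule drop_nat_at[OF p6 c6])
  also have "drop (entry_pos I 0) I = concat (map (\<lambda>i. encode_rat (entry I i)) [0..<?K])"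
    using ej[OF order_refl] by simp
  finally have d6: "drop (dim_pos I 6) I = encode_nat (nat_at I (dim_pos I 6)) @ concat (map (\<lambda>i. encode_rat (entry I i)) [0..<?K])" .
  have lt: "dim_pos I 6 < length I" using p6 nat_end_gt[of "dim_pos I 6" I] by simp
  have dmono: "dim_pos I i \<le> dim_pos I j" if "i \<le> j" for i j
    using that by (induction rule: dec_induct) auto
  have dj: "drop (dim_pos I (6 - j)) I = concat (map (\<lambda>i. encode_dim (dims I i)) [6 - j..<6]) @ drop (dim_pos I 6) I"
    if "j \<le> 6" for j
    using that
  proof (induction j)
    case (Suc j)
    let ?i = "6 - Suc j"
    have i: "?i < 6" "Suc ?i = 6 - j" using Suc.prems by auto
    have "dim_pos I ?i + ones I (dim_pos I ?i) < length I"
      using dmono[of "Suc ?i" 6] lt by simp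
    from drop_ones[OF this] have "drop (dim_pos I ?i) I = encode_dim (dims I ?i) @ drop (dim_pos I (6 - j)) I"
      unfolding i(2)[symmetric] by (simp add: dims_def)
    then show ?case using Suc i by (simp add: upt_conv_Cons)
  qed simp
  show ?thesis using dj[OF order_refl] d6 by (simp add: encoding_def o_def)
qed


section \<open>Instances as sequences of numbers\<close>

definition instance_of :: "(nat \<Rightarrow> nat) \<Rightarrow> nat \<Rightarrow> (nat \<Rightarrow> rat) \<Rightarrow> two_stage" where
  "instance_of d R r = \<lparr>bound = R, nx = d 0, nu = d 1, ny = d 2, mx = d 3, mu = d 4, my = d 5,
     rhs_a = vec (d 3) r, rhs_b = vec (d 4) (\<lambda>i. r (d 3 + i)),
     mat_A = mat (d 3) (d 0) (\<lambda>(i, j). r (ix_A d i j)), mat_W = mat (d 5) (d 2) (\<lambda>(i, j). r (ix_W d i j)),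
     coeffs_B = map (\<lambda>k. mat (d 4) (d 1) (\<lambda>(i, j). r (ix_B d k i j))) [0..<d 0],
     coeffs_T = map (\<lambda>k. mat (d 5) (d 0) (\<lambda>(i, j). r (ix_T d k i j))) [0..<d 1]\<rparr>"

lemma two_stage_instance_of: "two_stage_instance (instance_of d R r)"
  by (auto simp: two_stage_instance_def instance_of_def)

text \<open>Codes of consecutively numbered items. A matrix is a block of blocks, which
  \<open>concat_block\<close> flattens.\<close>

definition block :: "(nat \<Rightarrow> 'a list) \<Rightarrow> nat \<Rightarrow> nat \<Rightarrow> 'a list" where
  "block g off n = concat (map (\<lambda>t. g (off + t)) [0..<n])"

lemma block_append: "block g off (m + n) = block g off m @ block g (off + m) n"
  by (induction n) (simp_all add: block_def add_ac)

lemma concat_block: "concat (map (\<lambda>i. block g (off + i * n) n) [0..<m]) = block g off (m * n)"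
proof (induction m)
  case (Suc m)
  then show ?case using block_append[of g off "m * n" n] by (simp add: add.commute)
qed (simp add: block_def)

lemma encode_vec_vec: "encode_vec (vec n (\<lambda>j. r (off + j))) = block (\<lambda>t. encode_rat (r t)) off n"
proof -
  have "list_of_vec (vec n (\<lambda>j. r (off + j))) = map (\<lambda>j. r (off + j)) [0..<n]"
    by (intro nth_equalityI) (simp_all add: list_of_vec_index)
  then show ?thesis by (simp add: encode_vec_def block_def o_def)
qed

lemma encode_mat_mat:
  "encode_mat (mat m n (\<lambda>(i, j). r (off + (i * n + j)))) = block (\<lambda>t. encode_rat (r t)) off (m * n)"
proof -
  have "row (mat m n (\<lambda>(i, j). r (off + (i * n + j)))) i = vec n (\<lambda>j. r (off + i * n + j))" if "i < m" for i
    using that by (auto simp: add.assoc)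
  then have "map encode_vec (rows (mat m n (\<lambda>(i, j). r (off + (i * n + j))))) =
      map (\<lambda>i. block (\<lambda>t. encode_rat (r t)) (off + i * n) n) [0..<m]"
    by (auto simp: rows_def encode_vec_vec)
  then show ?thesis unfolding encode_mat_def by (simp only: concat_block)
qed

lemma encode_mats:
  "concat (map encode_mat (map (\<lambda>k. mat m n (\<lambda>(i, j). r (off + (k * (m * n) + (i * n + j))))) [0..<l])) =
     block (\<lambda>t. encode_rat (r t)) off (l * (m * n))"
proof -
  have "encode_mat (mat m n (\<lambda>(i, j). r (off + (k * (m * n) + (i * n + j))))) =
      block (\<lambda>t. encode_rat (r t)) (off + k * (m * n)) (m * n)" for k
    using encode_mat_mat[of m n r "off + k * (m * n)"] by (simp add: add.assoc)
  then show ?thesis by (simp add: concat_block o_def)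
qed

lemma encode_instance_of: "encode_two_stage (instance_of d R r) = encoding d R (map r [0..<entries d])"
proof -
  let ?g = "\<lambda>t. encode_rat (r t)"
  have a: "encode_vec (vec (d 3) r) = block ?g 0 (d 3)" using encode_vec_vec[of "d 3" r 0] by simp
  have 1: "encode_vec (vec (d 3) r) @ encode_vec (vec (d 4) (\<lambda>i. r (d 3 + i))) @
      encode_mat (mat (d 3) (d 0) (\<lambda>(i, j). r (ix_A d i j))) @ encode_mat (mat (d 5) (d 2) (\<lambda>(i, j). r (ix_W d i j))) @
      concat (map encode_mat (map (\<lambda>k. mat (d 4) (d 1) (\<lambda>(i, j). r (ix_B d k i j))) [0..<d 0])) @
      concat (map encode_mat (map (\<lambda>k. mat (d 5) (d 0) (\<lambda>(i, j). r (ix_T d k i j))) [0..<d 1])) =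
      block ?g 0 (entries d)"
    unfolding a encode_vec_vec ix_defs encode_mat_mat encode_mats entries_def off_T_def off_B_def off_W_def off_A_def
      block_append by simp
  have u: "[0..<6] = [0, 1, 2, 3, 4, 5 :: nat]" by (simp add: upt_rec)
  have 2: "concat (map encode_rat (map r [0..<entries d])) = block ?g 0 (entries d)"
    by (simp add: block_def o_def)
  show ?thesis unfolding encoding_def 2 1[symmetric] u by (simp add: encode_two_stage_def instance_of_def)
qed

lemma block_index: "i * n + j < m * n" if "i < m" "j < n" for i j m n :: nat
proof -
  have "i * n + j < Suc i * n" using that by simp
  also have "\<dots> \<le> m * n" using that by (intro mult_le_mono1) simp
  finally show ?thesis .
qed

lemma block_div_mod: "(k * n + x) div n = k" "(k * n + x) mod n = x" if "x < n" for k n x :: nat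
  using that by auto

text \<open>The sequence \<open>r\<close> inverts the numbering of the entries: the offsets identify
  the vector or matrix, division with remainder the indices.\<close>

lemma instance_of_exists:
  assumes J: "two_stage_instance J"
  shows "\<exists>d R r. J = instance_of d R r"
proof -
  define d where "d i = [nx J, nu J, ny J, mx J, mu J, my J] ! i" for i
  have d: "d 0 = nx J" "d (Suc 0) = nu J" "d 2 = ny J" "d 3 = mx J" "d 4 = mu J" "d 5 = my J"
    by (simp_all add: d_def numeral_eq_Suc)
  define r where "r t = (if t < d 3 then rhs_a J $ t
     else if t < off_A d then rhs_b J $ (t - d 3)
     else if t < off_W d then mat_A J $$ ((t - off_A d) div d 0, (t - off_A d) mod d 0)
     else if t < off_B d then mat_W J $$ ((t - off_W d) div d 2, (t - off_W d) mod d 2)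
     else if t < off_T d then (coeffs_B J ! ((t - off_B d) div (d 4 * d 1))) $$
        ((t - off_B d) mod (d 4 * d 1) div d 1, (t - off_B d) mod (d 4 * d 1) mod d 1)
     else (coeffs_T J ! ((t - off_T d) div (d 5 * d 0))) $$
        ((t - off_T d) mod (d 5 * d 0) div d 0, (t - off_T d) mod (d 5 * d 0) mod d 0))" for t
  have o: "d 3 \<le> off_A d" "off_A d \<le> off_W d" "off_W d \<le> off_B d" "off_B d \<le> off_T d"
    by (simp_all add: off_A_def off_W_def off_B_def off_T_def)
  have rb: "r (d 3 + i) = rhs_b J $ i" if "i < d 4" for i using that by (simp add: r_def off_A_def)
  have rA: "r (ix_A d i j) = mat_A J $$ (i, j)" if "i < d 3" "j < d 0" for i j
  proof -
    have "ix_A d i j < off_W d" using block_index[OF that] by (simp add: ix_A_def off_W_def)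
    moreover have "\<not> ix_A d i j < d 3" "\<not> ix_A d i j < off_A d" using o by (auto simp: ix_A_def)
    ultimately have "r (ix_A d i j) = mat_A J $$ ((ix_A d i j - off_A d) div d 0, (ix_A d i j - off_A d) mod d 0)"
      by (simp add: r_def)
    then show ?thesis using that by (simp add: ix_A_def)
  qed
  have rW: "r (ix_W d i j) = mat_W J $$ (i, j)" if "i < d 5" "j < d 2" for i j
  proof -
    have "ix_W d i j < off_B d" using block_index[OF that] by (simp add: ix_W_def off_B_def)
    moreover have "\<not> ix_W d i j < d 3" "\<not> ix_W d i j < off_A d" "\<not> ix_W d i j < off_W d" using o by (auto simp: ix_W_def)
    ultimately have "r (ix_W d i j) = mat_W J $$ ((ix_W d i j - off_W d) div d 2, (ix_W d i j - off_W d) mod d 2)"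
      by (simp add: r_def)
    then show ?thesis using that by (simp add: ix_W_def)
  qed
  have rB: "r (ix_B d k i j) = coeffs_B J ! k $$ (i, j)" if "k < d 0" "i < d 4" "j < d 1" for k i j
  proof -
    let ?x = "i * d 1 + j"
    have x: "?x < d 4 * d 1" by (rule block_index[OF that(2,3)])
    have "ix_B d k i j < off_T d" using block_index[OF that(1) x] by (simp add: ix_B_def off_T_def)
    moreover have "\<not> ix_B d k i j < d 3" "\<not> ix_B d k i j < off_A d" "\<not> ix_B d k i j < off_W d"
      "\<not> ix_B d k i j < off_B d" using o by (auto simp: ix_B_def)
    ultimately have "r (ix_B d k i j) = (coeffs_B J ! ((ix_B d k i j - off_B d) div (d 4 * d 1))) $$
        ((ix_B d k i j - off_B d) mod (d 4 * d 1) div d 1, (ix_B d k i j - off_B d) mod (d 4 * d 1) mod d 1)"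
      by (simp add: r_def)
    moreover have "ix_B d k i j - off_B d = k * (d 4 * d 1) + ?x" by (simp add: ix_B_def)
    moreover have "(k * (d 4 * d 1) + ?x) div (d 4 * d 1) = k" "(k * (d 4 * d 1) + ?x) mod (d 4 * d 1) = ?x"
      using block_div_mod[OF x] by blast+
    moreover have "?x div d 1 = i" "?x mod d 1 = j" using that(3) by simp_all
    ultimately show ?thesis by (simp only:)
  qed
  have rT: "r (ix_T d k i j) = coeffs_T J ! k $$ (i, j)" if "k < d 1" "i < d 5" "j < d 0" for k i j
  proof -
    let ?x = "i * d 0 + j"
    have x: "?x < d 5 * d 0" by (rule block_index[OF that(2,3)])
    have "\<not> ix_T d k i j < d 3" "\<not> ix_T d k i j < off_A d" "\<not> ix_T d k i j < off_W d"
      "\<not> ix_T d k i j < off_B d" "\<not> ix_T d k i j < off_T d" using o by (auto simp: ix_T_def)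
    then have "r (ix_T d k i j) = (coeffs_T J ! ((ix_T d k i j - off_T d) div (d 5 * d 0))) $$
        ((ix_T d k i j - off_T d) mod (d 5 * d 0) div d 0, (ix_T d k i j - off_T d) mod (d 5 * d 0) mod d 0)"
      by (simp add: r_def)
    moreover have "ix_T d k i j - off_T d = k * (d 5 * d 0) + ?x" by (simp add: ix_T_def)
    moreover have "(k * (d 5 * d 0) + ?x) div (d 5 * d 0) = k" "(k * (d 5 * d 0) + ?x) mod (d 5 * d 0) = ?x"
      using block_div_mod[OF x] by blast+
    moreover have "?x div d 0 = i" "?x mod d 0 = j" using that(3) by simp_all
    ultimately show ?thesis by (simp only:)
  qed
  have carr: "rhs_a J \<in> carrier_vec (d 3)" "rhs_b J \<in> carrier_vec (d 4)" "mat_A J \<in> carrier_mat (d 3) (d 0)"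
    "mat_W J \<in> carrier_mat (d 5) (d 2)" "length (coeffs_B J) = d 0" "length (coeffs_T J) = d 1"
    "\<And>k. k < d 0 \<Longrightarrow> coeffs_B J ! k \<in> carrier_mat (d 4) (d 1)" "\<And>k. k < d 1 \<Longrightarrow> coeffs_T J ! k \<in> carrier_mat (d 5) (d 0)"
    using J nth_mem by (auto simp: two_stage_instance_def d subset_eq)
  have "rhs_a J = vec (d 3) r" using carr(1) by (intro eq_vecI) (auto simp: r_def)
  moreover have "rhs_b J = vec (d 4) (\<lambda>i. r (d 3 + i))" using carr(2) by (intro eq_vecI) (auto simp: rb)
  moreover have "mat_A J = mat (d 3) (d 0) (\<lambda>(i, j). r (ix_A d i j))" using carr(3) by (intro eq_matI) (auto simp: rA)
  moreover have "mat_W J = mat (d 5) (d 2) (\<lambda>(i, j). r (ix_W d i j))" using carr(4) by (intro eq_matI) (auto simp: rW)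
  moreover have "coeffs_B J = map (\<lambda>k. mat (d 4) (d 1) (\<lambda>(i, j). r (ix_B d k i j))) [0..<d 0]"
    using carr(5) carrier_matD[OF carr(7)] rB by (intro nth_equalityI) (auto intro!: eq_matI)
  moreover have "coeffs_T J = map (\<lambda>k. mat (d 5) (d 0) (\<lambda>(i, j). r (ix_T d k i j))) [0..<d 1]"
    using carr(6) carrier_matD[OF carr(8)] rT by (intro nth_equalityI) (auto intro!: eq_matI)
  ultimately have "J = instance_of d (bound J) r" by (simp add: instance_of_def d)
  then show ?thesis by blast
qed

section \<open>The decision problem for sequences instead of vectors and matrices\<close>

definition stage_X :: "(nat \<Rightarrow> nat) \<Rightarrow> nat \<Rightarrow> (nat \<Rightarrow> real) \<Rightarrow> (nat \<Rightarrow> real) \<Rightarrow> bool" where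
  "stage_X d R a x \<longleftrightarrow> (\<forall>k<d 0. 0 \<le> x k \<and> x k \<le> real R) \<and> (\<forall>i<d 3. (\<Sum>j<d 0. a (ix_A d i j) * x j) \<le> a i)"

text \<open>Integral points of the box have natural coordinates, so integrality is expressed by the
  type of \<open>u\<close>.\<close>

definition scenario :: "(nat \<Rightarrow> nat) \<Rightarrow> nat \<Rightarrow> (nat \<Rightarrow> real) \<Rightarrow> (nat \<Rightarrow> real) \<Rightarrow> (nat \<Rightarrow> nat) \<Rightarrow> bool" where
  "scenario d R a x u \<longleftrightarrow> (\<forall>k<d 1. u k \<le> R) \<and>
     (\<forall>i<d 4. (\<Sum>j<d 1. \<Sum>k<d 0. a (ix_B d k i j) * x k * real (u j)) \<le> a (d 3 + i))"

definition load :: "(nat \<Rightarrow> nat) \<Rightarrow> (nat \<Rightarrow> real) \<Rightarrow> (nat \<Rightarrow> real) \<Rightarrow> (nat \<Rightarrow> nat) \<Rightarrow> nat \<Rightarrow> real" where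
  "load d a x u i = (\<Sum>j<d 0. \<Sum>k<d 1. a (ix_T d k i j) * real (u k) * x j)"

definition recourse :: "(nat \<Rightarrow> nat) \<Rightarrow> nat \<Rightarrow> (nat \<Rightarrow> real) \<Rightarrow> (nat \<Rightarrow> real) \<Rightarrow> (nat \<Rightarrow> nat) \<Rightarrow> bool" where
  "recourse d R a x u \<longleftrightarrow> (\<exists>y. (\<forall>j<d 2. 0 \<le> y j \<and> y j \<le> real R) \<and>
     (\<forall>i<d 5. load d a x u i + (\<Sum>j<d 2. a (ix_W d i j) * y j) \<le> 0))"

definition solves :: "(nat \<Rightarrow> nat) \<Rightarrow> nat \<Rightarrow> (nat \<Rightarrow> real) \<Rightarrow> (nat \<Rightarrow> real) \<Rightarrow> bool" where
  "solves d R a x \<longleftrightarrow> stage_X d R a x \<and> (\<forall>u. scenario d R a x u \<longrightarrow> recourse d R a x u)"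

lemma two_stage_yes_instance_of:
  "two_stage_yes (instance_of d R r) \<longleftrightarrow> (\<exists>x. solves d R (\<lambda>j. real_of_rat (r j)) x)"
proof -
  let ?J = "instance_of d R r" and ?a = "\<lambda>j. real_of_rat (r j)"
  have box: "vec n v \<in> vec_box R n \<longleftrightarrow> (\<forall>i<n. 0 \<le> v i \<and> v i \<le> real R)" for n v by (simp add: vec_box_def)
  have X: "vec (d 0) x \<in> set_X ?J \<longleftrightarrow> stage_X d R ?a x" for x
    unfolding set_X_def stage_X_def
    by (auto simp: instance_of_def box less_eq_vec_def scalar_prod_def lessThan_atLeast0)
  have U: "vec (d 1) (\<lambda>j. real (u j)) \<in> set_U ?J (vec (d 0) x) \<longleftrightarrow> scenario d R ?a x u" for u x
    unfolding set_U_def scenario_def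
    by (auto simp: instance_of_def box less_eq_vec_def scalar_prod_def lessThan_atLeast0 matrix_B_def sum_distrib_right)
  have Y: "vec (d 2) y \<in> set_Y ?J (vec (d 0) x) (vec (d 1) (\<lambda>j. real (u j))) \<longleftrightarrow>
      (\<forall>j<d 2. 0 \<le> y j \<and> y j \<le> real R) \<and> (\<forall>i<d 5. load d ?a x u i + (\<Sum>j<d 2. ?a (ix_W d i j) * y j) \<le> 0)" for y x u
    unfolding set_Y_def load_def
    by (auto simp: instance_of_def box less_eq_vec_def scalar_prod_def lessThan_atLeast0 matrix_T_def sum_distrib_right)
  have cX: "v \<in> set_X ?J \<Longrightarrow> \<exists>x. v = vec (d 0) x" for v
    by (intro exI[of _ "($) v"]) (auto simp: set_X_def vec_box_def instance_of_def)
  have cY: "v \<in> set_Y ?J x u \<Longrightarrow> \<exists>y. v = vec (d 2) y" for v x u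
    by (intro exI[of _ "($) v"]) (auto simp: set_Y_def vec_box_def instance_of_def)
  have cU: "\<exists>u. v = vec (d 1) (\<lambda>j. real (u j))" if v: "v \<in> set_U ?J x" for v x
  proof (intro exI[of _ "\<lambda>j. nat \<lfloor>v $ j\<rfloor>"] eq_vecI)
    have *: "v \<in> carrier_vec (d 1)" "\<And>i. i < d 1 \<Longrightarrow> v $ i \<in> \<int>" "\<And>i. i < d 1 \<Longrightarrow> 0 \<le> v $ i"
      using v by (auto simp: set_U_def vec_box_def instance_of_def)
    then show "dim_vec v = dim_vec (vec (d 1) (\<lambda>j. real (nat \<lfloor>v $ j\<rfloor>)))" by simp
    fix i assume "i < dim_vec (vec (d 1) (\<lambda>j. real (nat \<lfloor>v $ j\<rfloor>)))"
    then have "i < d 1" by simp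
    then show "v $ i = vec (d 1) (\<lambda>j. real (nat \<lfloor>v $ j\<rfloor>)) $ i" using *(2,3)[of i] by (auto elim!: Ints_cases)
  qed
  have rec: "(\<exists>y. y \<in> set_Y ?J (vec (d 0) x) (vec (d 1) (\<lambda>j. real (u j)))) \<longleftrightarrow> recourse d R ?a x u" for x u
    unfolding recourse_def Y[symmetric] using cY by metis
  show ?thesis
  proof
    assume "two_stage_yes ?J"
    then obtain v where v: "v \<in> set_X ?J" "\<And>w. w \<in> set_U ?J v \<Longrightarrow> \<exists>y. y \<in> set_Y ?J v w" by (auto simp: two_stage_yes_def)
    then obtain x where x: "v = vec (d 0) x" using cX by blast
    have "solves d R ?a x" unfolding solves_def using v U rec X unfolding x by blast
    then show "\<exists>x. solves d R ?a x" by blast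
  next
    assume "\<exists>x. solves d R ?a x"
    then obtain x where x: "solves d R ?a x" by blast
    have "\<exists>y. y \<in> set_Y ?J (vec (d 0) x) w" if w: "w \<in> set_U ?J (vec (d 0) x)" for w
    proof -
      obtain u where u: "w = vec (d 1) (\<lambda>j. real (u j))" using cU[OF w] by blast
      show ?thesis using x w unfolding u U rec solves_def by blast
    qed
    then show "two_stage_yes ?J" unfolding two_stage_yes_def using x X[of x] unfolding solves_def by blast
  qed
qed


section \<open>Certificates of polynomial size\<close>

text \<open>Dual feasibility. Neither \<open>x\<close> nor \<open>u\<close> occurs in it; they
  influence only the dual objective.\<close>

definition certificate :: "(nat \<Rightarrow> nat) \<Rightarrow> (nat \<Rightarrow> real) \<Rightarrow> (nat \<Rightarrow> real) \<Rightarrow> (nat \<Rightarrow> real) \<Rightarrow> bool" where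
  "certificate d a l \<mu> \<longleftrightarrow> (\<forall>j<d 2. 0 \<le> (\<Sum>i<d 5. l i * a (ix_W d i j)) + \<mu> j)"

text \<open>The rows of the recourse problem are combined with the weights \<open>l\<close>. In each
  column \<open>\<mu>\<close> compensates a negative sum, and there \<open>y\<close> is estimated by
  \<open>R\<close>.\<close>

lemma weak_duality:
  assumes "recourse d R a x u" "certificate d a l \<mu>" "\<And>i. i < d 5 \<Longrightarrow> 0 \<le> l i" "\<And>j. j < d 2 \<Longrightarrow> 0 \<le> \<mu> j"
  shows "(\<Sum>i<d 5. l i * load d a x u i) \<le> real R * (\<Sum>j<d 2. \<mu> j)"
proof -
  obtain y where y: "\<And>j. j < d 2 \<Longrightarrow> 0 \<le> y j" "\<And>j. j < d 2 \<Longrightarrow> y j \<le> real R"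
    "\<And>i. i < d 5 \<Longrightarrow> load d a x u i + (\<Sum>j<d 2. a (ix_W d i j) * y j) \<le> 0"
    using assms(1) unfolding recourse_def by blast
  have "(\<Sum>i<d 5. l i * load d a x u i) \<le> (\<Sum>i<d 5. l i * (- (\<Sum>j<d 2. a (ix_W d i j) * y j)))"
  proof (intro sum_mono mult_left_mono)
    fix i assume "i \<in> {..<d 5}"
    then show "load d a x u i \<le> - (\<Sum>j<d 2. a (ix_W d i j) * y j)" "0 \<le> l i" using y(3)[of i] assms(3) by auto
  qed
  also have "\<dots> = - (\<Sum>i<d 5. \<Sum>j<d 2. l i * a (ix_W d i j) * y j)"
    by (simp add: sum_negf sum_distrib_left mult.assoc)
  also have "\<dots> = - (\<Sum>j<d 2. (\<Sum>i<d 5. l i * a (ix_W d i j)) * y j)"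
    by (subst sum.swap) (simp add: sum_distrib_right)
  also have "\<dots> = (\<Sum>j<d 2. - (\<Sum>i<d 5. l i * a (ix_W d i j)) * y j)" by (simp add: sum_negf)
  also have "\<dots> \<le> (\<Sum>j<d 2. \<mu> j * real R)"
  proof (rule sum_mono)
    fix j assume "j \<in> {..<d 2}"
    then have j: "j < d 2" by simp
    have "- (\<Sum>i<d 5. l i * a (ix_W d i j)) * y j \<le> \<mu> j * y j"
      using assms(2) j y(1)[OF j] by (intro mult_right_mono) (auto simp: certificate_def neg_le_iff_le minus_le_iff add.commute dest!: spec[of _ j])
    also have "\<dots> \<le> \<mu> j * real R" using y(2)[OF j] assms(4)[OF j] by (rule mult_left_mono)
    finally show "- (\<Sum>i<d 5. l i * a (ix_W d i j)) * y j \<le> \<mu> j * real R" .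
  qed
  finally show ?thesis by (simp add: sum_distrib_left mult.commute)
qed

lemma sum_split: "(\<Sum>i<m + n. g i) = (\<Sum>i<m. g i) + (\<Sum>j<n. g (m + j))" for g :: "nat \<Rightarrow> 'a :: comm_monoid_add"
  by (induction n) (simp_all add: add_ac)

definition lower_bound :: "nat \<Rightarrow> (nat \<Rightarrow> int) \<times> int" where
  "lower_bound k = (\<lambda>i. if i = k then - 1 else 0, 0)"

definition upper_bound :: "int \<Rightarrow> nat \<Rightarrow> (nat \<Rightarrow> int) \<times> int" where
  "upper_bound b k = (\<lambda>i. if i = k then 1 else 0, b)"

lemma holds_bounds:
  assumes "k < n"
  shows "holds n (lower_bound k) x \<longleftrightarrow> 0 \<le> x k" "holds n (upper_bound b k) x \<longleftrightarrow> x k \<le> of_int b"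
proof -
  have "(\<Sum>i<n. of_int (if i = k then - 1 else 0) * x i) = (\<Sum>i<n. if i = k then - x i else 0)"
    "(\<Sum>i<n. of_int (if i = k then 1 else 0) * x i) = (\<Sum>i<n. if i = k then x i else 0)"
    by (intro sum.cong refl; simp)+
  then show "holds n (lower_bound k) x \<longleftrightarrow> 0 \<le> x k" "holds n (upper_bound b k) x \<longleftrightarrow> x k \<le> of_int b"
    using assms by (simp_all add: holds_def lower_bound_def upper_bound_def sum.delta)
qed

text \<open>Estimates the determinants in Cramer's rule; the summand \<open>L * L\<close> comes from
  \<open>fact n \<le> n ^ n\<close> and \<open>n \<le> 2 ^ L\<close>.\<close>

lemma fact_mult_power_le:
  assumes "n \<le> L"
  shows "fact n * (2 ^ m) ^ n \<le> (2 :: nat) ^ (L * L + m * L)"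
proof -
  have "n < 2 ^ n" by simp
  then have "n \<le> 2 ^ L" using assms by (meson less_imp_le less_le_trans one_le_numeral power_increasing)
  have "fact n \<le> n ^ n" using fact_le_power[of n, where ?'a = nat] by simp
  also have "\<dots> \<le> (2 ^ L) ^ n" using \<open>n \<le> 2 ^ L\<close> by (rule power_mono) simp
  also have "\<dots> \<le> 2 ^ (L * L)" unfolding power_mult[symmetric] using assms by (intro power_increasing) auto
  finally have f: "fact n \<le> (2 :: nat) ^ (L * L)" by simp
  have "(2 ^ m) ^ n \<le> (2 :: nat) ^ (m * L)" unfolding power_mult[symmetric] using assms by (intro power_increasing) auto
  then show ?thesis using f unfolding power_add by (intro mult_le_mono) auto
qed

lemma ix_less:
  "i < d 3 \<Longrightarrow> i < entries d" "i < d 4 \<Longrightarrow> d 3 + i < entries d"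
  "i < d 3 \<Longrightarrow> j < d 0 \<Longrightarrow> ix_A d i j < entries d" "i < d 5 \<Longrightarrow> j < d 2 \<Longrightarrow> ix_W d i j < entries d"
  "k < d 0 \<Longrightarrow> i < d 4 \<Longrightarrow> j < d 1 \<Longrightarrow> ix_B d k i j < entries d"
  "k < d 1 \<Longrightarrow> i < d 5 \<Longrightarrow> j < d 0 \<Longrightarrow> ix_T d k i j < entries d"
proof -
  note defs = entries_def off_A_def off_W_def off_B_def off_T_def
  show "i < d 3 \<Longrightarrow> i < entries d" "i < d 4 \<Longrightarrow> d 3 + i < entries d" by (simp_all add: defs)
  show "i < d 3 \<Longrightarrow> j < d 0 \<Longrightarrow> ix_A d i j < entries d"
    using block_index[of i "d 3" j "d 0"] unfolding ix_A_def defs by linarith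
  show "i < d 5 \<Longrightarrow> j < d 2 \<Longrightarrow> ix_W d i j < entries d"
    using block_index[of i "d 5" j "d 2"] unfolding ix_W_def defs by linarith
  show "k < d 0 \<Longrightarrow> i < d 4 \<Longrightarrow> j < d 1 \<Longrightarrow> ix_B d k i j < entries d"
    using block_index[of k "d 0" "i * d 1 + j" "d 4 * d 1"] block_index[of i "d 4" j "d 1"] unfolding ix_B_def defs by linarith
  show "k < d 1 \<Longrightarrow> i < d 5 \<Longrightarrow> j < d 0 \<Longrightarrow> ix_T d k i j < entries d"
    using block_index[of k "d 1" "i * d 0 + j" "d 5 * d 0"] block_index[of i "d 5" j "d 0"] unfolding ix_T_def defs by linarith
qed

text \<open>\<open>L\<close> will be the length of the input, \<open>D\<close> a common denominator
  and \<open>c\<close> the scaled entries. The 1 in \<open>d 0 + 1\<close> makes room for a slack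
  variable; the exponent \<open>2 * L\<close> accounts for a numerator and a factor of at most
  \<open>D\<close>.\<close>

locale small_instance =
  fixes d :: "nat \<Rightarrow> nat" and R L D :: nat and c :: "nat \<Rightarrow> int" and a :: "nat \<Rightarrow> real"
  assumes dims_le: "d 0 + 1 \<le> L" "d 1 \<le> L" "d 5 + d 2 \<le> L"
    and R_le: "R \<le> 2 ^ L" and D_pos: "0 < D" and D_le: "D \<le> 2 ^ L"
    and a_eq: "\<And>j. j < entries d \<Longrightarrow> a j = of_int (c j) / of_nat D"
    and c_le: "\<And>j. j < entries d \<Longrightarrow> \<bar>c j\<bar> \<le> 2 ^ (2 * L)"
begin

lemma c_eq: "j < entries d \<Longrightarrow> of_int (c j) = a j * real D"
  using a_eq D_pos by simp

text \<open>Dual feasibility and the sign of the objective are invariant under positive scaling. So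
  the Farkas multipliers can be scaled down into the unit box, where a vertex with positive
  objective exists, and the vertex can be scaled up by its common denominator to natural
  numbers.\<close>

lemma small_certificate:
  assumes "\<not> recourse d R a x u"
  shows "\<exists>l \<mu> :: nat \<Rightarrow> nat. (\<forall>i<d 5. l i \<le> 2 ^ (3 * L * L)) \<and> (\<forall>j<d 2. \<mu> j \<le> 2 ^ (3 * L * L)) \<and>
     certificate d a l \<mu> \<and> real R * (\<Sum>j<d 2. real (\<mu> j)) < (\<Sum>i<d 5. real (l i) * load d a x u i)"
proof -
  let ?m = "d 5" and ?n = "d 2" and ?t = "load d a x u"
  obtain l0 \<mu>0 where l0: "\<And>i. 0 \<le> l0 i" "\<And>j. 0 \<le> \<mu>0 j"
    "\<And>j. j < ?n \<Longrightarrow> 0 \<le> (\<Sum>i<?m. l0 i * a (ix_W d i j)) + \<mu>0 j"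
    "real R * (\<Sum>j<?n. \<mu>0 j) < (\<Sum>i<?m. l0 i * ?t i)"
    using farkas_box[of ?n "real R" ?m ?t "\<lambda>i j. a (ix_W d i j)"] assms unfolding recourse_def by blast
  \<comment> \<open>An upper bound for every multiplier; the summand 1 makes it positive at
    once.\<close>
  define s where "s = 1 + (\<Sum>i<?m. l0 i) + (\<Sum>j<?n. \<mu>0 j)"
  have s0: "0 < s" unfolding s_def by (intro add_pos_nonneg sum_nonneg l0) simp
  have sl: "l0 i \<le> s" if "i < ?m" for i
    using member_le_sum[of i "{..<?m}" l0] that l0 sum_nonneg[of "{..<?n}" \<mu>0] by (simp add: s_def)
  have s\<mu>: "\<mu>0 j \<le> s" if "j < ?n" for j
    using member_le_sum[of j "{..<?n}" \<mu>0] that l0 sum_nonneg[of "{..<?m}" l0] by (simp add: s_def)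
  define N where "N = ?m + ?n"
  define row where "row j = (\<lambda>i. if i < ?m then - c (ix_W d i j) else if i = ?m + j then - int D else 0, 0 :: int)" for j
  define S where "S = lower_bound ` {..<N} \<union> upper_bound 1 ` {..<N} \<union> row ` {..<?n}"
  define v where "v i = (if i < ?m then l0 i else \<mu>0 (i - ?m)) / s" for i
  \<comment> \<open>The dual objective, with the loads for the row multipliers and
    \<open>- R\<close> for the box multipliers. Its coefficients may be arbitrary reals.\<close>
  define f where "f i = (if i < ?m then ?t i else - real R)" for i
  have row: "holds N (row j) y \<longleftrightarrow> 0 \<le> (\<Sum>i<?m. y i * a (ix_W d i j)) + y (?m + j)" if j: "j < ?n" for j y
  proof -
    have "(\<Sum>i<N. of_int (fst (row j) i) * y i) =
        (\<Sum>i<?m. - (of_int (c (ix_W d i j)) * y i)) + (\<Sum>k<?n. if k = j then - (real D * y (?m + k)) else 0)"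
      unfolding N_def sum_split row_def by (intro arg_cong2[where f = "(+)"] sum.cong) auto
    also have "\<dots> = (\<Sum>i<?m. - (a (ix_W d i j) * real D * y i)) - real D * y (?m + j)"
      using j by (simp add: c_eq ix_less)
    also have "\<dots> = - real D * ((\<Sum>i<?m. y i * a (ix_W d i j)) + y (?m + j))"
      by (simp add: algebra_simps sum_negf sum_distrib_left)
    finally show ?thesis unfolding holds_def using D_pos by (simp add: row_def zero_le_mult_iff mult_le_0_iff)
  qed
  have Z1: "1 \<le> (2 :: int) ^ (2 * L)" by simp
  have DZ: "int D \<le> 2 ^ (2 * L)"
  proof -
    have "int D \<le> 2 ^ L" using D_le by (metis of_nat_le_iff of_nat_numeral of_nat_power)
    also have "\<dots> \<le> 2 ^ (2 * L)" by (intro power_increasing) auto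
    finally show ?thesis .
  qed
  have "\<exists>(p :: nat \<Rightarrow> nat) q. 0 < q \<and> q \<le> fact N * (2 ^ (2 * L)) ^ N \<and> (\<forall>i<N. p i \<le> fact N * (2 ^ (2 * L)) ^ N) \<and>
     (\<forall>s\<in>S. holds N s (\<lambda>i. real (p i) / real q)) \<and> dotp N f v \<le> dotp N f (\<lambda>i. real (p i) / real q)"
  proof (rule small_vertex)
    show "\<bar>fst s i\<bar> \<le> int (2 ^ (2 * L))" if "s \<in> S" "i < N" for s i
      using that Z1 DZ c_le ix_less(4) D_pos by (auto simp: S_def lower_bound_def upper_bound_def row_def)
    show "fst s i = 0" if "s \<in> S" "N \<le> i" for s i
      using that by (auto simp: S_def lower_bound_def upper_bound_def row_def N_def)
    show "\<bar>snd s\<bar> \<le> int (2 ^ (2 * L))" if "s \<in> S" for s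
      using that Z1 by (auto simp: S_def lower_bound_def upper_bound_def row_def)
    show "0 \<le> y i \<and> y i \<le> 1" if "\<And>s. s \<in> S \<Longrightarrow> holds N s y" "i < N" for y i
      using that(1)[of "lower_bound i"] that(1)[of "upper_bound 1 i"] that(2) by (auto simp: S_def holds_bounds)
    show "holds N s' v" if s': "s' \<in> S" for s'
    proof -
      consider k where "k < N" "s' = lower_bound k" | k where "k < N" "s' = upper_bound 1 k" | j where "j < ?n" "s' = row j"
        using s' unfolding S_def by blast
      then show ?thesis
      proof cases
        case 1
        then show ?thesis using l0 s0 by (simp add: holds_bounds v_def)
      next
        case 2
        then show ?thesis using sl s\<mu> s0 by (simp add: holds_bounds v_def N_def)
      next
        case 3
        have "(\<Sum>i<?m. v i * a (ix_W d i j)) + v (?m + j) = ((\<Sum>i<?m. l0 i * a (ix_W d i j)) + \<mu>0 j) / s"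
          by (simp add: v_def add_divide_distrib sum_divide_distrib)
        then show ?thesis using 3 l0(3) s0 by (simp add: row)
      qed
    qed
  qed
  then obtain p :: "nat \<Rightarrow> nat" and q where pq: "0 < q" "\<And>i. i < N \<Longrightarrow> p i \<le> fact N * (2 ^ (2 * L)) ^ N"
    "\<And>s. s \<in> S \<Longrightarrow> holds N s (\<lambda>i. real (p i) / real q)" "dotp N f v \<le> dotp N f (\<lambda>i. real (p i) / real q)" by blast
  have val: "dotp N f (\<lambda>i. g i / b) = ((\<Sum>i<?m. g i * ?t i) - real R * (\<Sum>j<?n. g (?m + j))) / b" for g b
    unfolding N_def sum_split f_def
    by (simp add: diff_divide_distrib sum_divide_distrib sum_distrib_left sum_negf mult.commute)
  have "dotp N f v = ((\<Sum>i<?m. l0 i * ?t i) - real R * (\<Sum>j<?n. \<mu>0 j)) / s"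
    using val[of "\<lambda>i. if i < ?m then l0 i else \<mu>0 (i - ?m)" s] unfolding v_def by simp
  then have "0 < dotp N f v" using l0(4) s0 by simp
  then have "0 < ((\<Sum>i<?m. real (p i) * ?t i) - real R * (\<Sum>j<?n. real (p (?m + j)))) / real q"
    using pq(4) unfolding val by linarith
  then have lt: "real R * (\<Sum>j<?n. real (p (?m + j))) < (\<Sum>i<?m. real (p i) * ?t i)"
    using pq(1) by (simp add: zero_less_divide_iff)
  have cert: "certificate d a p (\<lambda>j. real (p (?m + j)))"
    unfolding certificate_def
  proof (intro allI impI)
    fix j assume j: "j < ?n"
    then have "holds N (row j) (\<lambda>i. real (p i) / real q)" using pq(3) by (auto simp: S_def)
    then have "0 \<le> ((\<Sum>i<?m. real (p i) * a (ix_W d i j)) + real (p (?m + j))) / real q"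
      unfolding row[OF j] by (simp add: add_divide_distrib sum_divide_distrib)
    then show "0 \<le> (\<Sum>i<?m. real (p i) * a (ix_W d i j)) + real (p (?m + j))"
      using pq(1) by (simp add: zero_le_divide_iff)
  qed
  have "p i \<le> 2 ^ (3 * L * L)" if "i < N" for i
  proof -
    have "fact N * (2 ^ (2 * L)) ^ N \<le> (2 :: nat) ^ (L * L + 2 * L * L)"
      by (rule fact_mult_power_le) (use dims_le in \<open>simp add: N_def\<close>)
    moreover have "L * L + 2 * L * L = 3 * L * L" by simp
    ultimately show ?thesis using pq(2)[OF that] by (metis order_trans)
  qed
  then show ?thesis using cert lt
    by (intro exI[of _ p] exI[of _ "\<lambda>j. p (?m + j)"]) (simp add: N_def)
qed

end


lemma sum_abs_bound:
  fixes g :: "nat \<Rightarrow> int"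
  assumes "\<And>i. i < n \<Longrightarrow> \<bar>g i\<bar> \<le> B" "n \<le> 2 ^ e" "0 \<le> B"
  shows "\<bar>\<Sum>i<n. g i\<bar> \<le> 2 ^ e * B"
proof -
  have "\<bar>\<Sum>i<n. g i\<bar> \<le> (\<Sum>i<n. \<bar>g i\<bar>)" by (rule sum_abs)
  also have "\<dots> \<le> (\<Sum>i<n. B)" using assms(1) by (intro sum_mono) auto
  also have "\<dots> = int n * B" by simp
  also have "\<dots> \<le> 2 ^ e * B"
  proof (rule mult_right_mono[OF _ assms(3)])
    have "int n \<le> int (2 ^ e)" using assms(2) by (simp only: of_nat_le_iff)
    then show "int n \<le> 2 ^ e" by simp
  qed
  finally show ?thesis .
qed

lemma abs_mult_nat_le:
  fixes x :: int
  assumes "\<bar>x\<bar> \<le> 2 ^ e" "n \<le> 2 ^ f"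
  shows "\<bar>x * int n\<bar> \<le> 2 ^ (e + f)" "\<bar>int n * x\<bar> \<le> 2 ^ (e + f)"
proof -
  have "int n \<le> int (2 ^ f)" using assms(2) by (simp only: of_nat_le_iff)
  then have "\<bar>x\<bar> * int n \<le> 2 ^ e * 2 ^ f" using assms(1) by (intro mult_mono) auto
  then show "\<bar>x * int n\<bar> \<le> 2 ^ (e + f)" "\<bar>int n * x\<bar> \<le> 2 ^ (e + f)"
    by (simp_all add: abs_mult power_add mult.commute)
qed

context small_instance
begin

text \<open>The strict inequalities of \<open>x\<close>, which say that a scenario is not available, become weak ones by
  means of a slack variable, which a vertex with large last coordinate keeps positive.\<close>

lemma small_first_stage:
  assumes x0: "solves d R a x0"
  shows "\<exists>(p :: nat \<Rightarrow> nat) q. 0 < q \<and> q \<le> 2 ^ (10 * L * L * L) \<and> (\<forall>k<d 0. p k \<le> 2 ^ (10 * L * L * L)) \<and>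
     solves d R a (\<lambda>k. real (p k) / real q)"
proof -
  let ?n = "d 0"
  define N where "N = ?n + 1"
  define rowA where "rowA i = (\<lambda>j. if j < ?n then c (ix_A d i j) else 0, c i)" for i
  \<comment> \<open>Row \<open>i\<close> of \<open>B(x) u \<le> b\<close> fails for \<open>u\<close>
    with a margin that is, after multiplication by \<open>D\<close>, at least the slack variable
    with index \<open>?n\<close>.\<close>
  define rowB where "rowB u i = (\<lambda>k. if k < ?n then - (\<Sum>j<d 1. c (ix_B d k i j) * int (u j)) else if k = ?n then 1 else 0,
      - c (d 3 + i))" for u :: "nat \<Rightarrow> nat" and i
  \<comment> \<open>The dual inequality for the scenario \<open>u\<close> and fixed multipliers,
    read as an inequality in \<open>x\<close>.\<close>
  define rowT where "rowT u l \<mu> = (\<lambda>j. if j < ?n then \<Sum>i<d 5. int (l i) * (\<Sum>k<d 1. c (ix_T d k i j) * int (u k)) else 0,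
      int D * int R * (\<Sum>j<d 2. int (\<mu> j)))" for u l \<mu> :: "nat \<Rightarrow> nat"
  define inU where "inU u \<longleftrightarrow> (\<forall>k<d 1. u k \<le> R)" for u :: "nat \<Rightarrow> nat"
  define viol where "viol x u i \<longleftrightarrow> a (d 3 + i) < (\<Sum>j<d 1. \<Sum>k<?n. a (ix_B d k i j) * x k * real (u j))"
    for x :: "nat \<Rightarrow> real" and u :: "nat \<Rightarrow> nat" and i
  define small where "small l \<mu> \<longleftrightarrow> (\<forall>i<d 5. l i \<le> 2 ^ (3 * L * L)) \<and> (\<forall>j<d 2. \<mu> j \<le> 2 ^ (3 * L * L)) \<and>
      certificate d a (\<lambda>i. real (l i)) (\<lambda>j. real (\<mu> j))" for l \<mu> :: "nat \<Rightarrow> nat"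
  \<comment> \<open>The rows \<open>rowT\<close> guarantee recourse for the scenarios available at
    \<open>x0\<close>. Availability itself is not enforced for them, as losing an available scenario
    at the new point only makes the requirement weaker.\<close>
  define S1 where "S1 = lower_bound ` {..<N} \<union> upper_bound (int R) ` {..<?n} \<union> {upper_bound 1 ?n} \<union> rowA ` {..<d 3} \<union>
      {rowT u l \<mu> | u l \<mu>. scenario d R a x0 u \<and> small l \<mu>}"
  define S2 where "S2 = {rowB u i | u i. inU u \<and> i < d 4 \<and> viol x0 u i}"
  define S where "S = S1 \<union> S2"
  have scen: "scenario d R a x u \<longleftrightarrow> inU u \<and> (\<forall>i<d 4. \<not> viol x u i)" for x u
    by (auto simp: scenario_def inU_def viol_def not_less)

  have hA: "holds N (rowA i) y \<longleftrightarrow> (\<Sum>j<?n. a (ix_A d i j) * y j) \<le> a i" if i: "i < d 3" for i y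
  proof -
    have "(\<Sum>j<N. of_int (fst (rowA i) j) * y j) = (\<Sum>j<?n. a (ix_A d i j) * real D * y j)"
      unfolding N_def rowA_def using i by (simp add: c_eq ix_less)
    also have "\<dots> = real D * (\<Sum>j<?n. a (ix_A d i j) * y j)" by (simp add: sum_distrib_left mult_ac)
    finally show ?thesis unfolding holds_def using D_pos i by (simp add: rowA_def c_eq ix_less mult.commute)
  qed
  have hB: "holds N (rowB u i) y \<longleftrightarrow> y ?n \<le> real D * ((\<Sum>j<d 1. \<Sum>k<?n. a (ix_B d k i j) * y k * real (u j)) - a (d 3 + i))"
    if i: "i < d 4" for u i y
  proof -
    have "(\<Sum>k<N. of_int (fst (rowB u i) k) * y k) =
        (\<Sum>k<?n. - ((\<Sum>j<d 1. of_int (c (ix_B d k i j)) * real (u j)) * y k)) + y ?n"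
      unfolding N_def rowB_def by simp
    also have "(\<Sum>k<?n. - ((\<Sum>j<d 1. of_int (c (ix_B d k i j)) * real (u j)) * y k)) =
        (\<Sum>k<?n. - ((\<Sum>j<d 1. a (ix_B d k i j) * real D * real (u j)) * y k))"
      using i by (intro sum.cong) (auto simp: c_eq ix_less)
    also have "\<dots> = - real D * (\<Sum>k<?n. \<Sum>j<d 1. a (ix_B d k i j) * y k * real (u j))"
      by (simp add: sum_negf sum_distrib_left sum_distrib_right mult_ac)
    also have "(\<Sum>k<?n. \<Sum>j<d 1. a (ix_B d k i j) * y k * real (u j)) = (\<Sum>j<d 1. \<Sum>k<?n. a (ix_B d k i j) * y k * real (u j))"
      by (rule sum.swap)
    finally have eq: "(\<Sum>k<N. of_int (fst (rowB u i) k) * y k) =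
        - real D * (\<Sum>j<d 1. \<Sum>k<?n. a (ix_B d k i j) * y k * real (u j)) + y ?n" .
    have "of_int (snd (rowB u i)) = - (real D * a (d 3 + i))" using i by (simp add: rowB_def c_eq ix_less)
    then show ?thesis unfolding holds_def eq by (simp only: right_diff_distrib mult_minus_left) auto
  qed
  have hT: "holds N (rowT u l \<mu>) y \<longleftrightarrow> (\<Sum>i<d 5. real (l i) * load d a y u i) \<le> real R * (\<Sum>j<d 2. real (\<mu> j))" for u l \<mu> y
  proof -
    have "(\<Sum>j<N. of_int (fst (rowT u l \<mu>) j) * y j) =
        (\<Sum>j<?n. (\<Sum>i<d 5. real (l i) * (\<Sum>k<d 1. of_int (c (ix_T d k i j)) * real (u k))) * y j)"
      unfolding N_def rowT_def by simp
    also have "\<dots> = (\<Sum>j<?n. (\<Sum>i<d 5. real (l i) * (\<Sum>k<d 1. a (ix_T d k i j) * real D * real (u k))) * y j)"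
      by (intro sum.cong refl arg_cong2[where f = "(*)"]) (auto simp: c_eq ix_less)
    also have "\<dots> = (\<Sum>j<?n. \<Sum>i<d 5. real D * (real (l i) * (\<Sum>k<d 1. a (ix_T d k i j) * real (u k) * y j)))"
      by (simp add: sum_distrib_left sum_distrib_right mult_ac)
    also have "\<dots> = (\<Sum>i<d 5. \<Sum>j<?n. real D * (real (l i) * (\<Sum>k<d 1. a (ix_T d k i j) * real (u k) * y j)))"
      by (rule sum.swap)
    also have "\<dots> = real D * (\<Sum>i<d 5. real (l i) * load d a y u i)"
      by (simp add: load_def sum_distrib_left)
    finally show ?thesis unfolding holds_def using D_pos by (simp add: rowT_def mult.assoc)
  qed

  have LE: "L \<le> 2 ^ L" by (simp add: less_imp_le)
  have L1: "1 \<le> L" using dims_le(1) by simp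
  have nL: "d 1 \<le> 2 ^ L" "d 5 \<le> 2 ^ L" "d 2 \<le> 2 ^ L" using dims_le LE by linarith+
  have LL: "L \<le> L * L" using L1 by simp
  \<comment> \<open>The largest exponent in the estimates below is \<open>5 * L + 3 * L * L\<close>,
    for the coefficients of \<open>rowT\<close>; here \<open>L \<le> L * L\<close>.\<close>
  let ?M = "2 ^ (9 * L * L) :: nat"
  have L9: "9 * L \<le> 9 * L * L" using LL by simp
  have pown: "2 ^ e \<le> ?M" if "e \<le> 9 * L * L" for e using that by (intro power_increasing) auto
  have pow: "(2 :: int) ^ e \<le> int ?M" if "e \<le> 9 * L * L" for e
    using power_increasing[OF that, of "2 :: int"] by simp
  have M1: "1 \<le> int ?M" using pow[of 0] by simp
  have "R \<le> ?M" by (rule order_trans[OF R_le pown]) (use L9 in linarith)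
  then have MR: "int R \<le> int ?M" by (simp only: of_nat_le_iff)
  have Mc: "\<bar>c j\<bar> \<le> int ?M" if "j < entries d" for j
    by (rule order_trans[OF c_le[OF that] pow]) (use L9 in linarith)
  have bB: "\<bar>fst (rowB u i) k\<bar> \<le> int ?M" if u: "inU u" and i: "i < d 4" for u i k
  proof (cases "k < ?n")
    case True
    have "\<bar>\<Sum>j<d 1. c (ix_B d k i j) * int (u j)\<bar> \<le> 2 ^ L * 2 ^ (2 * L + L)"
    proof (rule sum_abs_bound[OF _ nL(1)])
      fix j assume j: "j < d 1"
      have "u j \<le> 2 ^ L" using u j R_le by (auto simp: inU_def intro: order_trans)
      then show "\<bar>c (ix_B d k i j) * int (u j)\<bar> \<le> 2 ^ (2 * L + L)"
        using c_le[OF ix_less(5)[OF True i j]] by (rule abs_mult_nat_le(1)[rotated])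
    qed simp
    also have "\<dots> \<le> int ?M" unfolding power_add[symmetric] using LL by (intro pow) linarith
    finally show ?thesis using True by (simp add: rowB_def)
  next
    case False
    then show ?thesis using M1 by (simp add: rowB_def)
  qed
  have bT: "\<bar>fst (rowT u l \<mu>) j\<bar> \<le> int ?M" "\<bar>snd (rowT u l \<mu>)\<bar> \<le> int ?M"
    if u: "inU u" and s: "small l \<mu>" for u l \<mu> j
  proof -
    show "\<bar>fst (rowT u l \<mu>) j\<bar> \<le> int ?M"
    proof (cases "j < ?n")
      case True
      have 1: "\<bar>\<Sum>k<d 1. c (ix_T d k i j) * int (u k)\<bar> \<le> 2 ^ (L + (2 * L + L))" if i: "i < d 5" for i
        unfolding power_add[of _ L "2 * L + L"]
      proof (rule sum_abs_bound[OF _ nL(1)])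
        fix k assume k: "k < d 1"
        have "u k \<le> 2 ^ L" using u k R_le by (auto simp: inU_def intro: order_trans)
        then show "\<bar>c (ix_T d k i j) * int (u k)\<bar> \<le> 2 ^ (2 * L + L)"
          using c_le[OF ix_less(6)[OF k i True]] by (rule abs_mult_nat_le(1)[rotated])
      qed simp
      have "\<bar>\<Sum>i<d 5. int (l i) * (\<Sum>k<d 1. c (ix_T d k i j) * int (u k))\<bar> \<le> 2 ^ L * 2 ^ (L + (2 * L + L) + 3 * L * L)"
        using s 1 by (intro sum_abs_bound[OF _ nL(2)] abs_mult_nat_le(2)) (auto simp: small_def)
      also have "\<dots> \<le> int ?M" unfolding power_add[symmetric] using LL by (intro pow) (simp add: mult.assoc)
      finally show ?thesis using True by (simp add: rowT_def)
    qed (use M1 in \<open>simp add: rowT_def\<close>)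
    have "\<bar>\<Sum>j<d 2. int (\<mu> j)\<bar> \<le> 2 ^ L * 2 ^ (3 * L * L)"
    proof (rule sum_abs_bound[OF _ nL(3)])
      fix j assume "j < d 2"
      then have "int (\<mu> j) \<le> int (2 ^ (3 * L * L))" using s by (simp only: small_def of_nat_le_iff)
      then show "\<bar>int (\<mu> j)\<bar> \<le> 2 ^ (3 * L * L)" by simp
    qed simp
    then have "\<bar>\<Sum>j<d 2. int (\<mu> j)\<bar> \<le> 2 ^ (L + 3 * L * L)" by (simp add: power_add)
    from abs_mult_nat_le(2)[OF this R_le]
    have "\<bar>int R * (\<Sum>j<d 2. int (\<mu> j))\<bar> \<le> 2 ^ (L + 3 * L * L + L)" .
    from abs_mult_nat_le(2)[OF this D_le]
    have "\<bar>int D * (int R * (\<Sum>j<d 2. int (\<mu> j)))\<bar> \<le> 2 ^ (L + 3 * L * L + L + L)" .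
    also have "\<dots> \<le> int ?M" using LL by (intro pow) (simp add: mult.assoc)
    finally show "\<bar>snd (rowT u l \<mu>)\<bar> \<le> int ?M" by (simp add: rowT_def mult.assoc)
  qed
  have kinds: "(\<exists>k<N. s = lower_bound k) \<or> (\<exists>k<?n. s = upper_bound (int R) k) \<or> s = upper_bound 1 ?n \<or> (\<exists>i<d 3. s = rowA i) \<or>
      (\<exists>u l \<mu>. s = rowT u l \<mu> \<and> scenario d R a x0 u \<and> small l \<mu>) \<or>
      (\<exists>u i. s = rowB u i \<and> inU u \<and> i < d 4 \<and> viol x0 u i)" if "s \<in> S" for s
    using that unfolding S_def S1_def S2_def by blast
  have cS: "\<bar>fst s i\<bar> \<le> int ?M" "N \<le> i \<Longrightarrow> fst s i = 0" "\<bar>snd s\<bar> \<le> int ?M" if s: "s \<in> S" for s i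
  proof -
    have "\<bar>fst s i\<bar> \<le> int ?M \<and> (N \<le> i \<longrightarrow> fst s i = 0) \<and> \<bar>snd s\<bar> \<le> int ?M"
      using kinds[OF s]
    proof (elim disjE exE conjE)
      fix j assume "j < d 3" "s = rowA j"
      then show ?thesis using Mc ix_less(1,3) by (auto simp: rowA_def N_def)
    next
      fix u l \<mu> assume "s = rowT u l \<mu>" "scenario d R a x0 u" "small l \<mu>"
      then show ?thesis using bT scen by (auto simp: rowT_def N_def)
    next
      fix u j assume "s = rowB u j" "inU u" "j < d 4"
      then show ?thesis using bB Mc ix_less(2) by (auto simp: rowB_def N_def)
    qed (use M1 MR in \<open>auto simp: lower_bound_def upper_bound_def N_def\<close>)
    then show "\<bar>fst s i\<bar> \<le> int ?M" "N \<le> i \<Longrightarrow> fst s i = 0" "\<bar>snd s\<bar> \<le> int ?M" by auto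
  qed
  have finS: "finite S"
  proof (rule finite_bounded_constraints)
    show "\<bar>fst s i\<bar> \<le> int ?M" if "s \<in> S" for s i by (rule cS(1)[OF that])
    show "fst s i = 0" if "s \<in> S" "N \<le> i" for s i by (rule cS(2)[OF that])
    show "\<bar>snd s\<bar> \<le> int ?M" if "s \<in> S" for s by (rule cS(3)[OF that])
  qed

  let ?slack = "\<lambda>s. of_int (snd s) - (\<Sum>k<?n. of_int (fst s k) * x0 k) :: real"
  \<comment> \<open>A minimum over finitely many positive slacks is positive. The 1 covers the case
    of no violated row and respects the upper bound of the slack variable.\<close>
  define e where "e = Min (insert 1 (?slack ` S2))"
  have finS2: "finite S2" using finS by (simp add: S_def)
  have slack: "?slack (rowB u i) = real D * ((\<Sum>j<d 1. \<Sum>k<?n. a (ix_B d k i j) * x0 k * real (u j)) - a (d 3 + i))"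
    if "i < d 4" for u i
  proof -
    let ?t = "?slack (rowB u i)" and ?r = "real D * ((\<Sum>j<d 1. \<Sum>k<?n. a (ix_B d k i j) * x0 k * real (u j)) - a (d 3 + i))"
    \<comment> \<open>Both expressions are the largest value of the slack variable that satisfies
      the row at \<open>x0\<close>; having the same lower bounds, they are equal.\<close>
    have "y \<le> ?t \<longleftrightarrow> y \<le> ?r" for y
    proof -
      have "y \<le> ?t \<longleftrightarrow> holds N (rowB u i) (x0(?n := y))"
        unfolding holds_def N_def by (simp add: rowB_def algebra_simps)
      also have "\<dots> \<longleftrightarrow> y \<le> ?r" unfolding hB[OF that] by simp
      finally show ?thesis .
    qed
    then show ?thesis by (meson order_antisym order_refl)
  qed
  have e_pos: "0 < e"
  proof -
    have "0 < ?slack s" if sS: "s \<in> S2" for s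
    proof -
      obtain u i where s: "s = rowB u i" "i < d 4" "viol x0 u i" using sS unfolding S2_def by blast
      have "0 < (\<Sum>j<d 1. \<Sum>k<?n. a (ix_B d k i j) * x0 k * real (u j)) - a (d 3 + i)" using s(3) by (simp add: viol_def)
      then show ?thesis unfolding s(1) slack[OF s(2)] using D_pos by (intro mult_pos_pos) auto
    qed
    then show ?thesis unfolding e_def using finS2 by (subst Min_gr_iff) auto
  qed
  have e_le: "e \<le> 1" "\<And>s. s \<in> S2 \<Longrightarrow> e \<le> ?slack s" unfolding e_def using finS2 by (auto intro!: Min_le)
  define x1 where "x1 = x0(?n := e)"
  have x1: "x1 k = x0 k" if "k < ?n" for k using that by (simp add: x1_def)
  have x0X: "stage_X d R a x0" and x0R: "\<And>u. scenario d R a x0 u \<Longrightarrow> recourse d R a x0 u"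
    using x0 by (auto simp: solves_def)
  have loadx1: "load d a x1 u i = load d a x0 u i" for u i
    unfolding load_def by (intro sum.cong) (auto simp: x1)
  have feas: "holds N s x1" if "s \<in> S" for s
    using kinds[OF that]
  proof (elim disjE exE conjE)
    fix k assume "k < N" "s = lower_bound k"
    then show ?thesis using x0X e_pos by (cases "k = ?n") (auto simp: holds_bounds x1_def N_def stage_X_def)
  next
    fix k assume "k < ?n" "s = upper_bound (int R) k"
    then show ?thesis using x0X by (auto simp: holds_bounds x1_def N_def stage_X_def)
  next
    assume "s = upper_bound 1 ?n"
    then show ?thesis using e_le(1) by (auto simp: holds_bounds x1_def N_def)
  next
    fix i assume "i < d 3" "s = rowA i"
    then show ?thesis using x0X by (simp add: hA x1 stage_X_def)
  next
    fix u l \<mu> assume s: "s = rowT u l \<mu>" "scenario d R a x0 u" "small l \<mu>"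
    show ?thesis unfolding s(1) hT loadx1
      by (rule weak_duality[OF x0R[OF s(2)]]) (use s(3) in \<open>simp_all add: small_def\<close>)
  next
    fix u i assume s: "s = rowB u i" "inU u" "i < d 4" "viol x0 u i"
    then have "e \<le> ?slack s" by (intro e_le) (auto simp: S2_def)
    then show ?thesis unfolding s(1) slack[OF s(3)] hB[OF s(3)] by (simp add: x1_def)
  qed
  let ?f = "\<lambda>i. if i = ?n then 1 else 0 :: real"
  have f: "dotp N ?f y = y ?n" for y by (simp add: N_def)
  have "\<exists>(p :: nat \<Rightarrow> nat) q. 0 < q \<and> q \<le> fact N * ?M ^ N \<and> (\<forall>i<N. p i \<le> fact N * ?M ^ N) \<and>
     (\<forall>s\<in>S. holds N s (\<lambda>i. real (p i) / real q)) \<and> dotp N ?f x1 \<le> dotp N ?f (\<lambda>i. real (p i) / real q)"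
  proof (rule small_vertex)
    show "\<bar>fst s i\<bar> \<le> int ?M" if "s \<in> S" "i < N" for s i by (rule cS(1)[OF that(1)])
    show "fst s i = 0" if "s \<in> S" "N \<le> i" for s i by (rule cS(2)[OF that])
    show "\<bar>snd s\<bar> \<le> int ?M" if "s \<in> S" for s by (rule cS(3)[OF that])
    show "0 \<le> y i \<and> y i \<le> real R + 1" if y: "\<And>s. s \<in> S \<Longrightarrow> holds N s y" and i: "i < N" for y i
    proof -
      have "holds N (lower_bound i) y" using i by (intro y) (auto simp: S_def S1_def)
      moreover have "holds N (if i < ?n then upper_bound (int R) i else upper_bound 1 ?n) y"
        using i by (intro y) (auto simp: S_def S1_def)
      ultimately show ?thesis using i by (auto simp: holds_bounds N_def less_Suc_eq split: if_splits)
    qed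
    show "holds N s x1" if "s \<in> S" for s by (rule feas[OF that])
  qed
  then obtain p :: "nat \<Rightarrow> nat" and q where pq: "0 < q" "q \<le> fact N * ?M ^ N" "\<And>i. i < N \<Longrightarrow> p i \<le> fact N * ?M ^ N"
    "\<And>s. s \<in> S \<Longrightarrow> holds N s (\<lambda>i. real (p i) / real q)" "x1 ?n \<le> real (p ?n) / real q"
    unfolding f by blast
  let ?x = "\<lambda>i. real (p i) / real q"
  have e': "0 < ?x ?n" using pq(5) e_pos by (simp add: x1_def)
  have X: "stage_X d R a ?x"
    unfolding stage_X_def
  proof (intro conjI allI impI)
    fix k assume k: "k < ?n"
    show "0 \<le> ?x k" by simp
    have "holds N (upper_bound (int R) k) ?x" using k by (intro pq(4)) (auto simp: S_def S1_def)
    then show "?x k \<le> real R" using k by (simp add: holds_bounds N_def)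
  next
    fix i assume i: "i < d 3"
    have "holds N (rowA i) ?x" using i by (intro pq(4)) (auto simp: S_def S1_def)
    then show "(\<Sum>j<d 0. a (ix_A d i j) * ?x j) \<le> a i" unfolding hA[OF i] .
  qed
  have "recourse d R a ?x u" if sc: "scenario d R a ?x u" for u
  proof (rule ccontr)
    assume nr: "\<not> recourse d R a ?x u"
    have u: "inU u" using sc scen by blast
    \<comment> \<open>No scenario becomes available by passing to the new point: a row violated at
      \<open>x0\<close> stays violated because the slack variable is positive.\<close>
    have sc0: "scenario d R a x0 u"
    proof (rule ccontr)
      assume "\<not> scenario d R a x0 u"
      then obtain i where i: "i < d 4" "viol x0 u i" using scen u by blast
      then have "holds N (rowB u i) ?x" using u by (intro pq(4)) (auto simp: S_def S2_def)
      then have "0 < real D * ((\<Sum>j<d 1. \<Sum>k<?n. a (ix_B d k i j) * ?x k * real (u j)) - a (d 3 + i))"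
        unfolding hB[OF i(1)] using e' by linarith
      then have "viol ?x u i" using D_pos by (simp add: viol_def zero_less_mult_iff)
      then show False using sc scen i(1) by blast
    qed
    obtain l \<mu> :: "nat \<Rightarrow> nat" where l: "small l \<mu>"
      "real R * (\<Sum>j<d 2. real (\<mu> j)) < (\<Sum>i<d 5. real (l i) * load d a ?x u i)"
      using small_certificate[OF nr] unfolding small_def by blast
    have "holds N (rowT u l \<mu>) ?x" using sc0 l(1) by (intro pq(4)) (auto simp: S_def S1_def)
    then show False using l(2) unfolding hT by simp
  qed
  then have sol: "solves d R a ?x" using X by (simp add: solves_def)
  \<comment> \<open>\<open>L * L\<close> stems from the factorial and \<open>9 * L * L * L\<close>
    from at most \<open>L\<close> factors \<open>?M\<close>.\<close>
  have "fact N * ?M ^ N \<le> 2 ^ (L * L + 9 * L * L * L)"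
    by (rule fact_mult_power_le) (use dims_le in \<open>simp add: N_def\<close>)
  also have "\<dots> \<le> 2 ^ (10 * L * L * L)"
  proof (rule power_increasing)
    have "L * L * 1 \<le> L * L * L" using L1 by (intro mult_le_mono) auto
    then show "L * L + 9 * L * L * L \<le> 10 * L * L * L" by simp
  qed simp
  finally have B: "fact N * ?M ^ N \<le> 2 ^ (10 * L * L * L)" .
  have "q \<le> 2 ^ (10 * L * L * L)" using pq(2) B by (rule order_trans)
  moreover have "p k \<le> 2 ^ (10 * L * L * L)" if "k < ?n" for k
    using order_trans[OF pq(3) B] that by (simp add: N_def)
  ultimately show ?thesis using sol pq(1) by (intro exI[of _ p] exI[of _ q]) simp
qed

end


section \<open>Correctness of the verifier\<close>

lemma bits_sum: "(\<Sum>s<b. of_bool (odd (n div 2 ^ s)) * 2 ^ s) = n mod 2 ^ b" for n :: nat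
proof (induction b)
  case (Suc b)
  have "(\<Sum>s<Suc b. of_bool (odd (n div 2 ^ s)) * 2 ^ s) = n mod 2 ^ b + of_bool (odd (n div 2 ^ b)) * 2 ^ b"
    by (simp only: sum.lessThan_Suc Suc)
  also have "\<dots> = n mod (2 ^ b * 2)" unfolding mod_mult2_eq by (simp add: mod_2_eq_odd mult.commute)
  finally show ?case by (simp add: mult.commute)
qed simp

definition pack :: "nat \<Rightarrow> nat \<Rightarrow> (nat \<Rightarrow> nat) \<Rightarrow> bool list" where
  "pack b K v = map (\<lambda>i. odd (v (i mod K) div 2 ^ (i div K))) [0..<b * K]"

lemma length_pack: "length (pack b K v) = b * K"
  by (simp add: pack_def)

lemma unpack_pack:
  assumes k: "k < K" and v: "v k < 2 ^ b"
  shows "unpack (pack b K v) K k = v k"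
proof -
  have idx: "s * K + k < b * K \<longleftrightarrow> s < b" for s
  proof
    assume "s * K + k < b * K"
    then have "s * K < b * K" by linarith
    then show "s < b" by simp
  next
    assume "s < b"
    then show "s * K + k < b * K" using k by (rule block_index)
  qed
  have bit: "bit (pack b K v) (s * K + k) \<longleftrightarrow> s < b \<and> odd (v k div 2 ^ s)" for s
    using idx[of s] k block_div_mod[OF k, of s] by (auto simp: bit_def pack_def)
  \<comment> \<open>\<open>unpack\<close> sums over as many digits as the string has positions; the
    digits from \<open>b\<close> on are zero.\<close>
  have "b \<le> b * K" using k by simp
  then have "unpack (pack b K v) K k = (\<Sum>s<b. of_bool (s < b \<and> odd (v k div 2 ^ s)) * 2 ^ s)"
    unfolding unpack_def bit length_pack by (intro sum.mono_neutral_right) auto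
  also have "\<dots> = (\<Sum>s<b. of_bool (odd (v k div 2 ^ s)) * 2 ^ s)" by (intro sum.cong) auto
  also have "\<dots> = v k" using v by (simp add: bits_sum)
  finally show ?thesis .
qed

lemma sum_of_bool_power_less: "(\<Sum>s<n. of_bool (P s) * 2 ^ s) < (2 :: nat) ^ n"
  by (induction n) (auto simp del: sum_of_bool_mult_eq)

lemma nat_at_less: "nat_at I p < 2 ^ length I"
proof -
  have "nat_at I p < 2 ^ digits I p" unfolding nat_at_def by (rule sum_of_bool_power_less)
  also have "\<dots> \<le> 2 ^ length I" by (rule power_increasing[OF digits_le]) simp
  finally show ?thesis .
qed

lemma binary_digits_less: "n < 2 ^ length (binary_digits n)"
  using sum_of_bool_power_less[of "\<lambda>s. binary_digits n ! s" "length (binary_digits n)"]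
  unfolding bin_value_sum[symmetric] bin_value_digits .

lemma instance_of_cong:
  assumes d: "\<And>i. i < 6 \<Longrightarrow> d i = d' i" and r: "\<And>j. j < entries d \<Longrightarrow> r j = r' j"
  shows "instance_of d R r = instance_of d' R r'"
proof -
  have ix: "ix_A d = ix_A d'" "ix_W d = ix_W d'" "ix_B d = ix_B d'" "ix_T d = ix_T d'"
    by (auto simp: fun_eq_iff ix_defs off_A_def off_W_def off_B_def off_T_def d)
  note dd = d[of 0] d[of 1] d[of 2] d[of 3] d[of 4] d[of 5]
  have "instance_of d R r = instance_of d R r'"
    unfolding instance_of_def using r ix_less[where d = d] by (auto intro!: eq_vecI eq_matI)
  also have "\<dots> = instance_of d' R r'"
    using dd by (simp add: instance_of_def ix)
  finally show ?thesis .
qed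

lemma real_entry:
  assumes "0 < denom I j"
  shows "real_of_rat (entry I j) = (if bit I (entry_pos I j) then - real (numer I j) else real (numer I j)) / real (denom I j)"
  using assms by (simp add: entry_def Fract_of_int_quotient of_rat_divide of_rat_minus)

lemma length_encode_rat_entry:
  assumes "coprime (numer I j) (denom I j)" "0 < denom I j"
  shows "0 < length (encode_rat (entry I j))" "denom I j \<le> 2 ^ length (encode_rat (entry I j))"
proof -
  let ?n = "if bit I (entry_pos I j) then - int (numer I j) else int (numer I j)"
  have "quotient_of (entry I j) = (?n, int (denom I j))"
    using assms by (simp add: entry_def quotient_of_Fract normalize_stable)
  then have e: "encode_rat (entry I j) = encode_int ?n @ encode_nat (denom I j)" by (simp add: encode_rat_def)
  show "0 < length (encode_rat (entry I j))" by (simp add: e encode_nat_def)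
  have "denom I j \<le> 2 ^ length (binary_digits (denom I j))" using binary_digits_less[of "denom I j"] by simp
  also have "\<dots> \<le> 2 ^ length (encode_rat (entry I j))"
    by (intro power_increasing) (simp_all add: e encode_nat_spread length_spread)
  finally show "denom I j \<le> 2 ^ length (encode_rat (entry I j))" .
qed

text \<open>A common multiple that is easy to bound: a denominator is at most two to the length of
  its code, so the product does not exceed two to the length of a well-formed input in lowest
  terms.\<close>

definition prod_denom :: "bool list \<Rightarrow> nat" where
  "prod_denom I = (\<Prod>j<entries (dims I). denom I j)"

definition scaled_numer :: "bool list \<Rightarrow> nat \<Rightarrow> nat" where
  "scaled_numer I j = numer I j * (prod_denom I div denom I j)"

definition scaled_entry :: "bool list \<Rightarrow> nat \<Rightarrow> int" where
  "scaled_entry I j = (if bit I (entry_pos I j) then - int (scaled_numer I j) else int (scaled_numer I j))"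

abbreviation bound_of :: "bool list \<Rightarrow> nat" where
  "bound_of I \<equiv> nat_at I (dim_pos I 6)"

abbreviation real_entries :: "bool list \<Rightarrow> nat \<Rightarrow> real" where
  "real_entries I j \<equiv> real_of_rat (entry I j)"

lemma scaled_numer_denom:
  assumes "j < entries (dims I)"
  shows "scaled_numer I j * denom I j = numer I j * prod_denom I"
proof -
  have "denom I j dvd prod_denom I" unfolding prod_denom_def using assms by (intro dvd_prodI) auto
  then show ?thesis by (simp add: scaled_numer_def)
qed

lemma sum_list_map_upt: "sum_list (map f [0..<n]) = (\<Sum>i<n. f i)" for f :: "nat \<Rightarrow> nat"
  by (induction n) auto

lemma encoding_sizes:
  assumes wf: "well_formed I" and cop: "\<And>j. j < entries (dims I) \<Longrightarrow> coprime (numer I j) (denom I j)"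
  shows "dims I 0 + 1 + dims I 1 + dims I 5 + dims I 2 \<le> length I" "entries (dims I) \<le> length I"
    "0 < prod_denom I" "prod_denom I \<le> 2 ^ length I"
proof -
  let ?w = "\<lambda>j. length (encode_rat (entry I j))" and ?K = "entries (dims I)"
  note den = well_formed_denom_pos[OF wf]
  have len: "length I = (\<Sum>i<6. dims I i + 1) + length (encode_nat (bound_of I)) + (\<Sum>j<?K. ?w j)"
    by (subst well_formed_encoding[OF wf cop])
      (simp_all add: encoding_def length_concat o_def sum_list_map_upt encode_dim_def del: sum_list_Suc upt_Suc)
  have w: "(\<Sum>j<?K. ?w j) \<le> length I" and ds: "(\<Sum>i<6. dims I i + 1) \<le> length I" using len by linarith+
  show "dims I 0 + 1 + dims I 1 + dims I 5 + dims I 2 \<le> length I" using ds by (simp add: eval_nat_numeral)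
  have "?K = (\<Sum>j<?K. 1)" by simp
  also have "\<dots> \<le> (\<Sum>j<?K. ?w j)" using length_encode_rat_entry(1)[OF cop den] by (intro sum_mono) (simp add: Suc_le_eq)
  finally show "?K \<le> length I" using w by linarith
  show "0 < prod_denom I" unfolding prod_denom_def using den by (intro prod_pos) auto
  have "prod_denom I \<le> (\<Prod>j<?K. 2 ^ ?w j)"
    unfolding prod_denom_def using length_encode_rat_entry(2)[OF cop den] by (intro prod_mono) auto
  also have "\<dots> = 2 ^ (\<Sum>j<?K. ?w j)" by (simp add: power_sum)
  also have "\<dots> \<le> 2 ^ length I" using w by (intro power_increasing) auto
  finally show "prod_denom I \<le> 2 ^ length I" .
qed

lemma scaled_numer_le:
  assumes "prod_denom I \<le> 2 ^ length I"
  shows "scaled_numer I j \<le> 2 ^ (2 * length I)"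
proof -
  have "scaled_numer I j \<le> 2 ^ length I * 2 ^ length I"
    unfolding scaled_numer_def using nat_at_less[of I "entry_pos I j + 1"] assms
    by (intro mult_le_mono) (auto simp: numer_def intro: order_trans[OF div_le_dividend])
  then show ?thesis by (simp add: mult_2 power_add)
qed

lemma small_instance_encoding:
  assumes wf: "well_formed I" and cop: "\<And>j. j < entries (dims I) \<Longrightarrow> coprime (numer I j) (denom I j)"
  shows "small_instance (dims I) (bound_of I) (length I) (prod_denom I) (scaled_entry I) (real_entries I)"
proof
  note sz = encoding_sizes[OF wf cop]
  show "dims I 0 + 1 \<le> length I" "dims I 1 \<le> length I" "dims I 5 + dims I 2 \<le> length I" using sz(1) by linarith+
  show "bound_of I \<le> 2 ^ length I" using nat_at_less[of I "dim_pos I 6"] by simp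
  show "0 < prod_denom I" by (rule sz(3))
  show "prod_denom I \<le> 2 ^ length I" by (rule sz(4))
  fix j assume j: "j < entries (dims I)"
  have dj: "0 < denom I j" by (rule well_formed_denom_pos[OF wf j])
  have "real (scaled_numer I j * denom I j) = real (numer I j * prod_denom I)" using scaled_numer_denom[OF j] by simp
  then show "real_entries I j = of_int (scaled_entry I j) / of_nat (prod_denom I)"
    using dj sz(3) unfolding real_entry[OF dj] by (simp add: scaled_entry_def frac_eq_eq)
  have "int (scaled_numer I j) \<le> int (2 ^ (2 * length I))" using scaled_numer_le[OF sz(4)] by (simp only: of_nat_le_iff)
  then show "\<bar>scaled_entry I j\<bar> \<le> 2 ^ (2 * length I)" by (simp add: scaled_entry_def)
qed

text \<open>Encoding and parsing are inverse to each other on well-formed strings in lowest terms,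
  so the unknown instance can be replaced by the parsed one.\<close>

lemma Bounded_Two_Stage_iff:
  "I \<in> Bounded_Two_Stage \<longleftrightarrow> well_formed I \<and> (\<forall>j<entries (dims I). coprime (numer I j) (denom I j)) \<and>
     (\<exists>x. solves (dims I) (bound_of I) (real_entries I) x)"
proof
  assume "I \<in> Bounded_Two_Stage"
  then obtain J where J: "I = encode_two_stage J" "two_stage_instance J" "two_stage_yes J"
    by (auto simp: Bounded_Two_Stage_def)
  obtain d R r where dR: "J = instance_of d R r" using instance_of_exists[OF J(2)] by blast
  have I: "I = encoding d R (map r [0..<entries d])" using J(1) by (simp add: dR encode_instance_of)
  note dec = decode[OF I, simplified]
  have ent: "entries (dims I) = entries d" by (rule entries_cong) (rule dec(2))
  have "instance_of d R r = instance_of (dims I) R (entry I)"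
    by (rule instance_of_cong) (simp_all add: dec)
  then have "two_stage_yes (instance_of (dims I) (bound_of I) (entry I))" using J(3) dec(3) by (simp add: dR)
  then show "well_formed I \<and> (\<forall>j<entries (dims I). coprime (numer I j) (denom I j)) \<and>
     (\<exists>x. solves (dims I) (bound_of I) (real_entries I) x)"
    using dec(1,5) unfolding ent two_stage_yes_instance_of by blast
next
  assume *: "well_formed I \<and> (\<forall>j<entries (dims I). coprime (numer I j) (denom I j)) \<and>
     (\<exists>x. solves (dims I) (bound_of I) (real_entries I) x)"
  then have "I = encode_two_stage (instance_of (dims I) (bound_of I) (entry I))"
    unfolding encode_instance_of by (intro well_formed_encoding) auto
  moreover have "two_stage_yes (instance_of (dims I) (bound_of I) (entry I))"
    using * unfolding two_stage_yes_instance_of by blast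
  ultimately show "I \<in> Bounded_Two_Stage"
    unfolding Bounded_Two_Stage_def using two_stage_instance_of by blast
qed

section \<open>Clearing denominators in the tests of the verifier\<close>

context
  fixes d :: "nat \<Rightarrow> nat" and R D q :: nat and c :: "nat \<Rightarrow> int" and p :: "nat \<Rightarrow> nat" and a :: "nat \<Rightarrow> real"
  assumes a: "\<And>j. j < entries d \<Longrightarrow> a j = of_int (c j) / of_nat D" and D: "0 < D" and q: "0 < q"
begin

lemma scaled: "j < entries d \<Longrightarrow> of_int (c j) = a j * real D" "real (p k) = (real (p k) / real q) * real q"
  using a D q by simp_all

lemma first_stage_iff: "first_stage d R c q p \<longleftrightarrow> stage_X d R a (\<lambda>k. real (p k) / real q)"
proof -
  have "int (p k) \<le> int R * int q \<longleftrightarrow> real (p k) / real q \<le> real R" for k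
  proof -
    have "int (p k) \<le> int R * int q \<longleftrightarrow> real_of_int (int (p k)) \<le> real_of_int (int R * int q)" by (simp only: of_int_le_iff)
    also have "\<dots> \<longleftrightarrow> real (p k) / real q \<le> real R" using q by (simp add: pos_divide_le_eq)
    finally show ?thesis .
  qed
  moreover have "(\<Sum>j<d 0. c (ix_A d i j) * int (p j)) \<le> c i * int q \<longleftrightarrow>
      (\<Sum>j<d 0. a (ix_A d i j) * (real (p j) / real q)) \<le> a i" if i: "i < d 3" for i
  proof -
    have "(\<Sum>j<d 0. c (ix_A d i j) * int (p j)) \<le> c i * int q \<longleftrightarrow>
        real_of_int (\<Sum>j<d 0. c (ix_A d i j) * int (p j)) \<le> real_of_int (c i * int q)" by (simp only: of_int_le_iff)
    also have "real_of_int (\<Sum>j<d 0. c (ix_A d i j) * int (p j)) =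
        (\<Sum>j<d 0. (real D * real q) * (a (ix_A d i j) * (real (p j) / real q)))"
      using i q by (simp add: scaled(1) ix_less mult_ac)
    also have "\<dots> = (real D * real q) * (\<Sum>j<d 0. a (ix_A d i j) * (real (p j) / real q))"
      by (simp only: sum_distrib_left)
    also have "real_of_int (c i * int q) = (real D * real q) * a i"
      using i by (simp add: scaled(1) ix_less mult_ac)
    finally show ?thesis using D q by simp
  qed
  ultimately show ?thesis unfolding first_stage_def stage_X_def by simp
qed

text \<open>The inequalities with entries are multiplied by \<open>D\<close> or by \<open>D\<close>
  and \<open>q\<close>. The lemma admits any common denominator \<open>D\<close>, because the one
  supplied in \<open>X\<close> need not be the product of the denominators.\<close>

lemma refutes_iff:
  "refutes d R c D q p u l \<mu> \<longleftrightarrow> scenario d R a (\<lambda>k. real (p k) / real q) u \<and> certificate d a l \<mu> \<and>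
     real R * (\<Sum>j<d 2. real (\<mu> j)) < (\<Sum>i<d 5. real (l i) * load d a (\<lambda>k. real (p k) / real q) u i)"
proof -
  let ?x = "\<lambda>k. real (p k) / real q"
  have DQ: "0 < real D * real q" using D q by simp
  have 1: "(\<Sum>j<d 1. \<Sum>k<d 0. c (ix_B d k i j) * int (p k) * int (u j)) \<le> c (d 3 + i) * int q \<longleftrightarrow>
      (\<Sum>j<d 1. \<Sum>k<d 0. a (ix_B d k i j) * ?x k * real (u j)) \<le> a (d 3 + i)" if i: "i < d 4" for i
  proof -
    have "(\<Sum>j<d 1. \<Sum>k<d 0. c (ix_B d k i j) * int (p k) * int (u j)) \<le> c (d 3 + i) * int q \<longleftrightarrow>
      real_of_int (\<Sum>j<d 1. \<Sum>k<d 0. c (ix_B d k i j) * int (p k) * int (u j)) \<le> real_of_int (c (d 3 + i) * int q)"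
      by (simp only: of_int_le_iff)
    also have "real_of_int (\<Sum>j<d 1. \<Sum>k<d 0. c (ix_B d k i j) * int (p k) * int (u j)) =
      (\<Sum>j<d 1. \<Sum>k<d 0. (real D * real q) * (a (ix_B d k i j) * ?x k * real (u j)))"
      using i q by (simp add: scaled(1) ix_less mult_ac)
    also have "\<dots> = (real D * real q) * (\<Sum>j<d 1. \<Sum>k<d 0. a (ix_B d k i j) * ?x k * real (u j))"
      by (simp only: sum_distrib_left)
    also have "real_of_int (c (d 3 + i) * int q) = (real D * real q) * a (d 3 + i)"
      using i by (simp add: scaled(1) ix_less mult_ac)
    finally show ?thesis unfolding mult_le_cancel_left_pos[OF DQ] .
  qed
  have 2: "0 \<le> (\<Sum>i<d 5. int (l i) * c (ix_W d i j)) + int D * int (\<mu> j) \<longleftrightarrow>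
      0 \<le> (\<Sum>i<d 5. real (l i) * a (ix_W d i j)) + real (\<mu> j)" if j: "j < d 2" for j
  proof -
    have "0 \<le> (\<Sum>i<d 5. int (l i) * c (ix_W d i j)) + int D * int (\<mu> j) \<longleftrightarrow>
      real_of_int 0 \<le> real_of_int ((\<Sum>i<d 5. int (l i) * c (ix_W d i j)) + int D * int (\<mu> j))"
      by (simp only: of_int_le_iff)
    also have "real_of_int ((\<Sum>i<d 5. int (l i) * c (ix_W d i j)) + int D * int (\<mu> j)) =
      (\<Sum>i<d 5. real D * (real (l i) * a (ix_W d i j))) + real D * real (\<mu> j)"
      using j by (simp add: scaled(1) ix_less mult_ac)
    also have "\<dots> = real D * ((\<Sum>i<d 5. real (l i) * a (ix_W d i j)) + real (\<mu> j))"
      by (simp only: sum_distrib_left distrib_left)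
    finally show ?thesis using D by (simp add: zero_le_mult_iff)
  qed
  have 3: "int R * int q * int D * (\<Sum>j<d 2. int (\<mu> j)) <
       (\<Sum>i<d 5. int (l i) * (\<Sum>j<d 0. \<Sum>k<d 1. c (ix_T d k i j) * int (u k) * int (p j))) \<longleftrightarrow>
      real R * (\<Sum>j<d 2. real (\<mu> j)) < (\<Sum>i<d 5. real (l i) * load d a ?x u i)"
  proof -
    let ?A = "int R * int q * int D * (\<Sum>j<d 2. int (\<mu> j))"
    let ?B = "\<Sum>i<d 5. int (l i) * (\<Sum>j<d 0. \<Sum>k<d 1. c (ix_T d k i j) * int (u k) * int (p j))"
    have A: "real_of_int ?A = (real D * real q) * (real R * (\<Sum>j<d 2. real (\<mu> j)))" by simp
    have "real_of_int (\<Sum>j<d 0. \<Sum>k<d 1. c (ix_T d k i j) * int (u k) * int (p j)) = (real D * real q) * load d a ?x u i"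
      if i: "i < d 5" for i
    proof -
      have "real_of_int (\<Sum>j<d 0. \<Sum>k<d 1. c (ix_T d k i j) * int (u k) * int (p j)) =
        (\<Sum>j<d 0. \<Sum>k<d 1. (real D * real q) * (a (ix_T d k i j) * real (u k) * ?x j))"
        using i q by (simp add: scaled(1) ix_less mult_ac)
      then show ?thesis by (simp only: sum_distrib_left load_def)
    qed
    then have "real_of_int ?B = (\<Sum>i<d 5. real (l i) * ((real D * real q) * load d a ?x u i))" by simp
    also have "\<dots> = (real D * real q) * (\<Sum>i<d 5. real (l i) * load d a ?x u i)"
      by (simp only: sum_distrib_left mult_ac)
    finally have B: "real_of_int ?B = (real D * real q) * (\<Sum>i<d 5. real (l i) * load d a ?x u i)" .
    have "?A < ?B \<longleftrightarrow> real_of_int ?A < real_of_int ?B" by (simp only: of_int_less_iff)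
    then show ?thesis unfolding A B using DQ by (simp only: mult_less_cancel_left_pos)
  qed
  show ?thesis unfolding refutes_def scenario_def certificate_def 3 using 1 2 by auto
qed

end

text \<open>Needed because components read from a certificate are known only at the indices that
  were packed into it.\<close>

lemma refutes_cong:
  assumes "\<And>k. k < d 1 \<Longrightarrow> u k = u' k" "\<And>i. i < d 5 \<Longrightarrow> l i = l' i" "\<And>j. j < d 2 \<Longrightarrow> \<mu> j = \<mu>' j"
    "\<And>k. k < d 0 \<Longrightarrow> p k = p' k" "\<And>j. j < entries d \<Longrightarrow> c j = c' j"
  shows "refutes d R c D q p u l \<mu> \<longleftrightarrow> refutes d R c' D q p' u' l' \<mu>'"
  unfolding refutes_def using assms ix_less[where d = d] by (simp cong: sum.cong_simp)

lemma first_stage_cong: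
  assumes "\<And>k. k < d 0 \<Longrightarrow> p k = p' k" "\<And>j. j < entries d \<Longrightarrow> c j = c' j"
  shows "first_stage d R c q p \<longleftrightarrow> first_stage d R c' q p'"
  unfolding first_stage_def using assms ix_less[where d = d] by (simp cong: sum.cong_simp)

text \<open>A certificate has at most \<open>4 * L\<close> components with at most
  \<open>10 * L * L * L + 1\<close> digits each; the latter is at most
  \<open>11 * L ^ 3\<close>.\<close>

lemma size_bound:
  fixes L :: nat
  assumes "1 \<le> L" "K \<le> 4 * L"
  shows "(10 * L * L * L + 1) * K \<le> 44 * L ^ 4"
proof -
  have "1 * 1 * 1 \<le> L * L * L" using assms(1) by (intro mult_le_mono)
  then have "10 * L * L * L + 1 \<le> 11 * (L * L * L)" by simp
  then have "(10 * L * L * L + 1) * K \<le> (11 * (L * L * L)) * (4 * L)" using assms(2) by (rule mult_le_mono)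
  then show ?thesis by (simp add: power4_eq_xxxx mult_ac)
qed

lemma power_bound:
  fixes L n :: nat
  assumes "n \<le> 2 ^ e" "e \<le> 10 * L * L * L"
  shows "n < 2 ^ (10 * L * L * L + 1)"
proof -
  have "(2 :: nat) ^ e < 2 ^ (10 * L * L * L + 1)" using assms(2) by (intro power_strict_increasing) auto
  then show ?thesis by (rule le_less_trans[OF assms(1)])
qed

text \<open>A \<open>Y\<close> of whatever length fails against this \<open>X\<close>: a refutation
  contradicts weak duality, and a common divisor contradicts lowest terms.\<close>

lemma verifier_complete:
  assumes "I \<in> Bounded_Two_Stage"
  shows "\<exists>X. length X \<le> 44 * length I ^ 4 \<and> (\<forall>Y. verifier (I, X, Y))"
proof -
  let ?d = "dims I" and ?R = "bound_of I" and ?a = "real_entries I" and ?L = "length I" and ?D = "prod_denom I"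
  have wf: "well_formed I" and cop: "\<And>j. j < entries ?d \<Longrightarrow> coprime (numer I j) (denom I j)"
    and "\<exists>x. solves ?d ?R ?a x" using assms unfolding Bounded_Two_Stage_iff by auto
  note sz = encoding_sizes[OF wf cop]
  interpret small_instance ?d ?R ?L ?D "scaled_entry I" ?a by (rule small_instance_encoding[OF wf cop])
  obtain p q where pq: "0 < q" "q \<le> 2 ^ (10 * ?L * ?L * ?L)" "\<And>k. k < ?d 0 \<Longrightarrow> p k \<le> 2 ^ (10 * ?L * ?L * ?L)"
    "solves ?d ?R ?a (\<lambda>k. real (p k) / real q)"
    using small_first_stage \<open>\<exists>x. solves ?d ?R ?a x\<close> by blast
  define b where "b = 10 * ?L * ?L * ?L + 1"
  define K where "K = 2 + ?d 0 + entries ?d"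
  define v where "v k = (if k = 0 then ?D else if k = 1 then q else if k < 2 + ?d 0 then p (k - 2)
     else scaled_numer I (k - (2 + ?d 0)))" for k
  define X where "X = pack b K v"
  have L1: "1 \<le> ?L" using sz(1) by simp
  have LLL: "2 * ?L \<le> 10 * ?L * ?L * ?L"
  proof -
    have "?L * 1 * 1 \<le> ?L * ?L * ?L" using L1 by (intro mult_le_mono) auto
    then show ?thesis by simp
  qed
  have v_less: "v k < 2 ^ b" if "k < K" for k
  proof -
    have twice: "x \<le> 2 * x" for x :: nat by simp
    have "?D < 2 ^ b" unfolding b_def by (rule power_bound[OF sz(4) order_trans[OF twice LLL]])
    moreover have "q < 2 ^ b" unfolding b_def by (rule power_bound[OF pq(2) order_refl])
    moreover have "p k < 2 ^ b" if "k < ?d 0" for k unfolding b_def by (rule power_bound[OF pq(3)[OF that] order_refl])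
    moreover have "scaled_numer I j < 2 ^ b" for j unfolding b_def by (rule power_bound[OF scaled_numer_le[OF sz(4)] LLL])
    ultimately show ?thesis by (auto simp: v_def)
  qed
  have cX: "cert_X (I, X, Y) k = v k" if "k < K" for k Y
    using unpack_pack[where k = k and K = K and v = v and b = b, OF that v_less[OF that]] by (simp add: cert_X_def X_def K_def)
  have cX0: "cert_X (I, X, Y) 0 = ?D" "cert_X (I, X, Y) 1 = q" for Y using cX[of 0] cX[of 1] by (simp_all add: K_def v_def)
  have cXp: "cert_X (I, X, Y) (2 + k) = p k" if "k < ?d 0" for k Y using cX[of "2 + k"] that by (simp add: K_def v_def)
  have cXN: "cert_X (I, X, Y) (2 + ?d 0 + j) = scaled_numer I j" if "j < entries ?d" for j Y
    using cX[of "2 + ?d 0 + j"] that by (simp add: K_def v_def)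
  have co: "coeff (I, X, Y) j = scaled_entry I j" if "j < entries ?d" for j Y
    using cXN[OF that] by (simp add: coeff_def scaled_entry_def)
  have "verifier (I, X, Y)" for Y
    unfolding verifier_def fst_conv snd_conv cX0
  proof (intro conjI allI impI)
    show "well_formed I" by (rule wf)
    show "0 < int ?D" "0 < int q" using sz(3) pq(1) by simp_all
    show "int (cert_X (I, X, Y) (2 + ?d 0 + j)) * int (denom I j) = int (numer I j) * int ?D" if "j < entries ?d" for j
      unfolding cXN[OF that] of_nat_mult[symmetric] scaled_numer_denom[OF that] ..
    have "first_stage ?d ?R (scaled_entry I) q p \<longleftrightarrow> stage_X ?d ?R ?a (\<lambda>k. real (p k) / real q)"
      by (rule first_stage_iff[OF _ D_pos pq(1)]) (rule a_eq)
    then have "first_stage ?d ?R (scaled_entry I) q p" using pq(4) by (simp add: solves_def)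
    then show "first_stage ?d ?R (coeff (I, X, Y)) q (\<lambda>k. cert_X (I, X, Y) (2 + k))"
      using first_stage_cong[of ?d "\<lambda>k. cert_X (I, X, Y) (2 + k)" p "coeff (I, X, Y)" "scaled_entry I" ?R q] cXp co by simp
    have "\<not> refutes ?d ?R (scaled_entry I) ?D q p u l \<mu>" for u l \<mu>
    proof
      assume "refutes ?d ?R (scaled_entry I) ?D q p u l \<mu>"
      moreover have "refutes ?d ?R (scaled_entry I) ?D q p u l \<mu> \<longleftrightarrow>
          scenario ?d ?R ?a (\<lambda>k. real (p k) / real q) u \<and> certificate ?d ?a (\<lambda>i. real (l i)) (\<lambda>j. real (\<mu> j)) \<and>
          real ?R * (\<Sum>j<?d 2. real (\<mu> j)) < (\<Sum>i<?d 5. real (l i) * load ?d ?a (\<lambda>k. real (p k) / real q) u i)"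
        by (rule refutes_iff[OF _ D_pos pq(1)]) (rule a_eq)
      ultimately have r: "scenario ?d ?R ?a (\<lambda>k. real (p k) / real q) u" "certificate ?d ?a (\<lambda>i. real (l i)) (\<lambda>j. real (\<mu> j))"
        "real ?R * (\<Sum>j<?d 2. real (\<mu> j)) < (\<Sum>i<?d 5. real (l i) * load ?d ?a (\<lambda>k. real (p k) / real q) u i)"
        by blast+
      have "recourse ?d ?R ?a (\<lambda>k. real (p k) / real q) u" using pq(4) r(1) by (simp add: solves_def)
      from weak_duality[OF this r(2)] r(3) show False by simp
    qed
    then show "\<not> refutes ?d ?R (coeff (I, X, Y)) ?D q (\<lambda>k. cert_X (I, X, Y) (2 + k)) (cert_Y (I, X, Y))
        (\<lambda>i. cert_Y (I, X, Y) (?d 1 + i)) (\<lambda>j. cert_Y (I, X, Y) (?d 1 + ?d 5 + j))"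
      using refutes_cong[of ?d "cert_Y (I, X, Y)" "cert_Y (I, X, Y)" "\<lambda>i. cert_Y (I, X, Y) (?d 1 + i)" "\<lambda>i. cert_Y (I, X, Y) (?d 1 + i)"
          "\<lambda>j. cert_Y (I, X, Y) (?d 1 + ?d 5 + j)" "\<lambda>j. cert_Y (I, X, Y) (?d 1 + ?d 5 + j)"
          "\<lambda>k. cert_X (I, X, Y) (2 + k)" p "coeff (I, X, Y)" "scaled_entry I" ?R ?D q] cXp co by simp
    fix j assume j: "j < entries ?d"
    show "\<not> (1 < int (unpack Y 3 0) \<and> int (numer I j) = int (unpack Y 3 0) * int (unpack Y 3 1) \<and>
        int (denom I j) = int (unpack Y 3 0) * int (unpack Y 3 2))"
    proof
      assume g: "1 < int (unpack Y 3 0) \<and> int (numer I j) = int (unpack Y 3 0) * int (unpack Y 3 1) \<and>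
        int (denom I j) = int (unpack Y 3 0) * int (unpack Y 3 2)"
      then have "unpack Y 3 0 dvd numer I j" "unpack Y 3 0 dvd denom I j"
        unfolding of_nat_mult[symmetric] of_nat_eq_iff by auto
      then have "unpack Y 3 0 dvd 1" using cop[OF j] by (metis coprime_common_divisor)
      then show False using g by simp
    qed
  qed
  moreover have "length X \<le> 44 * ?L ^ 4"
    unfolding X_def length_pack b_def using sz(1,2) L1 by (intro size_bound) (simp_all add: K_def)
  ultimately show ?thesis by blast
qed

text \<open>A fraction not in lowest terms or a scenario without recourse would yield a
  \<open>Y\<close> within the length bound that makes the verifier reject. Lowest terms come first,
  because the size estimates for the multipliers depend on them.\<close>

lemma verifier_sound:
  assumes ver: "\<And>Y. length Y \<le> 44 * length I ^ 4 \<Longrightarrow> verifier (I, X, Y)"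
  shows "I \<in> Bounded_Two_Stage"
proof -
  let ?d = "dims I" and ?R = "bound_of I" and ?a = "real_entries I" and ?L = "length I"
  have "verifier (I, X, [])" by (rule ver) simp
  then have wf: "well_formed I" and D0: "0 < cert_X (I, X, []) 0" and q0: "0 < cert_X (I, X, []) 1"
    and N0: "\<And>j. j < entries ?d \<Longrightarrow>
      int (cert_X (I, X, []) (2 + ?d 0 + j)) * int (denom I j) = int (numer I j) * int (cert_X (I, X, []) 0)"
    and fs: "first_stage ?d ?R (coeff (I, X, [])) (cert_X (I, X, []) 1) (\<lambda>k. cert_X (I, X, []) (2 + k))"
    by (simp_all add: verifier_def)
  define D q p c where "D = cert_X (I, X, []) 0" and "q = cert_X (I, X, []) 1"
    and "p k = cert_X (I, X, []) (2 + k)" and "c = coeff (I, X, [])" for k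
  \<comment> \<open>The facts extracted with the empty \<open>Y\<close> concern only
    \<open>I\<close> and \<open>X\<close> and therefore carry over to every
    \<open>Y\<close>.\<close>
  have indep: "cert_X (I, X, Y) = cert_X (I, X, [])" "coeff (I, X, Y) = coeff (I, X, [])" for Y
    by (auto simp: cert_X_def coeff_def fun_eq_iff)
  have L1: "1 \<le> ?L"
    using wf nat_end_gt[of "dim_pos I 6" I] entry_pos_mono[of 0 "entries ?d" I]
    by (simp add: well_formed_def entry_pos_0)
  have len: "length (pack b K v) \<le> 44 * ?L ^ 4" if "b \<le> 10 * ?L * ?L * ?L + 1" "K \<le> 4 * ?L" for b K v
    unfolding length_pack using size_bound[OF L1 that(2)] mult_le_mono1[OF that(1), of K] by linarith
  have den: "0 < denom I j" if "j < entries ?d" for j by (rule well_formed_denom_pos[OF wf that])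
  have LLL: "?L \<le> 10 * ?L * ?L * ?L" "3 * ?L * ?L \<le> 10 * ?L * ?L * ?L"
  proof -
    have "?L * (1 * 1) \<le> ?L * (?L * ?L)" "?L * (?L * 1) \<le> ?L * (?L * ?L)" using L1 by (intro mult_le_mono; simp)+
    then have "?L \<le> ?L * (?L * ?L)" "?L * ?L \<le> ?L * (?L * ?L)" by (simp_all only: mult_1_right)
    moreover have "x \<le> y \<Longrightarrow> x \<le> 10 * y" "x \<le> y \<Longrightarrow> 3 * x \<le> 10 * y" for x y :: nat by linarith+
    ultimately show "?L \<le> 10 * ?L * ?L * ?L" "3 * ?L * ?L \<le> 10 * ?L * ?L * ?L" unfolding mult.assoc by blast+
  qed
  have cop: "coprime (numer I j) (denom I j)" if j: "j < entries ?d" for j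
  proof (rule ccontr)
    assume nc: "\<not> coprime (numer I j) (denom I j)"
    define g where "g = gcd (numer I j) (denom I j)"
    have "g \<noteq> 0" "g \<noteq> 1" using den[OF j] nc by (auto simp: g_def coprime_iff_gcd_eq_1)
    then have g: "1 < g" by simp
    have gd: "numer I j = g * (numer I j div g)" "denom I j = g * (denom I j div g)" by (simp_all add: g_def)
    define v where "v k = [g, numer I j div g, denom I j div g] ! k" for k
    have "g \<le> denom I j" using den[OF j] unfolding g_def by (intro dvd_imp_le) auto
    have n: "numer I j < 2 ^ ?L" "denom I j < 2 ^ ?L" unfolding numer_def denom_def by (rule nat_at_less)+
    have v: "v 0 < 2 ^ ?L" "v 1 < 2 ^ ?L" "v 2 < 2 ^ ?L"
      using le_less_trans[OF \<open>g \<le> denom I j\<close> n(2)] le_less_trans[OF div_le_dividend n(1), of g]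
        le_less_trans[OF div_le_dividend n(2), of g] by (simp_all add: v_def)
    define Y where "Y = pack ?L 3 v"
    have "unpack Y 3 0 = g" "unpack Y 3 1 = numer I j div g" "unpack Y 3 2 = denom I j div g"
      unfolding Y_def using unpack_pack[of 0 3 v ?L] unpack_pack[of 1 3 v ?L] unpack_pack[of 2 3 v ?L] v
      by (simp_all add: v_def)
    moreover have "verifier (I, X, Y)" unfolding Y_def
      by (rule ver[OF len[OF trans_le_add1[OF LLL(1)]]]) (use L1 in linarith)
    ultimately have "\<not> (1 < int g \<and> int (numer I j) = int g * int (numer I j div g) \<and> int (denom I j) = int g * int (denom I j div g))"
      using j by (simp add: verifier_def)
    then show False using g gd unfolding of_nat_mult[symmetric] by simp
  qed
  note sz = encoding_sizes[OF wf cop]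
  \<comment> \<open>The size bounds are derived with the product of the denominators, whereas
    \<open>X\<close> may use another common denominator. The multipliers of
    \<open>small_certificate\<close> refer to the entries themselves and fit both.\<close>
  interpret small_instance ?d ?R ?L "prod_denom I" "scaled_entry I" ?a by (rule small_instance_encoding[OF wf cop])
  have a: "?a j = of_int (c j) / of_nat D" if j: "j < entries ?d" for j
  proof -
    have "real_of_int (int (cert_X (I, X, []) (2 + ?d 0 + j)) * int (denom I j)) = real_of_int (int (numer I j) * int D)"
      using N0[OF j] by (simp only: D_def)
    then have "real (cert_X (I, X, []) (2 + ?d 0 + j)) * real (denom I j) = real (numer I j) * real D" by simp
    then show ?thesis using den[OF j] D0 unfolding real_entry[OF den[OF j]] c_def D_def coeff_def
      by (simp add: frac_eq_eq)
  qed
  have D: "0 < D" and q: "0 < q" using D0 q0 by (simp_all add: D_def q_def)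
  let ?x = "\<lambda>k. real (p k) / real q"
  have "first_stage ?d ?R c q p" using fs by (simp add: c_def q_def p_def[abs_def])
  then have X: "stage_X ?d ?R ?a ?x" 
    using first_stage_iff[where d = ?d and a = ?a and c = c and D = D and q = q and R = ?R and p = p, OF a D q] by blast
  have "recourse ?d ?R ?a ?x u" if sc: "scenario ?d ?R ?a ?x u" for u
  proof (rule ccontr)
    assume "\<not> recourse ?d ?R ?a ?x u"
    from small_certificate[OF this] obtain l \<mu> where l: "\<And>i. i < ?d 5 \<Longrightarrow> l i \<le> 2 ^ (3 * ?L * ?L)"
      "\<And>j. j < ?d 2 \<Longrightarrow> \<mu> j \<le> 2 ^ (3 * ?L * ?L)" "certificate ?d ?a (\<lambda>i. real (l i)) (\<lambda>j. real (\<mu> j))"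
      "real ?R * (\<Sum>j<?d 2. real (\<mu> j)) < (\<Sum>i<?d 5. real (l i) * load ?d ?a ?x u i)" by blast
    define b where "b = 10 * ?L * ?L * ?L + 1"
    define K where "K = ?d 1 + ?d 5 + ?d 2"
    define v where "v k = (if k < ?d 1 then u k else if k < ?d 1 + ?d 5 then l (k - ?d 1) else \<mu> (k - (?d 1 + ?d 5)))" for k
    have v_less: "v k < 2 ^ b" if "k < K" for k
    proof -
      have "u k < 2 ^ b" if "k < ?d 1" for k
      proof -
        have "u k \<le> 2 ^ ?L" using sc that R_le by (auto simp: scenario_def intro: order_trans)
        then show ?thesis unfolding b_def using LLL(1) by (rule power_bound)
      qed
      moreover have "l i < 2 ^ b" if "i < ?d 5" for i unfolding b_def by (rule power_bound[OF l(1)[OF that] LLL(2)])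
      moreover have "\<mu> j < 2 ^ b" if "j < ?d 2" for j unfolding b_def by (rule power_bound[OF l(2)[OF that] LLL(2)])
      ultimately show ?thesis using that by (auto simp: v_def K_def)
    qed
    define Y where "Y = pack b K v"
    have cY: "cert_Y (I, X, Y) k = v k" if "k < K" for k
      using unpack_pack[where k = k and K = K and v = v and b = b, OF that v_less[OF that]] by (simp add: cert_Y_def Y_def K_def)
    have "refutes ?d ?R c D q p u l \<mu>" 
      using refutes_iff[where d = ?d and a = ?a and c = c and D = D and q = q and R = ?R and p = p
          and u = u and l = l and \<mu> = \<mu>, OF a D q] sc l(3,4) by blast
    moreover have "refutes ?d ?R c D q p u l \<mu> \<longleftrightarrow> refutes ?d ?R c D q p (cert_Y (I, X, Y))
        (\<lambda>i. cert_Y (I, X, Y) (?d 1 + i)) (\<lambda>j. cert_Y (I, X, Y) (?d 1 + ?d 5 + j))"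
      by (rule refutes_cong) (simp_all add: cY K_def v_def)
    moreover have "verifier (I, X, Y)" unfolding Y_def
      by (intro ver len) (use sz(1) in \<open>simp_all add: b_def K_def\<close>)
    ultimately show False
      by (simp add: verifier_def indep[of Y] c_def D_def q_def p_def[abs_def])
  qed
  then have "solves ?d ?R ?a ?x" using X by (simp add: solves_def)
  then show ?thesis unfolding Bounded_Two_Stage_iff using wf cop by blast
qed

theorem theorem16:
  shows "Bounded_Two_Stage \<in> Sigma2p"
proof -
  let ?P = "\<lambda>I X Y. verifier (I, X, Y)" and ?p = "monom 44 4 :: nat poly"
  have "I \<in> Bounded_Two_Stage \<longleftrightarrow> (\<exists>X. length X \<le> poly ?p (length I) \<and>
      (\<forall>Y. length Y \<le> poly ?p (length I) \<longrightarrow> ?P I X Y))" for I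
    unfolding poly_monom using verifier_complete[of I] verifier_sound[of I] by blast
  then show ?thesis unfolding Sigma2p_def using polytime_verifier by blast
qed

end
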